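(* Let $c>1$, $m(\xi)=\sqrt{\frac{\tanh(\xi)}{\xi}}$, and let $\delta_c\in(0,\frac{\pi}{2})$ satisfy $\sqrt{\frac{\tan(\delta_c)}{\delta_c}}=c$. Then, for $H_c=\mathscr{F}^{-1}\left(\frac{m}{c-m}\right)$, $$H_c(x)=\mathrm{e}^{-\delta_c|x|}\left(v(x)+\sqrt{2\pi}\,\frac{2\tan(\delta_c)\,\delta_c}{\delta_c\sec^2(\delta_c)-\tan(\delta_c)}\right)$$ for some even function $v\in L^p(\{x\in\mathbb{R}:|x|\ge 1\})$ for all $1\le p\le\infty$ that satisfies $v(x)\simeq|x|^{-1/2}$ for $|x|<1$. Moreover, if $u\in L^\infty(\mathbb{R})$ with $\lim_{|x|\to\infty}u(x)=0$ is a non-trivial solution to $$u(c-u)=H_c*u^2,$$ then, for $p\in[1,\infty]$, $$\mathrm{e}^{\delta_c|\cdot|}u(\cdot)\in L^p(\mathbb{R})\quad\text{if and only if}\quad p=\infty.$$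
   Context: The inverse Fourier transform is normalized by $\mathscr{F}^{-1}(\varphi)(x)=\frac{1}{\sqrt{2\pi}}\int_{\mathbb{R}}\varphi(\xi)\mathrm{e}^{ix\xi}\,\mathrm{d}\xi$ (in the sense of tempered distributions where necessary), and $(f*g)(x)=\int_{\mathbb{R}}f(x-y)g(y)\,\mathrm{d}y$. $m(0)=1$ by continuity. $A\simeq B$ means that each of $A,B$ is bounded by a positive constant times the other. *)

theory Defs
  imports "HOL-Analysis.Analysis" "HOL-Probability.Essential_Supremum"
begin

definition whitham_symbol :: "real \<Rightarrow> real" where
  "whitham_symbol \<xi> = (if \<xi> = 0 then 1 else sqrt (tanh \<xi> / \<xi>))"

definition Lp :: "ennreal \<Rightarrow> 'a measure \<Rightarrow> ('a \<Rightarrow> real) set" where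
  "Lp p M = {f \<in> borel_measurable M.
     if p = \<infinity> then esssup M (\<lambda>x. ereal \<bar>f x\<bar>) < \<infinity>
     else (\<integral>\<^sup>+ x. ennreal (\<bar>f x\<bar> powr enn2real p) \<partial>M) < \<infinity>}"

text \<open>The function \<open>D k\<close> is the \<open>k\<close>-th derivative of \<open>\<phi>\<close>.\<close>

definition schwartz :: "(real \<Rightarrow> complex) \<Rightarrow> bool" where
  "schwartz \<phi> \<longleftrightarrow> (\<exists>D :: nat \<Rightarrow> real \<Rightarrow> complex.
     D 0 = \<phi> \<and>
     (\<forall>k x. (D k has_vector_derivative D (Suc k) x) (at x)) \<and>
     (\<forall>j k. bounded (range (\<lambda>x. x ^ j *\<^sub>R D k x))))"

definition inv_fourier :: "(real \<Rightarrow> complex) \<Rightarrow> real \<Rightarrow> complex" where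
  "inv_fourier \<phi> x =
     of_real (1 / sqrt (2 * pi)) *
     (\<integral>\<xi>. \<phi> \<xi> * exp (\<i> * of_real (x * \<xi>)) \<partial>lebesgue)"

text \<open>Functions that are integrable against a polynomial weight. These define tempered
  distributions by integration, and two of them that define the same distribution agree almost
  everywhere.\<close>

definition tempered_fun :: "(real \<Rightarrow> complex) \<Rightarrow> bool" where
  "tempered_fun f \<longleftrightarrow> (\<exists>N :: nat. integrable lebesgue (\<lambda>x. f x / of_real ((1 + \<bar>x\<bar>) ^ N)))"

text \<open>The tempered distribution defined by \<open>g\<close> is the inverse Fourier transform of the one
  defined by \<open>f\<close>. The pairing of a function with a test function is bilinear (no conjugation),
  so that the inverse transform is moved to the test function unchanged.\<close>

definition is_tempered_inv_fourier :: "(real \<Rightarrow> complex) \<Rightarrow> (real \<Rightarrow> complex) \<Rightarrow> bool" where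
  "is_tempered_inv_fourier f g \<longleftrightarrow>
     tempered_fun f \<and> tempered_fun g \<and>
     (\<forall>\<phi>. schwartz \<phi> \<longrightarrow>
        (\<integral>x. g x * \<phi> x \<partial>lebesgue) = (\<integral>\<xi>. f \<xi> * inv_fourier \<phi> \<xi> \<partial>lebesgue))"

text \<open>\<open>H\<close> is a representative, unique up to null sets, of \<open>H\<^sub>c\<close>, the inverse Fourier transform of
  \<open>m / (c - m)\<close>. This symbol decays only like \<open>\<bar>\<xi>\<bar> powr (- 1 / 2)\<close>, so it is neither integrable
  nor square-integrable and the transform has to be taken in the distributional sense.\<close>

definition is_whitham_kernel :: "real \<Rightarrow> (real \<Rightarrow> real) \<Rightarrow> bool" where
  "is_whitham_kernel c H \<longleftrightarrow>
     is_tempered_inv_fourier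
       (\<lambda>\<xi>. of_real (whitham_symbol \<xi> / (c - whitham_symbol \<xi>)))
       (\<lambda>x. of_real (H x))"

definition fun_convolution :: "(real \<Rightarrow> real) \<Rightarrow> (real \<Rightarrow> real) \<Rightarrow> real \<Rightarrow> real" where
  "fun_convolution f g x = (\<integral>y. f (x - y) * g y \<partial>lebesgue)"

definition simeq_on :: "'a set \<Rightarrow> ('a \<Rightarrow> real) \<Rightarrow> ('a \<Rightarrow> real) \<Rightarrow> bool" where
  "simeq_on S f g \<longleftrightarrow>
     (\<exists>C>0. \<forall>x\<in>S. f x \<le> C * g x) \<and> (\<exists>C>0. \<forall>x\<in>S. g x \<le> C * f x)"

end

theory Submission
  imports Defs "HOL-Probability.Levy" "HOL-Probability.Sinc_Integral" "HOL-Real_Asymp.Real_Asymp"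
    "HOL-Computational_Algebra.Polynomial"
begin

text \<open>Write \<open>S \<xi> = tanh \<xi> / \<xi>\<close>, \<open>m = sqrt S\<close>. The symbol splits as
  \<open>m / (c - m) = 2 S / (c\<^sup>2 - S) + m / (c + m)\<close>, and
  \<open>m / (c + m)\<close> is the integral of \<open>(c / \<pi>) / (r\<^sup>2 + c\<^sup>2) \<cdot> S / (r\<^sup>2 + S)\<close> over real \<open>r\<close>.
  Truncating the partial fraction series of \<open>S\<close> turns \<open>S / (t + S)\<close> and \<open>S / (c\<^sup>2 - S)\<close>
  into rational functions of \<open>\<xi>\<^sup>2\<close> whose poles interlace with those of \<open>S\<close>; their residues are positive,
  so their inverse transforms are positive combinations of functions \<open>exp (- y \<bar>x\<bar>)\<close> with
  \<open>y \<ge> \<pi> / 2\<close>, except for the single pole \<open>\<i> \<delta>\<close> of the second one, which yields the explicit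
  exponential. Positivity, monotonicity and the decay rate \<open>\<pi> / 2\<close> survive the limit, and
  a Tauberian argument reads the singularity at the origin off the size of the symbol.

  For a solution, positivity of the kernel forces \<open>0 < u < c\<close>, hence \<open>u\<close> is bounded below by a multiple of
  \<open>exp (- \<delta> \<bar>x\<bar>)\<close>. Conversely, for each rate below \<open>\<delta>\<close>, a contraction argument in weighted
  sup norms gives exponential decay of \<open>u\<close>; then \<open>u\<^sup>2\<close> decays faster than \<open>exp (- \<delta> \<bar>x\<bar>)\<close>, and one more
  application of the equation yields the rate \<open>\<delta>\<close> itself.\<close>

section \<open>Partial fractions of tanh and tan\<close>

text \<open>On the imaginary axis \<open>tanh \<xi> / \<xi>\<close> becomes
  \<open>tan y / y\<close>, with poles at the numbers \<open>pole k\<close> and zeros in between.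
  Its square root therefore has branch points from \<open>\<i> * pi / 2\<close> onwards; rational
  truncations replace a contour deformation around these cuts. What is carried through sums, limits
  and mixtures is a class of kernels, all of whose conditions are linear in the kernel. One of them,
  a midpoint inequality, is a linearized form of logarithmic convexity: the Tauberian argument
  bounds a kernel from below only very close to the origin, and a merely decreasing kernel could
  vanish further out. In the limit, the truncations of \<open>tanh \<xi> / \<xi>\<close> have no
  common integrable majorant, but their squares do; hence a multiple of the truncated series is
  always split off and inverted by hand. For solutions, the weighted supremum is not known to be
  finite beforehand, so the weight is cut off at a level \<open>n\<close> and the bounds are made
  independent of \<open>n\<close>.\<close>

definition pole :: "nat \<Rightarrow> real" where "pole k = (real k + 1 / 2) * pi"

lemma pole_pos: "pole k > 0"
  by (simp add: pole_def add_nonneg_pos)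

lemma pole_0: "pole 0 = pi / 2"
  by (simp add: pole_def)

lemma pole_strict_mono: "strict_mono pole"
  by (auto simp: strict_mono_def pole_def)

lemma pole_ge: "pi / 2 \<le> pole k"
  using pole_strict_mono[THEN strict_mono_less_eq, of 0 k] by (simp add: pole_0)

lemma summable_inverse_pole_sq: "summable (\<lambda>k. 1 / (pole k)\<^sup>2)"
proof (rule summable_comparison_test')
  show "summable (\<lambda>k. inverse (real k ^ 2))"
    by (rule inverse_power_summable) simp
  fix k :: nat assume k: "k \<ge> 1"
  have "real k * 1 \<le> (real k + 1 / 2) * pi"
    using pi_gt3 by (intro mult_mono) auto
  then have "(real k)\<^sup>2 \<le> (pole k)\<^sup>2"
    by (intro power_mono) (auto simp: pole_def)
  then show "norm (1 / (pole k)\<^sup>2) \<le> inverse (real k ^ 2)"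
    using k by (simp add: divide_simps)
qed

section \<open>Infinite products for cos and cosh\<close>

lemma prod_even_odd_split:
  fixes f :: "nat \<Rightarrow> 'a :: comm_monoid_mult"
  shows "(\<Prod>k=1..2*n. f k) = (\<Prod>k=1..n. f (2 * k)) * (\<Prod>k<n. f (2 * k + 1))"
  by (induction n) (simp_all add: mult_ac)

text \<open>\<open>cos z = sin (2 * z) / (2 * sin z)\<close>: in Euler's product for the numerator
  the even-indexed factors are those of \<open>sin z\<close> and cancel; the odd-indexed ones, with
  zeros at plus and minus \<open>pole k\<close>, remain.\<close>

lemma cos_product_formula:
  fixes z :: complex
  assumes "sin z \<noteq> 0"
  shows "(\<lambda>n. \<Prod>k<n. 1 - z\<^sup>2 / of_real ((pole k)\<^sup>2)) \<longlonglongrightarrow> cos z"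
proof -
  define w where "w = z / of_real pi"
  have z: "z = of_real pi * w" by (simp add: w_def)
  have w0: "w \<noteq> 0" using assms by (auto simp: z)
  let ?P = "\<lambda>n w. of_real pi * w * (\<Prod>k=1..n. 1 - w^2 / of_nat k^2) :: complex"
  have 1: "(\<lambda>n. ?P n w) \<longlonglongrightarrow> sin z"
    unfolding z by (rule sin_product_formula_complex)
  have "(\<lambda>n. ?P n (2 * w)) \<longlonglongrightarrow> sin (of_real pi * (2 * w))"
    by (rule sin_product_formula_complex)
  \<comment> \<open>Cut at \<open>2 * n\<close>, the product for \<open>2 * w\<close> holds exactly
    the \<open>n\<close> factors of the product for \<open>w\<close> and \<open>n\<close> odd ones,
    so the quotient is a finite product for each \<open>n\<close>.\<close>
  then have 2: "(\<lambda>n. ?P (2 * n) (2 * w)) \<longlonglongrightarrow> sin (2 * z)"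
    using LIMSEQ_subseq_LIMSEQ[of _ _ "\<lambda>n. 2 * n"] 
    by (force simp: strict_mono_def o_def z mult_ac)
  have "(\<lambda>n. ?P (2 * n) (2 * w) / (2 * ?P n w)) \<longlonglongrightarrow> sin (2 * z) / (2 * sin z)"
    using 1 2 assms by (intro tendsto_intros) auto
  also have "sin (2 * z) / (2 * sin z) = cos z"
    using assms by (simp add: sin_double)
  finally have 3: "(\<lambda>n. ?P (2 * n) (2 * w) / (2 * ?P n w)) \<longlonglongrightarrow> cos z" .
  have "\<forall>\<^sub>F n in sequentially. ?P n w \<noteq> 0"
    using tendsto_imp_eventually_ne[OF 1 assms] .
  then have "\<forall>\<^sub>F n in sequentially. ?P (2 * n) (2 * w) / (2 * ?P n w)
      = (\<Prod>k<n. 1 - z\<^sup>2 / of_real ((pole k)\<^sup>2))"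
  proof eventually_elim
    case (elim n)
    have a: "(\<Prod>k=1..n. 1 - (2 * w)\<^sup>2 / (of_nat (2 * k))\<^sup>2) = (\<Prod>k=1..n. 1 - w\<^sup>2 / (of_nat k)\<^sup>2)"
      by (intro prod.cong refl) (auto simp: power_mult_distrib)
    have b: "(\<Prod>k<n. 1 - (2 * w)\<^sup>2 / (of_nat (2 * k + 1))\<^sup>2) = (\<Prod>k<n. 1 - z\<^sup>2 / of_real ((pole k)\<^sup>2))"
    proof (intro prod.cong refl)
      have nz: "(of_nat (2 * k + 1) :: complex) \<noteq> 0" for k by (simp only: of_nat_eq_0_iff)
      fix k
      have "pole k = real (2 * k + 1) * pi / 2" by (simp add: pole_def field_simps)
      then have e: "of_real (pole k) = (of_nat (2 * k + 1) * of_real pi / 2 :: complex)"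
        by (simp only: of_real_mult of_real_divide of_real_of_nat_eq of_real_numeral)
      show "1 - (2 * w)\<^sup>2 / (of_nat (2 * k + 1))\<^sup>2 = 1 - z\<^sup>2 / of_real ((pole k)\<^sup>2)"
        unfolding z of_real_power e using nz[of k] by (simp add: power_mult_distrib power_divide del: of_nat_add of_nat_Suc)
    qed
    show ?case
      unfolding prod_even_odd_split a b using elim by (simp add: field_simps)
  qed
  then show ?thesis
    by (rule Lim_transform_eventually[OF 3])
qed

lemma cosh_product_formula:
  fixes x :: real
  assumes "x \<noteq> 0"
  shows "(\<lambda>n. \<Prod>k<n. 1 + x\<^sup>2 / (pole k)\<^sup>2) \<longlonglongrightarrow> cosh x"
proof -
  have "sin (\<i> * of_real x) = \<i> * of_real (sinh x)"
    by (simp add: sin_conv_sinh sinh_def scaleR_conv_of_real algebra_simps flip: exp_of_real)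
  then have "sin (\<i> * of_real x :: complex) \<noteq> 0" using assms by simp
  from cos_product_formula[OF this]
  have "(\<lambda>n. complex_of_real (\<Prod>k<n. 1 + x\<^sup>2 / (pole k)\<^sup>2)) \<longlonglongrightarrow> cos (\<i> * of_real x)"
    by (simp add: power_mult_distrib)
  also have "cos (\<i> * of_real x :: complex) = of_real (cosh x)"
    by (simp add: cos_conv_cosh cosh_def scaleR_conv_of_real flip: exp_of_real)
  finally show ?thesis by (simp only: tendsto_of_real_iff)
qed

lemma cos_product_formula_real:
  fixes x :: real
  assumes "0 < x" "x < pi"
  shows "(\<lambda>n. \<Prod>k<n. 1 - x\<^sup>2 / (pole k)\<^sup>2) \<longlonglongrightarrow> cos x"
proof -
  have "sin (of_real x :: complex) \<noteq> 0" 
    using sin_gt_zero[of x] assms by (simp add: sin_of_real)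
  from cos_product_formula[OF this]
  have "(\<lambda>n. complex_of_real (\<Prod>k<n. 1 - x\<^sup>2 / (pole k)\<^sup>2)) \<longlonglongrightarrow> of_real (cos x)"
    by (simp add: cos_of_real)
  then show ?thesis by (simp only: tendsto_of_real_iff)
qed

section \<open>Partial fractions by logarithmic differentiation\<close>

lemma summable_tanh_terms: "summable (\<lambda>k. 2 / (x\<^sup>2 + (pole k)\<^sup>2))"
proof (rule summable_comparison_test'[OF summable_mult[OF summable_inverse_pole_sq, of 2]])
  fix k show "norm (2 / (x\<^sup>2 + (pole k)\<^sup>2)) \<le> 2 * (1 / (pole k)\<^sup>2)"
    using pole_pos[of k] by (simp add: frac_le)
qed

text \<open>The logarithm of the product for cosh is a series; its termwise derivative sums to
  \<open>tanh x\<close>, and every term contains the factor \<open>x\<close>.\<close>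

lemma tanh_partial_fractions:
  fixes x :: real
  assumes x: "x > 0"
  shows "(\<lambda>k. 2 / (x\<^sup>2 + (pole k)\<^sup>2)) sums (tanh x / x)"
proof -
  define f where "f = (\<lambda>k y. ln (1 + y\<^sup>2 / (pole k)\<^sup>2))"
  define f' where "f' = (\<lambda>k y. 2 * y / (y\<^sup>2 + (pole k)\<^sup>2))"
  have f_sums: "(\<lambda>k. f k y) sums ln (cosh y)" if "y > 0" for y
  proof -
    have "(\<lambda>n. ln (\<Prod>k<n. 1 + y\<^sup>2 / (pole k)\<^sup>2)) \<longlonglongrightarrow> ln (cosh y)"
      using cosh_product_formula[of y] that by (intro tendsto_ln) auto
    moreover have "ln (\<Prod>k<n. 1 + y\<^sup>2 / (pole k)\<^sup>2) = (\<Sum>k<n. f k y)" for n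
      unfolding f_def by (intro ln_prod) (use add_pos_nonneg[OF zero_less_one zero_le_square, of "y / pole _"] in \<open>auto simp: power2_eq_square less_imp_neq[symmetric]\<close>)
    ultimately show ?thesis by (simp add: sums_def)
  qed
  have "((\<lambda>y. \<Sum>k. f k y) has_field_derivative (\<Sum>k. f' k x)) (at x)"
  proof (rule has_field_derivative_series')
    \<comment> \<open>A bounded interval, because the derivatives \<open>f' k y\<close> are
      majorized by a multiple of the summable \<open>1 / (pole k)\<^sup>2\<close> only as long as
      \<open>y\<close> is bounded.\<close>
    show "convex {0<..<x + 1}" by simp
    show "uniformly_convergent_on {0<..<x + 1} (\<lambda>n y. \<Sum>i<n. f' i y)"
    proof (rule Weierstrass_m_test')
      show "summable (\<lambda>k. 2 * (x + 1) * (1 / (pole k)\<^sup>2))"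
        by (intro summable_mult summable_inverse_pole_sq)
      fix k y assume "y \<in> {0<..<x + 1}"
      then show "norm (f' k y) \<le> 2 * (x + 1) * (1 / (pole k)\<^sup>2)"
        using pole_pos[of k] by (auto simp: f'_def intro!: frac_le)
    qed
    show "summable (\<lambda>k. f k x)" using f_sums[OF x] by (rule sums_summable)
    show "x \<in> interior {0<..<x + 1}" "x \<in> {0<..<x + 1}" using x by auto
    fix k y assume "y \<in> {0<..<x + 1}"
    have "1 + y\<^sup>2 / (pole k)\<^sup>2 > 0" "(pole k)\<^sup>2 + y\<^sup>2 > 0" 
      using pole_pos[of k] by (auto intro: add_pos_nonneg)
    then show "(f k has_field_derivative f' k y) (at y within {0<..<x + 1})"
      unfolding f_def f'_def using pole_pos[of k]
      by (auto intro!: derivative_eq_intros simp: field_simps power2_eq_square)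
  qed
  moreover have "\<forall>\<^sub>F y in nhds x. (\<Sum>k. f k y) = ln (cosh y)"
    using eventually_nhds_in_open[of "{0<..}" x] x
    by (auto elim!: eventually_mono simp: sums_unique[OF f_sums, symmetric])
  ultimately have "((\<lambda>y. ln (cosh y)) has_field_derivative (\<Sum>k. f' k x)) (at x)"
    by (subst (asm) DERIV_cong_ev[OF refl _ refl])
  moreover have "((\<lambda>y. ln (cosh y)) has_field_derivative tanh x) (at x)"
    by (auto intro!: derivative_eq_intros simp: tanh_def)
  ultimately have *: "(\<Sum>k. f' k x) = tanh x"
    using DERIV_unique by blast
  have "f' k x = x * (2 / (x\<^sup>2 + (pole k)\<^sup>2))" for k by (simp add: f'_def)
  then have "(\<Sum>k. f' k x) = x * (\<Sum>k. 2 / (x\<^sup>2 + (pole k)\<^sup>2))"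
    by (simp only: suminf_mult[OF summable_tanh_terms])
  with * x have "(\<Sum>k. 2 / (x\<^sup>2 + (pole k)\<^sup>2)) = tanh x / x"
    by (simp add: field_simps)
  then show ?thesis using summable_tanh_terms by (simp add: sums_iff)
qed

lemma summable_tan_terms:
  assumes "0 \<le> x" "x < pi / 2"
  shows "summable (\<lambda>k. 1 / ((pole k)\<^sup>2 - x\<^sup>2))"
proof -
  \<comment> \<open>The ratio measures how far \<open>x\<close> stays below the smallest pole; it
    gives \<open>(pole k)\<^sup>2 - x\<^sup>2 \<ge> (1 - r) * (pole k)\<^sup>2\<close> for all
    \<open>k\<close>.\<close>
  define r where "r = x\<^sup>2 / (pi / 2)\<^sup>2"
  have r: "0 \<le> r" "r < 1"
    unfolding r_def using assms power_strict_mono[of x "pi/2" 2] by auto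
  show ?thesis
  proof (rule summable_comparison_test'[OF summable_mult[OF summable_inverse_pole_sq, of "1 / (1 - r)"]])
    fix k
    have "x\<^sup>2 = r * (pi / 2)\<^sup>2" by (simp add: r_def)
    also have "\<dots> \<le> r * (pole k)\<^sup>2" using pole_ge[of k] r by (intro mult_left_mono power_mono) auto
    finally have "(1 - r) * (pole k)\<^sup>2 \<le> (pole k)\<^sup>2 - x\<^sup>2" by (simp add: algebra_simps)
    moreover have "0 < (1 - r) * (pole k)\<^sup>2" using r pole_pos[of k] by simp
    ultimately have "1 / ((pole k)\<^sup>2 - x\<^sup>2) \<le> 1 / ((1 - r) * (pole k)\<^sup>2)" "0 < (pole k)\<^sup>2 - x\<^sup>2"
      by (auto intro!: divide_left_mono mult_pos_pos)
    then show "norm (1 / ((pole k)\<^sup>2 - x\<^sup>2)) \<le> 1 / (1 - r) * (1 / (pole k)\<^sup>2)"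
      by simp
  qed
qed

lemma pole_sq_gt:
  assumes "0 \<le> x" "x < pi / 2"
  shows "x\<^sup>2 < (pole k)\<^sup>2"
  using assms pole_ge[of k] by (intro power_strict_mono) auto

lemma tan_partial_fractions:
  fixes x :: real
  assumes x: "0 < x" "x < pi / 2"
  shows "(\<lambda>k. 2 / ((pole k)\<^sup>2 - x\<^sup>2)) sums (tan x / x)"
proof -
  define f where "f = (\<lambda>k y. - ln (1 - y\<^sup>2 / (pole k)\<^sup>2))"
  define f' where "f' = (\<lambda>k y. 2 * y / ((pole k)\<^sup>2 - y\<^sup>2))"
  have f_sums: "(\<lambda>k. f k y) sums (- ln (cos y))" if "0 < y" "y < pi / 2" for y
  proof -
    have "(\<lambda>n. - ln (\<Prod>k<n. 1 - y\<^sup>2 / (pole k)\<^sup>2)) \<longlonglongrightarrow> - ln (cos y)"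
      using cos_product_formula_real[of y] that cos_gt_zero_pi[of y] by (intro tendsto_ln tendsto_minus) auto
    moreover have "- ln (\<Prod>k<n. 1 - y\<^sup>2 / (pole k)\<^sup>2) = (\<Sum>k<n. f k y)" for n
    proof -
      have "1 - y\<^sup>2 / (pole k)\<^sup>2 > 0" for k
        using pole_sq_gt[of y k] that pole_pos[of k] by simp
      then have "1 - y\<^sup>2 / (pole k)\<^sup>2 \<noteq> 0" for k using less_irrefl by metis
      then have "ln (\<Prod>k<n. 1 - y\<^sup>2 / (pole k)\<^sup>2) = (\<Sum>k<n. ln (1 - y\<^sup>2 / (pole k)\<^sup>2))"
        by (intro ln_prod) (simp_all only: finite_lessThan not_False_eq_True)
      then show ?thesis by (simp add: f_def sum_negf)
    qed
    ultimately show ?thesis by (simp add: sums_def)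
  qed
  \<comment> \<open>On \<open>{0<..<b}\<close> the derived terms are dominated by the same terms
    with \<open>b\<close> in place of \<open>y\<close>, a bound that would blow up at
    \<open>pi / 2\<close>.\<close>
  obtain b where b: "x < b" "b < pi / 2" using x dense by blast
  have "((\<lambda>y. \<Sum>k. f k y) has_field_derivative (\<Sum>k. f' k x)) (at x)"
  proof (rule has_field_derivative_series')
    show "convex {0<..<b}" by simp
    show "uniformly_convergent_on {0<..<b} (\<lambda>n y. \<Sum>i<n. f' i y)"
    proof (rule Weierstrass_m_test')
      show "summable (\<lambda>k. 2 * b * (1 / ((pole k)\<^sup>2 - b\<^sup>2)))"
        using b x by (intro summable_mult summable_tan_terms) auto
      fix k y assume y: "y \<in> {0<..<b}"
      then have "(pole k)\<^sup>2 - b\<^sup>2 > 0" "y\<^sup>2 < b\<^sup>2"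
        using pole_sq_gt[of b k] b by (auto intro: power_strict_mono)
      then show "norm (f' k y) \<le> 2 * b * (1 / ((pole k)\<^sup>2 - b\<^sup>2))"
        using y by (auto simp: f'_def intro!: frac_le)
    qed
    show "summable (\<lambda>k. f k x)" using f_sums[OF x] by (rule sums_summable)
    show "x \<in> interior {0<..<b}" "x \<in> {0<..<b}" using x b by auto
    fix k y assume "y \<in> {0<..<b}"
    then have "(pole k)\<^sup>2 - y\<^sup>2 > 0" using pole_sq_gt[of y k] b by auto
    moreover from this have "1 - y\<^sup>2 / (pole k)\<^sup>2 > 0" 
      using pole_pos[of k] by (auto simp: field_simps)
    moreover have "((\<lambda>y. - ln (1 - y\<^sup>2 / P)) has_field_derivative
        2 * y / P / (1 - y\<^sup>2 / P)) (at y within {0<..<b})" if "1 - y\<^sup>2 / P > 0" "P > 0" for P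
      using that by (auto intro!: derivative_eq_intros simp: power2_eq_square)
    ultimately have "((\<lambda>y. - ln (1 - y\<^sup>2 / (pole k)\<^sup>2)) has_field_derivative
        2 * y / (pole k)\<^sup>2 / (1 - y\<^sup>2 / (pole k)\<^sup>2)) (at y within {0<..<b})"
      using pole_pos[of k] by simp
    also have "2 * y / (pole k)\<^sup>2 / (1 - y\<^sup>2 / (pole k)\<^sup>2) = f' k y"
    proof -
      have "(pole k)\<^sup>2 * (1 - y\<^sup>2 / (pole k)\<^sup>2) = (pole k)\<^sup>2 - y\<^sup>2"
        using pole_pos[of k] by (simp add: right_diff_distrib)
      then show ?thesis by (simp only: f'_def divide_divide_eq_left)
    qed
    finally show "(f k has_field_derivative f' k y) (at y within {0<..<b})"
      by (simp add: f_def)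
  qed
  moreover have "\<forall>\<^sub>F y in nhds x. (\<Sum>k. f k y) = - ln (cos y)"
    using eventually_nhds_in_open[of "{0<..<pi/2}" x] x
    by (auto elim!: eventually_mono simp: sums_unique[OF f_sums, symmetric])
  ultimately have "((\<lambda>y. - ln (cos y)) has_field_derivative (\<Sum>k. f' k x)) (at x)"
    by (subst (asm) DERIV_cong_ev[OF refl _ refl])
  moreover have "((\<lambda>y. - ln (cos y)) has_field_derivative tan x) (at x)"
    using cos_gt_zero_pi[of x] x by (auto intro!: derivative_eq_intros simp: tan_def)
  ultimately have *: "(\<Sum>k. f' k x) = tan x"
    using DERIV_unique by blast
  have s: "summable (\<lambda>k. 2 / ((pole k)\<^sup>2 - x\<^sup>2))"
    using summable_mult[OF summable_tan_terms[of x], of 2] x by simp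
  have "f' k x = x * (2 / ((pole k)\<^sup>2 - x\<^sup>2))" for k by (simp add: f'_def)
  then have "(\<Sum>k. f' k x) = x * (\<Sum>k. 2 / ((pole k)\<^sup>2 - x\<^sup>2))"
    by (simp only: suminf_mult[OF s])
  with * x have "(\<Sum>k. 2 / ((pole k)\<^sup>2 - x\<^sup>2)) = tan x / x"
    by (subst nonzero_eq_divide_eq) (auto simp only: mult.commute)
  then show ?thesis using s by (simp add: sums_iff)
qed

text \<open>One more termwise differentiation, now of \<open>tan y / y\<close>. The right-hand side
  is the derivative of \<open>tan x / x\<close> with respect to the square of \<open>x\<close>; it
  becomes the denominator of the residue at the pole \<open>\<i> * \<delta>\<close>.\<close>

lemma tan_deriv_partial_fractions:
  fixes x :: real
  assumes x: "0 < x" "x < pi / 2"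
  shows "(\<lambda>k. 2 / ((pole k)\<^sup>2 - x\<^sup>2)\<^sup>2) sums ((x * (1 / cos x)\<^sup>2 - tan x) / (2 * x ^ 3))"
proof -
  define f where "f = (\<lambda>k y. 2 / ((pole k)\<^sup>2 - y\<^sup>2))"
  define f' where "f' = (\<lambda>k y. 4 * y / ((pole k)\<^sup>2 - y\<^sup>2)\<^sup>2)"
  have f_sums: "(\<lambda>k. f k y) sums (tan y / y)" if "0 < y" "y < pi / 2" for y
    using tan_partial_fractions[OF that] by (simp add: f_def)
  obtain b where b: "x < b" "b < pi / 2" using x dense by blast
  define e where "e = (pole 0)\<^sup>2 - b\<^sup>2"
  have e: "e > 0" using b x pole_sq_gt[of b 0] by (simp add: e_def)
  have bnd: "norm (f' k y) \<le> 4 * b / e * (1 / ((pole k)\<^sup>2 - b\<^sup>2))" if y: "y \<in> {0<..<b}" for k y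
  proof -
    have 1: "(pole k)\<^sup>2 - b\<^sup>2 > 0" "y\<^sup>2 < b\<^sup>2" "(pole 0)\<^sup>2 \<le> (pole k)\<^sup>2"
      using pole_sq_gt[of b k] b y pole_ge[of k] by (auto intro: power_strict_mono power_mono simp: pole_0)
    then have "e * ((pole k)\<^sup>2 - b\<^sup>2) \<le> ((pole k)\<^sup>2 - y\<^sup>2) * ((pole k)\<^sup>2 - y\<^sup>2)"
      using e by (intro mult_mono) (auto simp: e_def)
    then have "norm (f' k y) \<le> 4 * b / (e * ((pole k)\<^sup>2 - b\<^sup>2))"
      using y e 1 by (auto simp: f'_def power2_eq_square[of "_ - _"] intro!: frac_le)
    then show ?thesis by simp
  qed
  have bs: "summable (\<lambda>k. 4 * b / e * (1 / ((pole k)\<^sup>2 - b\<^sup>2)))"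
    using b x by (intro summable_mult summable_tan_terms) auto
  have "((\<lambda>y. \<Sum>k. f k y) has_field_derivative (\<Sum>k. f' k x)) (at x)"
  proof (rule has_field_derivative_series')
    show "convex {0<..<b}" by simp
    show "uniformly_convergent_on {0<..<b} (\<lambda>n y. \<Sum>i<n. f' i y)"
      by (rule Weierstrass_m_test'[OF bnd bs])
    show "summable (\<lambda>k. f k x)" using f_sums[OF x] by (rule sums_summable)
    show "x \<in> interior {0<..<b}" "x \<in> {0<..<b}" using x b by auto
    fix k y assume "y \<in> {0<..<b}"
    then have "(pole k)\<^sup>2 - y\<^sup>2 > 0" using pole_sq_gt[of y k] b by auto
    then show "(f k has_field_derivative f' k y) (at y within {0<..<b})"
      unfolding f_def f'_def
      by (auto intro!: derivative_eq_intros simp: field_simps power2_eq_square)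
  qed
  moreover have "\<forall>\<^sub>F y in nhds x. (\<Sum>k. f k y) = tan y / y"
    using eventually_nhds_in_open[of "{0<..<pi/2}" x] x
    by (auto elim!: eventually_mono simp: sums_unique[OF f_sums, symmetric])
  ultimately have "((\<lambda>y. tan y / y) has_field_derivative (\<Sum>k. f' k x)) (at x)"
    by (subst (asm) DERIV_cong_ev[OF refl _ refl])
  moreover have "((\<lambda>y. tan y / y) has_field_derivative (x * (1 / cos x)\<^sup>2 - tan x) / x\<^sup>2) (at x)"
    using cos_gt_zero_pi[of x] x 
    by (rule_tac derivative_eq_intros DERIV_tan refl | simp add: power2_eq_square inverse_eq_divide)+
  ultimately have *: "(\<Sum>k. f' k x) = (x * (1 / cos x)\<^sup>2 - tan x) / x\<^sup>2"
    using DERIV_unique by blast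
  have "summable (\<lambda>k. f' k x)"
    using summable_comparison_test'[OF bs bnd] x b by auto
  then have "(\<lambda>k. f' k x) sums ((x * (1 / cos x)\<^sup>2 - tan x) / x\<^sup>2)"
    using * summable_sums by metis
  \<comment> \<open>The factor \<open>1 / (2 * x)\<close> turns the derivative in \<open>x\<close>
    into the derivative in \<open>x\<^sup>2\<close>.\<close>
  from sums_mult[OF this, of "1 / (2 * x)"] show ?thesis
    using x by (simp add: f'_def power3_eq_cube power2_eq_square mult_ac)
qed

section \<open>The function tanh x / x and its size\<close>

definition tanhc :: "real \<Rightarrow> real" where
  "tanhc x = (\<Sum>k. 2 / (x\<^sup>2 + (pole k)\<^sup>2))"

lemma tanhc_sums: "(\<lambda>k. 2 / (x\<^sup>2 + (pole k)\<^sup>2)) sums tanhc x"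
  unfolding tanhc_def by (rule summable_sums[OF summable_tanh_terms])

lemma tanhc_minus [simp]: "tanhc (- x) = tanhc x"
  by (simp add: tanhc_def)

lemma continuous_on_tanhc: "continuous_on UNIV tanhc"
proof -
  have "uniform_limit UNIV (\<lambda>n x. \<Sum>k<n. 2 / (x\<^sup>2 + (pole k)\<^sup>2)) tanhc sequentially"
    unfolding tanhc_def
  proof (rule Weierstrass_m_test[OF _ summable_mult[OF summable_inverse_pole_sq, of 2]])
    fix k and x :: real show "norm (2 / (x\<^sup>2 + (pole k)\<^sup>2)) \<le> 2 * (1 / (pole k)\<^sup>2)"
      using pole_pos[of k] by (simp add: frac_le)
  qed
  then show ?thesis
  proof (rule uniform_limit_theorem[rotated])
    have "x\<^sup>2 + (pole k)\<^sup>2 \<noteq> 0" for k x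
      using pole_pos[of k] by (simp add: add_nonneg_eq_0_iff)
    then show "\<forall>\<^sub>F n in sequentially. continuous_on UNIV (\<lambda>x. \<Sum>k<n. 2 / (x\<^sup>2 + (pole k)\<^sup>2))"
      by (intro always_eventually allI continuous_intros) auto
  qed simp
qed

text \<open>The series is continuous at 0 too, so its value there is the limit of
  \<open>tanh x / x\<close>, which is the derivative of tanh at 0. Defining \<open>tanhc\<close> by
  the series keeps the partial fractions free of a case distinction.\<close>

lemma tanhc_eq: "tanhc x = (if x = 0 then 1 else tanh x / x)"
proof -
  have pos: "tanhc x = tanh x / x" if "x > 0" for x
    using sums_unique2[OF tanhc_sums tanh_partial_fractions[OF that]] .
  have "(\<lambda>x :: real. tanh x / x) \<midarrow>0\<rightarrow> 1"
  proof -
    have "(tanh has_field_derivative 1) (at (0::real))"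
      by (rule derivative_eq_intros refl | simp)+
    then show ?thesis by (simp add: has_field_derivative_iff)
  qed
  then have "((\<lambda>x :: real. tanh x / x) \<longlongrightarrow> 1) (at_right 0)"
    by (simp add: filterlim_at_split)
  moreover have "\<forall>\<^sub>F x in at_right (0::real). tanh x / x = tanhc x"
    using pos by (auto simp: eventually_at_filter)
  ultimately have "(tanhc \<longlongrightarrow> 1) (at_right 0)"
    using Lim_transform_eventually by blast
  moreover have "(tanhc \<longlongrightarrow> tanhc 0) (at_right 0)"
    using continuous_on_tanhc
    by (metis continuous_on_eq_continuous_at continuous_at_imp_continuous_within continuous_within open_UNIV UNIV_I)
  ultimately have "tanhc 0 = 1"
    using tendsto_unique trivial_limit_at_right_real by blast
  moreover have "tanhc x = tanh x / x" if "x < 0"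
    using pos[of "-x"] that by simp
  ultimately show ?thesis using pos by (cases x "0::real" rule: linorder_cases) auto
qed

lemma whitham_symbol_eq: "whitham_symbol x = sqrt (tanhc x)"
  by (simp add: whitham_symbol_def tanhc_eq)

lemma tanhc_pos: "tanhc x > 0"
  by (cases x "0::real" rule: linorder_cases) (auto simp: tanhc_eq field_simps)

lemma tanhc_antimono:
  assumes "\<bar>x\<bar> \<le> \<bar>y\<bar>" shows "tanhc y \<le> tanhc x"
proof (rule sums_le[OF _ tanhc_sums tanhc_sums])
  fix k have "x\<^sup>2 \<le> y\<^sup>2" using assms by (simp add: abs_le_square_iff)
  then show "2 / (y\<^sup>2 + (pole k)\<^sup>2) \<le> 2 / (x\<^sup>2 + (pole k)\<^sup>2)"
    using pole_pos[of k] by (intro divide_left_mono) (auto intro!: add_nonneg_pos mult_pos_pos)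
qed

lemma tanhc_le_1: "tanhc x \<le> 1"
  using tanhc_antimono[of 0 x] by (simp add: tanhc_eq)

lemma tanhc_le: "tanhc x \<le> 1 / \<bar>x\<bar>" if "x \<noteq> 0"
proof -
  have "tanhc \<bar>x\<bar> = tanh \<bar>x\<bar> / \<bar>x\<bar>" using that by (simp add: tanhc_eq)
  also have "\<dots> \<le> 1 / \<bar>x\<bar>" 
    using tanh_real_lt_1[of "\<bar>x\<bar>"] that by (intro divide_right_mono) auto
  also have "tanhc \<bar>x\<bar> = tanhc x" by (simp add: abs_if)
  finally show ?thesis .
qed

lemma tanhc_ge: "tanh 1 * min 1 (1 / \<bar>x\<bar>) \<le> tanhc x" if "x \<noteq> 0"
proof (cases "\<bar>x\<bar> \<le> 1")
  case True
  then have "tanhc 1 \<le> tanhc x" using tanhc_antimono[of x 1] by simp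
  moreover have "tanh (1::real) * min 1 (1 / \<bar>x\<bar>) \<le> tanh 1 * 1"
    by (intro mult_left_mono) auto
  moreover have "tanhc 1 = tanh 1" by (simp add: tanhc_eq)
  ultimately show ?thesis by linarith
next
  case False
  have "tanhc \<bar>x\<bar> = tanh \<bar>x\<bar> / \<bar>x\<bar>" using that by (simp add: tanhc_eq)
  moreover have "tanh 1 / \<bar>x\<bar> \<le> tanh \<bar>x\<bar> / \<bar>x\<bar>" 
    using False tanh_real_le_iff[of 1 "\<bar>x\<bar>"] by (intro divide_right_mono) (auto simp del: tanh_real_abs)
  moreover have "tanhc \<bar>x\<bar> = tanhc x" by (simp add: abs_if)
  ultimately show ?thesis using False by (simp add: min_def)
qed

text \<open>\<open>tanhc\<close> itself is only of order \<open>1 / \<bar>x\<bar>\<close>; the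
  integrability of its square provides the majorants for the limits of kernels below.\<close>

lemma tanhc_sq_le: "(tanhc x)\<^sup>2 \<le> 2 / (1 + x\<^sup>2)"
proof (cases "\<bar>x\<bar> \<le> 1")
  case True
  then have "1 + x\<^sup>2 \<le> 2" by (simp add: abs_square_le_1)
  then have "1 \<le> 2 / (1 + x\<^sup>2)" by (simp add: add_pos_nonneg)
  moreover have "(tanhc x)\<^sup>2 \<le> 1" using tanhc_le_1[of x] tanhc_pos[of x] by (simp add: power_le_one)
  ultimately show ?thesis by simp
next
  case False
  then have "x \<noteq> 0" "1 \<le> x\<^sup>2" using abs_square_le_1[of x] by auto
  have "(tanhc x)\<^sup>2 \<le> (1 / \<bar>x\<bar>)\<^sup>2"
    using tanhc_le[OF \<open>x \<noteq> 0\<close>] tanhc_pos[of x] by (intro power_mono) auto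
  also have "\<dots> \<le> 2 / (1 + x\<^sup>2)"
    using \<open>1 \<le> x\<^sup>2\<close> by (simp add: power_divide divide_simps)
  finally show ?thesis .
qed

section \<open>Rational Stieltjes functions\<close>

text \<open>The difference has degree below \<open>card X\<close>, since the coefficients at that
  index agree, but it vanishes at \<open>card X\<close> points.\<close>

lemma poly_eqI_card_roots:
  fixes f g :: "real poly"
  assumes "finite X" "degree f \<le> card X" "degree g \<le> card X" "coeff f (card X) = coeff g (card X)"
    and "\<And>x. x \<in> X \<Longrightarrow> poly f x = poly g x"
  shows "f = g"
proof (rule ccontr)
  assume "f \<noteq> g"
  then have nz: "f - g \<noteq> 0" by simp
  have "degree (f - g) \<le> card X" using assms by (intro degree_diff_le) auto
  moreover have "degree (f - g) \<noteq> card X"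
    using nz assms(4) leading_coeff_0_iff[of "f - g"] by (metis coeff_diff diff_self)
  ultimately have "degree (f - g) < card X" by simp
  moreover have "card X \<le> card {x. poly (f - g) x = 0}"
    using assms nz by (intro card_mono poly_roots_finite) auto
  ultimately show False using card_poly_roots_bound[OF nz] by simp
qed

lemma degree_prod_linear:
  fixes f :: "'b \<Rightarrow> real"
  assumes "finite A"
  shows "degree (\<Prod>a\<in>A. [:f a, 1:]) = card A"
  using assms by (subst degree_prod_eq_sum_degree) auto

lemma coeff_prod_linear:
  fixes f :: "'b \<Rightarrow> real"
  assumes "finite A"
  shows "coeff (\<Prod>a\<in>A. [:f a, 1:]) (card A) = 1"
  using lead_coeff_prod[of "\<lambda>a. [:f a, 1:]" A] degree_prod_linear[OF assms, of f] by simp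

text \<open>After clearing denominators, \<open>F z / (\<tau> + F z)\<close> is a quotient of
  polynomials whose denominator vanishes exactly at the \<open>N\<close> points \<open>- q\<close>.
  The residue there is the value of \<open>F\<close> over the value of its derivative, that is
  \<open>- \<tau>\<close> over \<open>- D q\<close>.\<close>

lemma secular_partial_fractions:
  fixes p w :: "nat \<Rightarrow> real" and Q :: "real set" and N :: nat
  defines "F \<equiv> \<lambda>z. \<Sum>k<N. w k / (z + p k)"
  defines "D \<equiv> \<lambda>q. \<Sum>k<N. w k / (p k - q)\<^sup>2"
  assumes "N \<ge> 1" and Q: "finite Q" "card Q = N" and \<tau>: "\<tau> \<noteq> 0"
    and w: "\<And>k. w k > 0"
    and ne: "\<And>q k. q \<in> Q \<Longrightarrow> k < N \<Longrightarrow> p k \<noteq> q"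
    and root: "\<And>q. q \<in> Q \<Longrightarrow> \<tau> + F (- q) = 0"
    and z: "\<And>k. k < N \<Longrightarrow> z + p k \<noteq> 0" "\<And>q. q \<in> Q \<Longrightarrow> z + q \<noteq> 0"
  shows "F z / (\<tau> + F z) = (\<Sum>q\<in>Q. \<tau> / D q / (z + q))"
proof -
  define P where "P = (\<Prod>k<N. [:p k, 1:])"
  define R where "R = (\<lambda>k. \<Prod>j\<in>{..<N} - {k}. [:p j, 1:])"
  define Nn where "Nn = (\<Sum>k<N. smult (w k) (R k))"
  define M where "M = smult \<tau> P + Nn"
  define L where "L = (\<lambda>q. \<Prod>r\<in>Q - {q}. [:r, 1:])"
  define T where "T = (\<Sum>q\<in>Q. smult (\<tau>\<^sup>2 / D q) (L q))"
  have P_R: "P = [:p k, 1:] * R k" if "k < N" for k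
    unfolding P_def R_def using that by (subst prod.remove[of _ k]) auto
  have L_Q: "(\<Prod>r\<in>Q. [:r, 1:]) = [:q, 1:] * L q" if "q \<in> Q" for q
    unfolding L_def using that Q by (subst prod.remove[of _ q]) auto
  have poly_Nn: "poly Nn x = poly P x * F x" if "\<And>k. k < N \<Longrightarrow> x + p k \<noteq> 0" for x
    unfolding Nn_def F_def poly_sum sum_distrib_left
  proof (intro sum.cong refl)
    fix k assume k: "k \<in> {..<N}"
    show "poly (smult (w k) (R k)) x = poly P x * (w k / (x + p k))"
    proof -
      have "poly P x = (x + p k) * poly (R k) x"
        using P_R[of k] k by (simp add: algebra_simps)
      then show ?thesis using that[of k] k by simp
    qed
  qed
  have poly_M: "poly M x = poly P x * (\<tau> + F x)" if "\<And>k. k < N \<Longrightarrow> x + p k \<noteq> 0" for x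
    unfolding M_def using poly_Nn[OF that] by (simp add: algebra_simps)
  have D_pos: "D q > 0" if "q \<in> Q" for q
    unfolding D_def using \<open>N \<ge> 1\<close> ne[OF that] w
    by (intro sum_pos) (auto intro!: divide_pos_pos simp: lessThan_empty_iff)
  have deg_R: "degree (R k) < N" if "k < N" for k
    unfolding R_def using degree_prod_linear[of "{..<N} - {k}" p] that by simp
  have deg_L: "degree (L q) < N" if "q \<in> Q" for q
    unfolding L_def using degree_prod_linear[of "Q - {q}" id] that Q \<open>N \<ge> 1\<close> by simp
  have deg_Nn: "degree Nn < N" 
    unfolding Nn_def using deg_R \<open>N \<ge> 1\<close> 
    by (intro degree_sum_less) (auto intro: le_less_trans[OF degree_smult_le])
  have deg_T: "degree T < N" 
    unfolding T_def using deg_L \<open>N \<ge> 1\<close> 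
    by (intro degree_sum_less) (auto intro: le_less_trans[OF degree_smult_le])
  have deg_P: "degree P = N" "coeff P N = 1"
    unfolding P_def using degree_prod_linear[of "{..<N}" p] coeff_prod_linear[of "{..<N}" p] by auto
  have M_root: "poly M (- q) = 0" if "q \<in> Q" for q
    using poly_M[of "- q"] ne[OF that] root[OF that] by auto
  \<comment> \<open>\<open>M\<close> has degree \<open>N\<close>, leading coefficient
    \<open>\<tau>\<close> and the \<open>N\<close> known roots \<open>- q\<close>, so it factors
    completely.\<close>
  have M_eq: "M = smult \<tau> (\<Prod>r\<in>Q. [:r, 1:])"
  proof (rule poly_eqI_card_roots[of "uminus ` Q"])
    have c: "card (uminus ` Q) = N" using Q by (simp add: card_image)
    show "degree M \<le> card (uminus ` Q)" unfolding c M_def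
      using deg_Nn deg_P by (intro degree_add_le) (auto intro: le_trans[OF degree_smult_le])
    show "degree (smult \<tau> (\<Prod>r\<in>Q. [:r, 1:])) \<le> card (uminus ` Q)" unfolding c
      using degree_prod_linear[of Q id] Q by (auto intro: le_trans[OF degree_smult_le])
    show "coeff M (card (uminus ` Q)) = coeff (smult \<tau> (\<Prod>r\<in>Q. [:r, 1:])) (card (uminus ` Q))"
      unfolding c M_def using deg_Nn deg_P coeff_prod_linear[of Q id] Q by (simp add: coeff_eq_0)
    fix x assume "x \<in> uminus ` Q"
    then obtain q where q: "q \<in> Q" "x = - q" by auto
    then show "poly M x = poly (smult \<tau> (\<Prod>r\<in>Q. [:r, 1:])) x"
      using M_root[of q] L_Q[of q] by simp
  qed (use Q in auto)
  \<comment> \<open>Both sides are the derivative of \<open>M\<close> at \<open>- q\<close>: on the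
    left from its factorization, on the right from \<open>P * (\<tau> + F)\<close>, where
    \<open>\<tau> + F\<close> vanishes and has derivative \<open>- D q\<close>. Exact division by
    \<open>[:q, 1:]\<close> takes the place of differentiation.\<close>
  have L_val: "\<tau> * poly (L q) (- q) = - poly P (- q) * D q" if q: "q \<in> Q" for q
  proof -
    define B where "B = (\<Sum>k<N. smult (w k / (p k - q)) (R k))"
    have pk: "smult (w k / (p k - q)) ([:q, 1:] * R k) = smult (w k / (p k - q)) P - smult (w k) (R k)"
      if "k < N" for k
    proof -
      have "[:q, 1:] = [:p k, 1:] - [:p k - q:]" by simp
      then have "[:q, 1:] * R k = P - smult (p k - q) (R k)"
        by (simp only: left_diff_distrib P_R[OF that]) simp
      then show ?thesis using ne[OF q that] by (simp only: smult_diff_right) simp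
    qed
    have "[:q, 1:] * B = (\<Sum>k<N. smult (w k / (p k - q)) ([:q, 1:] * R k))"
      by (simp only: B_def sum_distrib_left mult_smult_right)
    also have "\<dots> = (\<Sum>k<N. smult (w k / (p k - q)) P - smult (w k) (R k))"
      using pk by (intro sum.cong) auto
    also have "\<dots> = smult (F (- q)) P - Nn"
      by (simp add: sum_subtractf Nn_def F_def smult_sum[symmetric])
    also have "F (- q) = - \<tau>" using root[OF q] by simp
    also have "smult (- \<tau>) P - Nn = - M" by (simp add: M_def)
    also have "- M = [:q, 1:] * (- smult \<tau> (L q))" unfolding M_eq L_Q[OF q] by simp
    finally have "B = - smult \<tau> (L q)" by (simp only: mult_cancel_left) simp
    then have "\<tau> * poly (L q) (- q) = - poly B (- q)" by simp
    also have "poly B (- q) = (\<Sum>k<N. poly P (- q) * (w k / (p k - q)\<^sup>2))"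
      unfolding B_def poly_sum
    proof (intro sum.cong refl)
      fix k assume "k \<in> {..<N}"
      then have "p k - q \<noteq> 0" "poly P (- q) = (p k - q) * poly (R k) (- q)"
        using ne[OF q, of k] P_R[of k] by (auto simp: algebra_simps)
      then show "poly (smult (w k / (p k - q)) (R k)) (- q) = poly P (- q) * (w k / (p k - q)\<^sup>2)"
        by (simp add: power2_eq_square)
    qed
    also have "\<dots> = poly P (- q) * D q" by (simp add: D_def sum_distrib_left)
    finally show ?thesis by simp
  qed
  \<comment> \<open>Lagrange interpolation: both polynomials have degree below \<open>N\<close> and
    agree at the \<open>N\<close> points \<open>- q\<close>.\<close>
  have "T = Nn"
  proof (rule poly_eqI_card_roots[of "uminus ` Q"])
    have c: "card (uminus ` Q) = N" using Q by (simp add: card_image)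
    show "degree T \<le> card (uminus ` Q)" "degree Nn \<le> card (uminus ` Q)" 
      "coeff T (card (uminus ` Q)) = coeff Nn (card (uminus ` Q))"
      using c deg_T deg_Nn by (auto simp: coeff_eq_0)
    fix x assume "x \<in> uminus ` Q"
    then obtain q where q: "q \<in> Q" "x = - q" by auto
    have "poly T x = (\<Sum>r\<in>Q. \<tau>\<^sup>2 / D r * poly (L r) (- q))"
      by (simp add: T_def poly_sum q)
    also have "\<dots> = (\<Sum>r\<in>{q}. \<tau>\<^sup>2 / D r * poly (L r) (- q))"
      using q Q by (intro sum.mono_neutral_right) (auto simp: L_def poly_prod)
    also have "\<dots> = \<tau> / D q * (\<tau> * poly (L q) (- q))" by (simp add: power2_eq_square)
    also have "\<dots> = - \<tau> * poly P (- q)"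
      using D_pos[OF q(1)] by (simp add: L_val[OF q(1)])
    also have "\<dots> = poly Nn x" using M_root[OF q(1)] by (simp add: M_def q)
    finally show "poly T x = poly Nn x" .
  qed (use Q in auto)
  have Pz: "poly P z \<noteq> 0" unfolding P_def poly_prod using z by (auto simp: add.commute)
  have Mz: "poly M z = \<tau> * (\<Prod>r\<in>Q. r + z)" unfolding M_eq by (simp add: poly_prod)
  have Mz0: "poly M z \<noteq> 0" unfolding Mz using \<tau> z Q by (auto simp: add.commute)
  have "F z / (\<tau> + F z) = poly Nn z / poly M z"
    using poly_Nn[OF z(1)] poly_M[OF z(1)] Pz by simp
  also have "poly Nn z = (\<Sum>q\<in>Q. \<tau>\<^sup>2 / D q * poly (L q) z)"
    unfolding \<open>T = Nn\<close>[symmetric] T_def by (simp add: poly_sum)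
  also have "\<dots> / poly M z = (\<Sum>q\<in>Q. \<tau> / D q / (z + q))"
    unfolding sum_divide_distrib
  proof (intro sum.cong refl)
    fix q assume q: "q \<in> Q"
    have e: "poly M z = \<tau> * ((q + z) * poly (L q) z)"
      unfolding M_eq L_Q[OF q] by (simp add: algebra_simps)
    then have "poly (L q) z \<noteq> 0" "q + z \<noteq> 0" using Mz0 by auto
    then show "\<tau>\<^sup>2 / D q * poly (L q) z / poly M z = \<tau> / D q / (z + q)"
      unfolding e using \<tau> by (simp add: power2_eq_square add.commute)
  qed
  finally show ?thesis .
qed

section \<open>Location of the roots of the secular equation\<close>

lemma secular_root_between:
  fixes p w :: "nat \<Rightarrow> real"
  assumes p: "strict_mono p" and w: "\<And>k. w k > 0" and i: "Suc i < N"
  shows "\<exists>q. p i < q \<and> q < p (Suc i) \<and> \<tau> + (\<Sum>k<N. w k / (- q + p k)) = 0"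
proof -
  define R where "R = (\<lambda>k x. \<Prod>j\<in>{..<N} - {k}. p j - x)"
  \<comment> \<open>Multiplying by all \<open>p k - x\<close> removes the singularities, so the
    intermediate value theorem applies up to the endpoints \<open>p i\<close> and
    \<open>p (Suc i)\<close>; at each of them only one summand survives.\<close>
  define g where "g = (\<lambda>x. \<tau> * (\<Prod>k<N. p k - x) + (\<Sum>k<N. w k * R k x))"
  have R0: "R k (p l) = 0" if "k \<noteq> l" "l < N" for k l
    unfolding R_def using that by (intro prod_zero) auto
  have g_at: "g (p l) = w l * R l (p l)" if "l < N" for l
  proof -
    have "(\<Sum>k<N. w k * R k (p l)) = (\<Sum>k\<in>{l}. w k * R k (p l))"
      using that R0 by (intro sum.mono_neutral_right) auto
    moreover have "(\<Prod>k<N. p k - p l) = 0" using that by (intro prod_zero) auto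
    ultimately show ?thesis by (simp add: g_def)
  qed
  let ?A = "{..<N} - {i} - {Suc i}"
  have R1: "R i (p i) = (p (Suc i) - p i) * (\<Prod>j\<in>?A. p j - p i)"
    unfolding R_def using i by (subst prod.remove[of _ "Suc i"]) auto
  have "{..<N} - {Suc i} - {i} = ?A" by auto
  then have R2: "R (Suc i) (p (Suc i)) = (p i - p (Suc i)) * (\<Prod>j\<in>?A. p j - p (Suc i))"
    unfolding R_def using i by (subst prod.remove[of _ "i"]) auto
  have lt: "p i < p (Suc i)" using p by (simp add: strict_mono_def)
  \<comment> \<open>No other \<open>p j\<close> lies between the endpoints, so these factors
    contribute equal signs at both; the sign change of \<open>g\<close> comes from the two factors
    belonging to the endpoints themselves.\<close>
  have "(\<Prod>j\<in>?A. p j - p i) * (\<Prod>j\<in>?A. p j - p (Suc i)) > 0"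
    unfolding prod.distrib[symmetric]
  proof (intro prod_pos ballI)
    fix j assume "j \<in> ?A"
    then have "j < i \<or> Suc i < j" by auto
    then have "p j < p i \<or> p (Suc i) < p j" using p by (auto simp: strict_mono_def)
    then show "0 < (p j - p i) * (p j - p (Suc i))"
      using lt by (auto intro: mult_neg_neg mult_pos_pos)
  qed
  then have neg: "(p i - p (Suc i)) * (p (Suc i) - p i) * ((\<Prod>j\<in>?A. p j - p i) * (\<Prod>j\<in>?A. p j - p (Suc i))) < 0"
    using lt by (intro mult_neg_pos) auto
  then have "w i * w (Suc i) * (R i (p i) * R (Suc i) (p (Suc i))) < 0"
    using mult_pos_neg[OF mult_pos_pos[OF w[of i] w[of "Suc i"]], OF neg] unfolding R1 R2 by (simp only: mult_ac)
  then have sgn: "g (p i) * g (p (Suc i)) < 0"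
    using i by (simp add: g_at mult_ac)
  have cont: "continuous_on {p i..p (Suc i)} g"
    unfolding g_def R_def by (intro continuous_intros)
  have "\<exists>q. p i \<le> q \<and> q \<le> p (Suc i) \<and> g q = 0"
  proof (cases "g (p i) < 0")
    case True
    then have "g (p i) \<le> 0" "0 \<le> g (p (Suc i))" using sgn by (auto simp: mult_less_0_iff)
    then show ?thesis using IVT'[of g "p i" 0 "p (Suc i)"] cont lt by auto
  next
    case False
    then have "g (p (Suc i)) \<le> 0" "0 \<le> g (p i)" using sgn by (auto simp: mult_less_0_iff)
    then show ?thesis using IVT2'[of g "p (Suc i)" 0 "p i"] cont lt by auto
  qed
  then obtain q where q: "p i \<le> q" "q \<le> p (Suc i)" "g q = 0" by blast
  have "q \<noteq> p i" "q \<noteq> p (Suc i)" using q sgn by auto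
  then have q': "p i < q" "q < p (Suc i)" using q by auto
  have ne: "p k \<noteq> q" for k
  proof (cases "k \<le> i")
    case True then have "p k \<le> p i" using p by (simp add: strict_mono_less_eq)
    then show ?thesis using q' by simp
  next
    case False then have "p (Suc i) \<le> p k" using p by (simp add: strict_mono_less_eq)
    then show ?thesis using q' by simp
  qed
  have "(\<Prod>k<N. p k - q) * (\<tau> + (\<Sum>k<N. w k / (- q + p k))) = g q"
  proof -
    have "(\<Prod>k<N. p k - q) * (w k / (- q + p k)) = w k * R k q" if "k < N" for k
      unfolding R_def using that ne[of k] by (subst prod.remove[of _ k]) (auto simp: field_simps)
    then show ?thesis by (simp add: g_def distrib_left sum_distrib_left mult.commute)
  qed
  moreover have "(\<Prod>k<N. p k - q) \<noteq> 0" using ne by auto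
  ultimately have "\<tau> + (\<Sum>k<N. w k / (- q + p k)) = 0" using q(3) by simp
  then show ?thesis using q' by blast
qed

text \<open>An explicit bracket: at \<open>p n + w n / \<tau>\<close> the last summand alone equals
  \<open>- \<tau>\<close> and the others are not positive; at \<open>p n + W / \<tau>\<close> every
  denominator has modulus at least \<open>W / \<tau>\<close>, so the sum is at least
  \<open>- \<tau>\<close>.\<close>

lemma secular_root_above:
  fixes p w :: "nat \<Rightarrow> real"
  assumes p: "strict_mono p" and w: "\<And>k. w k > 0" and \<tau>: "\<tau> > 0"
  shows "\<exists>q. p n < q \<and> \<tau> + (\<Sum>k<Suc n. w k / (- q + p k)) = 0"
proof -
  define g where "g = (\<lambda>q. \<tau> + (\<Sum>k<Suc n. w k / (- q + p k)))"
  define W where "W = (\<Sum>k<Suc n. w k)"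
  have le: "p k \<le> p n" if "k < Suc n" for k using p that by (simp add: strict_mono_less_eq)
  have Ww: "w n \<le> W" unfolding W_def using w by (intro member_le_sum) (auto simp: less_imp_le)
  have wp: "0 < w n / \<tau>" "w n / \<tau> \<le> W / \<tau>" using w \<tau> Ww by (auto intro: divide_right_mono)
  have "g (p n + w n / \<tau>) = \<tau> + (\<Sum>k<n. w k / (- (p n + w n / \<tau>) + p k)) - \<tau>"
    using w[of n] \<tau> by (simp add: g_def del: minus_add_distrib add_uminus_conv_diff)
  also have "(\<Sum>k<n. w k / (- (p n + w n / \<tau>) + p k)) \<le> 0"
    using le w wp by (intro sum_nonpos divide_nonneg_nonpos) (auto simp: less_imp_le, smt (verit) less_SucI)
  finally have 1: "g (p n + w n / \<tau>) \<le> 0" by simp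
  have "- (\<Sum>k<Suc n. w k / (- (p n + W / \<tau>) + p k)) \<le> (\<Sum>k<Suc n. w k / (W / \<tau>))"
    unfolding sum_negf[symmetric]
  proof (intro sum_mono)
    fix k assume k: "k \<in> {..<Suc n}"
    have "- (w k / (- (p n + W / \<tau>) + p k)) = w k / (p n + W / \<tau> - p k)"
      by (simp flip: divide_minus_right)
    also have "\<dots> \<le> w k / (W / \<tau>)"
      using le[of k] k w[of k] wp by (intro divide_left_mono mult_pos_pos) auto
    finally show "- (w k / (- (p n + W / \<tau>) + p k)) \<le> w k / (W / \<tau>)" .
  qed
  also have "\<dots> = W / (W / \<tau>)" by (simp only: W_def sum_divide_distrib)
  also have "\<dots> = \<tau>" using wp \<tau> by auto
  finally have 2: "0 \<le> g (p n + W / \<tau>)" unfolding g_def by linarith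
  have "continuous_on {p n + w n / \<tau>..p n + W / \<tau>} g"
    unfolding g_def using le wp by (intro continuous_intros) force
  with 1 2 obtain q where "p n + w n / \<tau> \<le> q" "g q = 0"
    using IVT'[of g "p n + w n / \<tau>" 0 "p n + W / \<tau>"] wp by auto
  then show ?thesis using wp unfolding g_def by (intro exI[of _ q]) auto
qed

lemma secular_roots_gaps:
  fixes p w :: "nat \<Rightarrow> real"
  assumes p: "strict_mono p" and w: "\<And>k. w k > 0"
  shows "\<exists>Q. finite Q \<and> card Q = n \<and> 
     (\<forall>q\<in>Q. p 0 < q \<and> q < p n \<and> (\<forall>k. p k \<noteq> q) \<and> \<tau> + (\<Sum>k<Suc n. w k / (- q + p k)) = 0)"
proof -
  have "\<forall>i\<in>{..<n}. \<exists>q. p i < q \<and> q < p (Suc i) \<and> \<tau> + (\<Sum>k<Suc n. w k / (- q + p k)) = 0"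
    using secular_root_between[OF p w, of _ "Suc n"] by auto
  then obtain r where r: "\<And>i. i < n \<Longrightarrow> p i < r i \<and> r i < p (Suc i) \<and> \<tau> + (\<Sum>k<Suc n. w k / (- r i + p k)) = 0"
    by (metis lessThan_iff)
  have mono: "p i \<le> p j" if "i \<le> j" for i j using p that by (simp add: strict_mono_less_eq)
  have "inj_on r {..<n}"
  proof (rule linorder_inj_onI)
    fix i j assume "i < j" "i \<in> {..<n}" "j \<in> {..<n}"
    then show "r i \<noteq> r j" using r[of i] r[of j] mono[of "Suc i" j] by auto
  qed auto
  moreover have "p 0 < r i \<and> r i < p n \<and> (\<forall>k. p k \<noteq> r i)" if "i < n" for i
  proof (intro conjI allI)
    show "p 0 < r i" "r i < p n" using r[OF that] mono[of 0 i] mono[of "Suc i" n] that by auto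
    fix k show "p k \<noteq> r i" using r[OF that] mono[of k i] mono[of "Suc i" k] by (cases "k \<le> i") auto
  qed
  ultimately show ?thesis
    using r by (intro exI[of _ "r ` {..<n}"] conjI ballI) (auto simp only: card_image card_lessThan finite_imageI finite_lessThan image_iff lessThan_iff)
qed

text \<open>\<open>Suc n\<close> poles leave \<open>n\<close> gaps with a root in each; for
  \<open>\<tau> > 0\<close> the one missing root lies above the largest pole. All roots exceed
  \<open>p 0\<close>, which later preserves the decay rate, and all residues
  \<open>\<tau> / D q\<close> are positive.\<close>

lemma stieltjes_div_add:
  fixes p w :: "nat \<Rightarrow> real" and n :: nat
  defines "F \<equiv> \<lambda>N z. \<Sum>k<N. w k / (z + p k)"
  assumes p: "strict_mono p" "p 0 > 0" and w: "\<And>k. w k > 0" and \<tau>: "\<tau> > 0" 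
  shows "\<exists>Q b. finite Q \<and> (\<forall>q\<in>Q. p 0 < q \<and> 0 < (b q :: real)) \<and>
     (\<forall>z\<ge>0. F (Suc n) z / (\<tau> + F (Suc n) z) = (\<Sum>q\<in>Q. b q / (z + q)))"
proof -
  obtain Q where Q: "finite Q" "card Q = n" and Q': "\<And>q. q \<in> Q \<Longrightarrow> p 0 < q \<and> q < p n \<and> (\<forall>k. p k \<noteq> q) \<and> \<tau> + (\<Sum>k<Suc n. w k / (- q + p k)) = 0"
    using secular_roots_gaps[of p w n \<tau>, OF p(1) w] by blast
  obtain q0 where q0: "p n < q0" "\<tau> + (\<Sum>k<Suc n. w k / (- q0 + p k)) = 0"
    using secular_root_above[of p w \<tau> n, OF p(1) w \<tau>] by blast
  have mono: "p i \<le> p j" if "i \<le> j" for i j using p that by (simp add: strict_mono_less_eq)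
  define D where "D = (\<lambda>q. \<Sum>k<Suc n. w k / (p k - q)\<^sup>2)"
  let ?Q = "insert q0 Q"
  have nm: "q0 \<notin> Q" using Q' q0 by force
  have gt: "p 0 < q" if "q \<in> ?Q" for q using Q' q0 that mono[of 0 n] by auto
  have ne: "p k \<noteq> q" if "q \<in> ?Q" "k < Suc n" for q k
    using Q' q0 that mono[of k n] by auto
  have D_pos: "D q > 0" if "q \<in> ?Q" for q
    unfolding D_def using ne[OF that] w by (intro sum_pos) (auto intro!: divide_pos_pos)
  have "F (Suc n) z / (\<tau> + F (Suc n) z) = (\<Sum>q\<in>?Q. \<tau> / D q / (z + q))" if z: "z \<ge> 0" for z
    unfolding F_def D_def
  proof (rule secular_partial_fractions)
    show "p k \<noteq> q" if "q \<in> ?Q" "k < Suc n" for q k using ne that .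
    show "\<tau> + (\<Sum>k<Suc n. w k / (- q + p k)) = 0" if "q \<in> ?Q" for q using Q' q0 that by blast
    show "z + p k \<noteq> 0" for k using z p(2) mono[of 0 k] by simp
    show "z + q \<noteq> 0" if "q \<in> ?Q" for q using z p(2) gt[OF that] by simp
  qed (use Q nm \<tau> w in auto)
  then show ?thesis using gt D_pos \<tau> Q by (intro exI[of _ ?Q] exI[of _ "\<lambda>q. \<tau> / D q"]) auto
qed

text \<open>Here the constant is \<open>- \<kappa>\<close> and the missing root is the prescribed
  \<open>d\<close> below \<open>p 0\<close>: taking \<open>\<kappa>\<close> as the value of the
  truncated sum at \<open>- d\<close> keeps this pole in place for every \<open>n\<close>. The minus
  sign of \<open>- \<kappa>\<close> cancels that of the reversed denominator, so the residues
  \<open>\<kappa> / D q\<close> are again positive.\<close>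

lemma stieltjes_div_diff:
  fixes p w :: "nat \<Rightarrow> real" and n :: nat
  defines "F \<equiv> \<lambda>N z. \<Sum>k<N. w k / (z + p k)"
  assumes p: "strict_mono p" "p 0 > 0" and w: "\<And>k. w k > 0" and d: "0 < d" "d < p 0"
  defines "\<kappa> \<equiv> F (Suc n) (- d)"
  shows "\<exists>Q b. finite Q \<and> (\<forall>q\<in>Q. p 0 < q \<and> 0 < (b q :: real)) \<and>
     (\<forall>z\<ge>0. F (Suc n) z / (\<kappa> - F (Suc n) z) = 
        \<kappa> / (\<Sum>k<Suc n. w k / (p k - d)\<^sup>2) / (z + d) + (\<Sum>q\<in>Q. b q / (z + q)))"
proof -
  have mono: "p i \<le> p j" if "i \<le> j" for i j using p that by (simp add: strict_mono_less_eq)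
  have dp: "d < p k" for k using d mono[of 0 k] by simp
  have \<kappa>: "\<kappa> > 0" unfolding \<kappa>_def F_def using w dp by (intro sum_pos) (auto intro!: divide_pos_pos)
  obtain Q where Q: "finite Q" "card Q = n" and Q': "\<And>q. q \<in> Q \<Longrightarrow> p 0 < q \<and> q < p n \<and> (\<forall>k. p k \<noteq> q) \<and> - \<kappa> + (\<Sum>k<Suc n. w k / (- q + p k)) = 0"
    using secular_roots_gaps[of p w n "- \<kappa>", OF p(1) w] by blast
  define D where "D = (\<lambda>q. \<Sum>k<Suc n. w k / (p k - q)\<^sup>2)"
  let ?Q = "insert d Q"
  have nm: "d \<notin> Q" using Q' d by force
  have ne: "p k \<noteq> q" if "q \<in> ?Q" for q k using Q' dp[of k] that by auto
  have D_pos: "D q > 0" if "q \<in> ?Q" for q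
    unfolding D_def using ne[OF that] w by (intro sum_pos) (auto intro!: divide_pos_pos)
  have "F (Suc n) z / (\<kappa> - F (Suc n) z) = \<kappa> / D d / (z + d) + (\<Sum>q\<in>Q. \<kappa> / D q / (z + q))" if z: "z \<ge> 0" for z
  proof -
    have "F (Suc n) z / (- \<kappa> + F (Suc n) z) = (\<Sum>q\<in>?Q. (- \<kappa>) / D q / (z + q))"
      unfolding F_def D_def
    proof (rule secular_partial_fractions)
      show "p k \<noteq> q" if "q \<in> ?Q" "k < Suc n" for q k using ne that by blast
      show "- \<kappa> + (\<Sum>k<Suc n. w k / (- q + p k)) = 0" if "q \<in> ?Q" for q 
        using Q' that by (auto simp: \<kappa>_def F_def)
      show "z + p k \<noteq> 0" for k using z p(2) mono[of 0 k] by simp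
      show "z + q \<noteq> 0" if "q \<in> ?Q" for q using z p(2) Q' d that by fastforce
    qed (use Q nm \<kappa> w in auto)
    moreover have "F (Suc n) z / (\<kappa> - F (Suc n) z) = - (F (Suc n) z / (- \<kappa> + F (Suc n) z))"
      by (simp flip: divide_minus_right)
    ultimately show ?thesis using Q nm by (simp add: sum_negf)
  qed
  then show ?thesis using Q' D_pos \<kappa> Q 
    unfolding D_def by (intro exI[of _ Q] exI[of _ "\<lambda>q. \<kappa> / D q"]) (auto simp: D_def)
qed

section \<open>Fourier inversion\<close>

text \<open>Supplies the hypothesis of Fubini's theorem below; \<open>k\<close> stands for a bounded
  oscillating factor.\<close>

lemma integrable_pair_mult:
  fixes f g :: "real \<Rightarrow> 'a :: {real_normed_field, second_countable_topology, banach}"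
  assumes f: "integrable lborel f" and g: "integrable lborel g"
    and k: "k \<in> borel_measurable (lborel \<Otimes>\<^sub>M lborel)" "\<And>x y. norm (k (x, y)) \<le> B"
  shows "integrable (lborel \<Otimes>\<^sub>M lborel) (\<lambda>(x, y). f x * g y * k (x, y))"
proof -
  have [measurable]: "f \<in> borel_measurable lborel" "g \<in> borel_measurable lborel" "k \<in> borel_measurable (lborel \<Otimes>\<^sub>M lborel)"
    using f g k by auto
  have 1: "integrable (lborel \<Otimes>\<^sub>M lborel) (\<lambda>(x, y). f x * g y)"
  proof (rule lborel_pair.Fubini_integrable)
    show "integrable lborel (\<lambda>x. \<integral>y. norm (case (x, y) of (x, y) \<Rightarrow> f x * g y) \<partial>lborel)"
      using f by (simp add: norm_mult)
    show "AE x in lborel. integrable lborel (\<lambda>y. case (x, y) of (x, y) \<Rightarrow> f x * g y)"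
      using g by simp
  qed measurable
  then have "integrable (lborel \<Otimes>\<^sub>M lborel) (\<lambda>p. B * norm (case p of (x, y) \<Rightarrow> f x * g y))"
    by (intro integrable_mult_right integrable_norm)
  then show ?thesis
  proof (rule Bochner_Integration.integrable_bound)
    show "AE p in lborel \<Otimes>\<^sub>M lborel. norm (case p of (x, y) \<Rightarrow> f x * g y * k (x, y))
         \<le> norm (B * norm (case p of (x, y) \<Rightarrow> f x * g y))"
    proof (intro always_eventually allI, clarify)
      fix x y
      have "norm (f x * g y * k (x, y)) \<le> norm (f x * g y) * B"
        using k(2)[of x y] by (simp add: norm_mult mult_left_mono)
      also have "\<dots> \<le> norm (B * norm (f x * g y))" by (simp only: mult.commute[of _ B] real_norm_def abs_ge_self)
      finally show "norm (f x * g y * k (x, y)) \<le> norm (B * norm (f x * g y))" .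
    qed
  qed measurable
qed

lemma gaussian_fourier:
  fixes s :: real
  assumes n: "n > 0"
  shows "(\<integral>\<xi>. iexp (\<xi> * s) * of_real (exp (- (\<xi> / n)\<^sup>2 / 2)) \<partial>lborel) = complex_of_real (n * sqrt (2 * pi) * exp (- (n * s)\<^sup>2 / 2))"
proof -
  have "(\<integral>\<xi>. iexp (\<xi> * s) * of_real (exp (- (\<xi> / n)\<^sup>2 / 2)) \<partial>lborel)
      = n *\<^sub>R (\<integral>z. iexp (n * z * s) * of_real (exp (- (n * z / n)\<^sup>2 / 2)) \<partial>lborel)"
    using n by (subst lborel_integral_real_affine[where c = n and t = 0]) auto
  also have "(\<integral>z. iexp (n * z * s) * of_real (exp (- (n * z / n)\<^sup>2 / 2)) \<partial>lborel)
      = (\<integral>z. sqrt (2 * pi) *\<^sub>R (std_normal_density z *\<^sub>R iexp (n * s * z)) \<partial>lborel)"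
    using n by (intro Bochner_Integration.integral_cong refl)
      (simp add: std_normal_density_def scaleR_conv_of_real mult_ac real_sqrt_mult flip: exp_of_real)
  also have "\<dots> = sqrt (2 * pi) *\<^sub>R (\<integral>z. std_normal_density z *\<^sub>R iexp (n * s * z) \<partial>lborel)"
    by (rule integral_scaleR_right) 
  also have "(\<integral>z. std_normal_density z *\<^sub>R iexp (n * s * z) \<partial>lborel) = char std_normal_distribution (n * s)"
    unfolding char_def by (subst integral_density) auto
  also have "\<dots> = of_real (exp (- (n * s)\<^sup>2 / 2))"
    by (simp add: char_std_normal_distribution)
  finally show ?thesis by (simp add: scaleR_conv_of_real)
qed

lemma integrable_gaussian: 
  "integrable lborel (\<lambda>z :: real. exp (- z\<^sup>2 / 2))"
proof -
  have "integrable lborel (\<lambda>z. sqrt (2 * pi) * std_normal_density z)"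
    by (intro integrable_mult_right integrable_normal_density) simp
  then show ?thesis by (simp add: std_normal_density_def)
qed

lemma integrable_gaussian_scaled: 
  assumes "n > (0::real)"
  shows "integrable lborel (\<lambda>z :: real. exp (- (z / n)\<^sup>2 / 2))"
  using lborel_integrable_real_affine[OF integrable_gaussian, of "1 / n" 0] assms by simp

text \<open>Gaussian regularization: with a Gaussian of width \<open>Suc n\<close> inserted in
  \<open>\<xi>\<close>, Fubini turns the double integral into a Gaussian average of
  \<open>\<phi>\<close> around \<open>x\<close> at scale \<open>1 / Suc n\<close>. Dominated
  convergence identifies the limits of both sides.\<close>

lemma fourier_inversion:
  fixes \<phi> :: "real \<Rightarrow> complex"
  assumes cont: "continuous_on UNIV \<phi>" and bdd: "\<And>x. norm (\<phi> x) \<le> B" and int: "integrable lborel \<phi>"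
    and int_hat: "integrable lborel (\<lambda>\<xi>. \<integral>y. \<phi> y * iexp (\<xi> * y) \<partial>lborel)"
  shows "(\<integral>\<xi>. (\<integral>y. \<phi> y * iexp (\<xi> * y) \<partial>lborel) * iexp (- \<xi> * x) \<partial>lborel) = 2 * pi * \<phi> x"
proof -
  define F where "F = (\<lambda>\<xi>. \<integral>y. \<phi> y * iexp (\<xi> * y) \<partial>lborel)"
  define g where "g = (\<lambda>n \<xi>. exp (- (\<xi> / real (Suc n))\<^sup>2 / 2))"
  have [measurable]: "\<phi> \<in> borel_measurable borel" using cont by (rule borel_measurable_continuous_onI)
  have [measurable]: "F \<in> borel_measurable borel" unfolding F_def by measurable
  have [measurable]: "g n \<in> borel_measurable borel" for n unfolding g_def by measurable
  have g_le: "0 \<le> g n \<xi>" "g n \<xi> \<le> 1" for n \<xi> by (auto simp: g_def)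
  have g_int: "integrable lborel (g n)" for n
    unfolding g_def by (rule integrable_gaussian_scaled) simp
  have "(\<lambda>n. \<integral>\<xi>. F \<xi> * iexp (- \<xi> * x) * of_real (g n \<xi>) \<partial>lborel) \<longlonglongrightarrow> (\<integral>\<xi>. F \<xi> * iexp (- \<xi> * x) \<partial>lborel)"
  proof (rule integral_dominated_convergence[where w = "\<lambda>\<xi>. norm (F \<xi>)"])
    show "integrable lborel (\<lambda>\<xi>. norm (F \<xi>))" using int_hat unfolding F_def by (rule integrable_norm)
    show "AE \<xi> in lborel. (\<lambda>n. F \<xi> * iexp (- \<xi> * x) * of_real (g n \<xi>)) \<longlonglongrightarrow> F \<xi> * iexp (- \<xi> * x)"
    proof (intro always_eventually allI)
      fix \<xi>
      have "(\<lambda>n. \<xi> * inverse (real (Suc n))) \<longlonglongrightarrow> \<xi> * 0"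
        by (intro tendsto_intros LIMSEQ_inverse_real_of_nat)
      then have "(\<lambda>n. g n \<xi>) \<longlonglongrightarrow> exp (- (\<xi> * 0)\<^sup>2 / 2)"
        unfolding g_def divide_inverse[of \<xi>] by (intro tendsto_exp tendsto_divide tendsto_minus tendsto_power tendsto_const) auto
      then have "(\<lambda>n. F \<xi> * iexp (- \<xi> * x) * of_real (g n \<xi>)) \<longlonglongrightarrow> F \<xi> * iexp (- \<xi> * x) * of_real 1"
        by (intro tendsto_intros) simp
      then show "(\<lambda>n. F \<xi> * iexp (- \<xi> * x) * of_real (g n \<xi>)) \<longlonglongrightarrow> F \<xi> * iexp (- \<xi> * x)" by simp
    qed
    show "AE \<xi> in lborel. norm (F \<xi> * iexp (- \<xi> * x) * of_real (g n \<xi>)) \<le> norm (F \<xi>)" for n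
      using g_le by (intro always_eventually allI) (simp add: norm_mult mult_left_le)
  qed measurable
  moreover have "(\<integral>\<xi>. F \<xi> * iexp (- \<xi> * x) * of_real (g n \<xi>) \<partial>lborel) =
      sqrt (2 * pi) * (\<integral>z. \<phi> (x + 1 / real (Suc n) * z) * of_real (exp (- z\<^sup>2 / 2)) \<partial>lborel)" for n
  proof -
    let ?n = "real (Suc n)"
    have "(\<integral>\<xi>. F \<xi> * iexp (- \<xi> * x) * of_real (g n \<xi>) \<partial>lborel)
      = (\<integral>\<xi>. (\<integral>y. \<phi> y * of_real (g n \<xi>) * iexp (\<xi> * (y - x)) \<partial>lborel) \<partial>lborel)"
      unfolding F_def
      by (intro Bochner_Integration.integral_cong refl)
        (simp flip: integral_mult_left_zero, simp add: mult_ac ring_distribs exp_diff exp_minus divide_inverse)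
    also have "\<dots> = (\<integral>y. (\<integral>\<xi>. \<phi> y * of_real (g n \<xi>) * iexp (\<xi> * (y - x)) \<partial>lborel) \<partial>lborel)"
    proof (rule lborel_pair.Fubini_integral)
      show "integrable (lborel \<Otimes>\<^sub>M lborel) (\<lambda>(y, \<xi>). \<phi> y * of_real (g n \<xi>) * iexp (\<xi> * (y - x)))"
        using integrable_pair_mult[OF int integrable_of_real[OF g_int[of n]], of "\<lambda>(y, \<xi>). iexp (\<xi> * (y - x))" 1]
        by simp
    qed
    also have "\<dots> = (\<integral>y. \<phi> y * of_real (?n * sqrt (2 * pi) * exp (- (?n * (y - x))\<^sup>2 / 2)) \<partial>lborel)"
    proof (intro Bochner_Integration.integral_cong refl)
      fix y
      have "(\<integral>\<xi>. \<phi> y * of_real (g n \<xi>) * iexp (\<xi> * (y - x)) \<partial>lborel)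
         = \<phi> y * (\<integral>\<xi>. iexp (\<xi> * (y - x)) * of_real (g n \<xi>) \<partial>lborel)"
        by (subst integral_mult_right_zero[symmetric]) (simp add: mult_ac)
      then show "(\<integral>\<xi>. \<phi> y * of_real (g n \<xi>) * iexp (\<xi> * (y - x)) \<partial>lborel)
         = \<phi> y * of_real (?n * sqrt (2 * pi) * exp (- (?n * (y - x))\<^sup>2 / 2))"
        unfolding g_def by (subst (asm) gaussian_fourier) auto
    qed
    also have "\<dots> = (1 / ?n) *\<^sub>R (\<integral>z. \<phi> (x + 1 / ?n * z) * of_real (?n * sqrt (2 * pi) * exp (- z\<^sup>2 / 2)) \<partial>lborel)"
      by (subst lborel_integral_real_affine[where c = "1 / ?n" and t = x]) auto
    also have "(\<integral>z. \<phi> (x + 1 / ?n * z) * of_real (?n * sqrt (2 * pi) * exp (- z\<^sup>2 / 2)) \<partial>lborel)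
       = (?n * sqrt (2 * pi)) * (\<integral>z. \<phi> (x + 1 / ?n * z) * of_real (exp (- z\<^sup>2 / 2)) \<partial>lborel)"
      by (subst integral_mult_right_zero[symmetric]) (simp only: mult_ac of_real_mult)
    finally show ?thesis by (simp add: scaleR_conv_of_real del: of_nat_Suc)
  qed
  ultimately have lim1: "(\<lambda>n. sqrt (2 * pi) * (\<integral>z. \<phi> (x + 1 / real (Suc n) * z) * of_real (exp (- z\<^sup>2 / 2)) \<partial>lborel))
     \<longlonglongrightarrow> (\<integral>\<xi>. F \<xi> * iexp (- \<xi> * x) \<partial>lborel)"
    by simp
  have "(\<lambda>n. \<integral>z. \<phi> (x + 1 / real (Suc n) * z) * of_real (exp (- z\<^sup>2 / 2)) \<partial>lborel) 
     \<longlonglongrightarrow> (\<integral>z. \<phi> x * of_real (exp (- z\<^sup>2 / 2)) \<partial>lborel)"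
  proof (rule integral_dominated_convergence[where w = "\<lambda>z. B * exp (- z\<^sup>2 / 2)"])
    show "integrable lborel (\<lambda>z. B * exp (- z\<^sup>2 / 2))" by (intro integrable_mult_right integrable_gaussian)
    show "AE z in lborel. (\<lambda>n. \<phi> (x + 1 / real (Suc n) * z) * of_real (exp (- z\<^sup>2 / 2))) \<longlonglongrightarrow> \<phi> x * of_real (exp (- z\<^sup>2 / 2))"
    proof (intro always_eventually allI)
      fix z
      have "(\<lambda>n. x + inverse (real (Suc n)) * z) \<longlonglongrightarrow> x + 0 * z"
        by (intro tendsto_intros LIMSEQ_inverse_real_of_nat)
      then have "(\<lambda>n. x + 1 / real (Suc n) * z) \<longlonglongrightarrow> x" by (simp add: inverse_eq_divide)
      then have "(\<lambda>n. \<phi> (x + 1 / real (Suc n) * z)) \<longlonglongrightarrow> \<phi> x"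
        using cont by (auto simp: continuous_on_eq_continuous_at intro: isCont_tendsto_compose)
      then show "(\<lambda>n. \<phi> (x + 1 / real (Suc n) * z) * of_real (exp (- z\<^sup>2 / 2))) \<longlonglongrightarrow> \<phi> x * of_real (exp (- z\<^sup>2 / 2))"
        by (intro tendsto_intros)
    qed
    show "AE z in lborel. norm (\<phi> (x + 1 / real (Suc n) * z) * of_real (exp (- z\<^sup>2 / 2))) \<le> B * exp (- z\<^sup>2 / 2)" for n
      using bdd by (intro always_eventually allI) (simp add: norm_mult mult_right_mono)
  qed measurable
  also have "(\<integral>z. \<phi> x * of_real (exp (- z\<^sup>2 / 2)) \<partial>lborel) = \<phi> x * sqrt (2 * pi)"
    using gaussian_fourier[of 1 0] by simp
  finally have "(\<lambda>n. sqrt (2 * pi) * (\<integral>z. \<phi> (x + 1 / real (Suc n) * z) * of_real (exp (- z\<^sup>2 / 2)) \<partial>lborel))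
     \<longlonglongrightarrow> sqrt (2 * pi) * (\<phi> x * sqrt (2 * pi))"
    by (intro tendsto_intros)
  from LIMSEQ_unique[OF lim1 this] show ?thesis
    by (simp add: F_def mult_ac flip: of_real_mult real_sqrt_mult) 
qed

section \<open>Even functions and the cosine transform\<close>

lemma integral_odd:
  fixes f :: "real \<Rightarrow> real"
  assumes "\<And>x. f (- x) = - f x"
  shows "(\<integral>x. f x \<partial>lborel) = 0"
  using lborel_integral_real_affine[of "-1" f 0] assms by simp

text \<open>For even functions this is the Fourier transform without a normalizing factor, so that
  inversion produces \<open>2 * pi\<close>. Real values keep arguments by sign and order
  available.\<close>

definition cos_transform :: "(real \<Rightarrow> real) \<Rightarrow> real \<Rightarrow> real" where
  "cos_transform h \<xi> = (\<integral>x. h x * cos (\<xi> * x) \<partial>lborel)"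

lemma integrable_mult_cos:
  fixes h :: "real \<Rightarrow> real"
  assumes [measurable]: "integrable lborel h" shows "integrable lborel (\<lambda>x. h x * cos (\<xi> * x))"
proof (rule Bochner_Integration.integrable_bound[OF assms])
  show "AE x in lborel. norm (h x * cos (\<xi> * x)) \<le> norm (h x)"
    by (intro AE_I2) (simp add: abs_mult mult_left_le)
qed measurable

lemma integrable_mult_sin:
  fixes h :: "real \<Rightarrow> real"
  assumes [measurable]: "integrable lborel h" shows "integrable lborel (\<lambda>x. h x * sin (\<xi> * x))"
proof (rule Bochner_Integration.integrable_bound[OF assms])
  show "AE x in lborel. norm (h x * sin (\<xi> * x)) \<le> norm (h x)"
    by (intro AE_I2) (simp add: abs_mult mult_left_le)
qed measurable

lemma even_fourier_transform:
  fixes h :: "real \<Rightarrow> real"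
  assumes h: "integrable lborel h" and even: "\<And>x. h (- x) = h x"
  shows "(\<integral>x. of_real (h x) * iexp (\<xi> * x) \<partial>lborel) = of_real (cos_transform h \<xi>)"
proof -
  have eq: "of_real (h x) * iexp (\<xi> * x) = of_real (h x * cos (\<xi> * x)) + \<i> * of_real (h x * sin (\<xi> * x))" for x
    by (simp add: cis_conv_exp[symmetric] complex_eq_iff flip: of_real_mult) 
  have "(\<integral>x. of_real (h x) * iexp (\<xi> * x) \<partial>lborel) 
      = of_real (\<integral>x. h x * cos (\<xi> * x) \<partial>lborel) + \<i> * of_real (\<integral>x. h x * sin (\<xi> * x) \<partial>lborel)"
    unfolding eq using integrable_mult_cos[OF h] integrable_mult_sin[OF h]
    by (subst Bochner_Integration.integral_add) (auto simp del: of_real_mult)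
  also have "(\<integral>x. h x * sin (\<xi> * x) \<partial>lborel) = 0"
    by (rule integral_odd) (simp add: even)
  finally show ?thesis by (simp add: cos_transform_def)
qed

lemma cos_transform_inversion:
  assumes cont: "continuous_on UNIV h" and bdd: "\<And>x. \<bar>h x\<bar> \<le> B" and h: "integrable lborel h" and even: "\<And>x. h (- x) = h x"
    and int: "integrable lborel (cos_transform h)"
  shows "cos_transform (cos_transform h) x = 2 * pi * h x"
proof -
  have even': "cos_transform h (- \<xi>) = cos_transform h \<xi>" for \<xi> by (simp add: cos_transform_def)
  have "(\<integral>\<xi>. (\<integral>y. of_real (h y) * iexp (\<xi> * y) \<partial>lborel) * iexp (- \<xi> * x) \<partial>lborel) = 2 * pi * complex_of_real (h x)"
  proof (rule fourier_inversion[where B = B])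
    show "integrable lborel (\<lambda>\<xi>. \<integral>y. of_real (h y) * iexp (\<xi> * y) \<partial>lborel)"
      using int by (simp only: even_fourier_transform[OF h even] integrable_of_real)
  qed (use cont bdd h in \<open>auto intro!: continuous_intros\<close>)
  also have "(\<integral>\<xi>. (\<integral>y. of_real (h y) * iexp (\<xi> * y) \<partial>lborel) * iexp (- \<xi> * x) \<partial>lborel)
      = (\<integral>\<xi>. of_real (cos_transform h \<xi>) * iexp (- x * \<xi>) \<partial>lborel)"
    by (simp only: even_fourier_transform[OF h even] mult.commute[of x] minus_mult_left[symmetric] mult_minus_right)
  also have "\<dots> = of_real (cos_transform (cos_transform h) (- x))"
    by (rule even_fourier_transform[OF int even'])
  finally have "complex_of_real (cos_transform (cos_transform h) (- x)) = of_real (2 * pi * h x)"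
    by simp
  then show ?thesis by (simp only: of_real_eq_iff) (simp add: cos_transform_def)
qed

section \<open>Kernels dominated by exponentials\<close>

lemma lorentz:
  fixes s :: real
  assumes s: "s > 0"
  shows integrable_lorentz: "integrable lborel (\<lambda>x. 1 / (x\<^sup>2 + s))"
    and integral_lorentz: "(\<integral>x. 1 / (x\<^sup>2 + s) \<partial>lborel) = pi / sqrt s"
proof -
  have 1: "integrable lborel (\<lambda>x :: real. inverse (1 + x\<^sup>2))"
    using integrable_inverse_1_plus_square by (simp add: set_integrable_def)
  have 2: "(\<integral>x. inverse (1 + x\<^sup>2) \<partial>lborel) = pi"
    using LBINT_inverse_1_plus_square
    by (simp add: interval_lebesgue_integral_def set_lebesgue_integral_def)
  have eq: "1 / ((0 + sqrt s * x)\<^sup>2 + s) = inverse s * inverse (1 + x\<^sup>2)" for x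
    using s by (simp add: power_mult_distrib field_simps)
  show "integrable lborel (\<lambda>x. 1 / (x\<^sup>2 + s))"
    using s integrable_mult_right[OF 1, of "inverse s"] 
    by (subst lborel_integrable_real_affine_iff[of "sqrt s" _ 0, symmetric]) (simp_all only: eq, auto)
  have "(\<integral>x. 1 / (x\<^sup>2 + s) \<partial>lborel) = sqrt s * (inverse s * pi)"
    using s by (subst lborel_integral_real_affine[of "sqrt s" _ 0]) (simp_all only: eq integral_mult_right_zero 2, auto)
  also have "\<dots> = pi / sqrt s"
    using s real_sqrt_mult_self[of s] by (simp add: field_simps)
  finally show "(\<integral>x. 1 / (x\<^sup>2 + s) \<partial>lborel) = pi / sqrt s" .
qed

lemma even_integral_half:
  fixes f :: "real \<Rightarrow> real"
  assumes f: "integrable lborel f" and even: "\<And>x. f (- x) = f x"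
  shows "(\<integral>x. f x \<partial>lborel) = 2 * (LBINT x=0..\<infinity>. f x)"
proof -
  have i: "interval_lebesgue_integrable lborel (-\<infinity>) \<infinity> f"
    using f by (simp add: interval_lebesgue_integrable_def set_integrable_def)
  have "(LBINT x=-\<infinity>..0. f x) + (LBINT x=0..\<infinity>. f x) = (LBINT x=-\<infinity>..\<infinity>. f x)"
    by (rule interval_integral_sum) (use i in \<open>simp add: min_def max_def\<close>)
  moreover have "(LBINT x=-\<infinity>..0. f x) = (LBINT x=0..\<infinity>. f x)"
    by (subst interval_integral_reflect) (simp add: even)
  moreover have "(LBINT x=-\<infinity>..\<infinity>. f x) = (\<integral>x. f x \<partial>lborel)"
    by (simp add: interval_lebesgue_integral_def set_lebesgue_integral_def)
  ultimately show ?thesis by simp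
qed

lemma exp_abs_transform:
  fixes a :: real
  assumes a: "a > 0"
  shows integrable_exp_abs: "integrable lborel (\<lambda>x. exp (- a * \<bar>x\<bar>))"
    and cos_transform_exp_abs: "cos_transform (\<lambda>x. exp (- a * \<bar>x\<bar>)) \<xi> = 2 * a / (\<xi>\<^sup>2 + a\<^sup>2)"
proof -
  have 1: "integrable lborel (\<lambda>x. indicator {0<..} x * exp (- a * x))"
    using integrable_I0i_exp_mscale[OF a]
    by (simp add: interval_lebesgue_integrable_def set_integrable_def einterval_eq mult.commute zero_ereal_def)
  then have "integrable lborel (\<lambda>x. indicator {0<..} x * exp (- a * x) + indicator {0<..} (0 + (-1) * x) * exp (- a * (0 + (-1) * x)))"
    using lborel_integrable_real_affine[OF 1, of "-1" 0]
    by (intro Bochner_Integration.integrable_add) auto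
  then show int: "integrable lborel (\<lambda>x. exp (- a * \<bar>x\<bar>))"
  proof (rule Bochner_Integration.integrable_bound)
    show "AE x in lborel. norm (exp (- a * \<bar>x\<bar>)) \<le> norm (indicator {0<..} x * exp (- a * x) +
          indicator {0<..} (0 + (-1) * x) * exp (- a * (0 + (-1) * x)))"
      using AE_lborel_singleton[of "0::real"] by eventually_elim (auto simp: indicator_def)
  qed measurable
  \<comment> \<open>The antiderivative of \<open>exp (- a * x) * cos (\<xi> * x)\<close> that
    vanishes at infinity.\<close>
  define F where "F = (\<lambda>x. exp (- a * x) * (\<xi> * sin (\<xi> * x) - a * cos (\<xi> * x)) / (\<xi>\<^sup>2 + a\<^sup>2))"
  have p: "\<xi>\<^sup>2 + a\<^sup>2 > 0" using a by (simp add: add_nonneg_pos)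
  have "(LBINT x=0..\<infinity>. exp (- a * x) * cos (\<xi> * x)) = 0 - (- a / (\<xi>\<^sup>2 + a\<^sup>2))"
  proof (rule interval_integral_FTC_integrable[where F = F])
    fix x
    have "((\<lambda>x. exp (- a * x) * (\<xi> * sin (\<xi> * x) - a * cos (\<xi> * x))) has_field_derivative
        (exp (- a * x) * (\<xi> * (\<xi> * cos (\<xi> * x)) + a * (\<xi> * sin (\<xi> * x)))
        - a * exp (- a * x) * (\<xi> * sin (\<xi> * x) - a * cos (\<xi> * x)))) (at x)"
      by (auto intro!: derivative_eq_intros simp: algebra_simps)
    from DERIV_cdivide[OF this, of "\<xi>\<^sup>2 + a\<^sup>2"]
    have "(F has_field_derivative (exp (- a * x) * (\<xi> * (\<xi> * cos (\<xi> * x)) + a * (\<xi> * sin (\<xi> * x)))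
        - a * exp (- a * x) * (\<xi> * sin (\<xi> * x) - a * cos (\<xi> * x))) / (\<xi>\<^sup>2 + a\<^sup>2)) (at x)"
      unfolding F_def .
    also have "(exp (- a * x) * (\<xi> * (\<xi> * cos (\<xi> * x)) + a * (\<xi> * sin (\<xi> * x)))
        - a * exp (- a * x) * (\<xi> * sin (\<xi> * x) - a * cos (\<xi> * x))) = exp (- a * x) * cos (\<xi> * x) * (\<xi>\<^sup>2 + a\<^sup>2)"
      by (simp add: algebra_simps power2_eq_square)
    finally show "(F has_vector_derivative exp (- a * x) * cos (\<xi> * x)) (at x)"
      using p a by (simp add: has_real_derivative_iff_has_vector_derivative)
    show "isCont (\<lambda>x. exp (- a * x) * cos (\<xi> * x)) x" by (intro continuous_intros)
  next
    have "integrable lborel (\<lambda>x. indicator {0<..} x * (exp (- a * \<bar>x\<bar>) * cos (\<xi> * x)))"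
      by (rule Bochner_Integration.integrable_bound[OF int]) (auto simp: indicator_def abs_mult mult_left_le)
    then show "set_integrable lborel (einterval 0 \<infinity>) (\<lambda>x. exp (- a * x) * cos (\<xi> * x))"
      unfolding set_integrable_def
      by (rule Bochner_Integration.integrable_cong[THEN iffD1, rotated -1]) (auto simp: indicator_def einterval_def)
  next
    have "isCont F 0" unfolding F_def using p by (intro continuous_intros) auto
    then have "(F \<longlongrightarrow> F 0) (at_right 0)"
      by (meson continuous_at_imp_continuous_within continuous_within)
    then show "((F \<circ> real_of_ereal) \<longlongrightarrow> - a / (\<xi>\<^sup>2 + a\<^sup>2)) (at_right 0)"
      unfolding zero_ereal_def ereal_tendsto_simps by (simp add: F_def)
  next
    have "(F \<longlongrightarrow> 0) at_top"
    proof (rule Lim_null_comparison)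
      show "\<forall>\<^sub>F x in at_top. norm (F x) \<le> exp (- a * x) * ((\<bar>\<xi>\<bar> + a) / (\<xi>\<^sup>2 + a\<^sup>2))"
      proof (intro always_eventually allI)
        fix x
        have "\<bar>\<xi> * sin (\<xi> * x) - a * cos (\<xi> * x)\<bar> \<le> \<bar>\<xi> * sin (\<xi> * x)\<bar> + \<bar>a * cos (\<xi> * x)\<bar>"
          by (rule abs_triangle_ineq4)
        also have "\<dots> \<le> \<bar>\<xi>\<bar> * 1 + a * 1"
          using a by (intro add_mono) (auto simp: abs_mult mult_left_le)
        finally show "norm (F x) \<le> exp (- a * x) * ((\<bar>\<xi>\<bar> + a) / (\<xi>\<^sup>2 + a\<^sup>2))"
          using p by (simp add: F_def abs_mult divide_right_mono mult_left_mono)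
      qed
      show "((\<lambda>x. exp (- a * x) * ((\<bar>\<xi>\<bar> + a) / (\<xi>\<^sup>2 + a\<^sup>2))) \<longlongrightarrow> 0) at_top"
        using a by (intro tendsto_mult_left_zero) real_asymp
    qed
    then show "((F \<circ> real_of_ereal) \<longlongrightarrow> 0) (at_left \<infinity>)"
      unfolding ereal_tendsto_simps .
  qed simp
  moreover have "(LBINT x=0..\<infinity>. exp (- a * \<bar>x\<bar>) * cos (\<xi> * x)) = (LBINT x=0..\<infinity>. exp (- a * x) * cos (\<xi> * x))"
    by (intro interval_integral_cong) (auto simp: einterval_iff)
  moreover have "cos_transform (\<lambda>x. exp (- a * \<bar>x\<bar>)) \<xi> = 2 * (LBINT x=0..\<infinity>. exp (- a * \<bar>x\<bar>) * cos (\<xi> * x))"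
    unfolding cos_transform_def by (rule even_integral_half[OF integrable_mult_cos[OF int]]) simp
  ultimately show "cos_transform (\<lambda>x. exp (- a * \<bar>x\<bar>)) \<xi> = 2 * a / (\<xi>\<^sup>2 + a\<^sup>2)"
    by simp
qed

text \<open>Minimized over \<open>s\<close>, the midpoint inequality says that the square of
  \<open>h ((x + y) / 2)\<close> is at most \<open>h x * h y\<close>. The parameter makes it linear
  in \<open>h\<close>, so that it passes to sums, limits and integrals. Both inequalities avoid the
  origin, where kernels may be unbounded.\<close>

definition exp_kernel :: "real \<Rightarrow> (real \<Rightarrow> real) \<Rightarrow> (real \<Rightarrow> real) \<Rightarrow> bool" where
  "exp_kernel a E h \<longleftrightarrow> integrable lborel h \<and> (\<forall>x. h (- x) = h x) \<and> (\<forall>x. 0 \<le> h x) \<and>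
     (\<forall>x>0. \<forall>d\<ge>0. h (x + d) \<le> exp (- a * d) * h x) \<and>
     (\<forall>x>0. \<forall>y>0. \<forall>s>0. 2 * h ((x + y) / 2) \<le> s * h x + h y / s) \<and> (\<forall>\<xi>. cos_transform h \<xi> = E \<xi>)"

lemma exp_kernelD:
  assumes "exp_kernel a E h"
  shows "integrable lborel h" "h (- x) = h x" "0 \<le> h x" "cos_transform h \<xi> = E \<xi>"
    and "0 < x \<Longrightarrow> 0 \<le> d \<Longrightarrow> h (x + d) \<le> exp (- a * d) * h x"
    and "0 < x \<Longrightarrow> 0 < y \<Longrightarrow> 0 < s \<Longrightarrow> 2 * h ((x + y) / 2) \<le> s * h x + h y / s"
  using assms by (simp_all add: exp_kernel_def)

lemma cos_transform_sum:
  assumes "\<And>i. i \<in> I \<Longrightarrow> integrable lborel (f i)"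
  shows "cos_transform (\<lambda>x. \<Sum>i\<in>I. b i * f i x) \<xi> = (\<Sum>i\<in>I. b i * cos_transform (f i) \<xi>)"
proof -
  have "cos_transform (\<lambda>x. \<Sum>i\<in>I. b i * f i x) \<xi> = (\<integral>x. (\<Sum>i\<in>I. b i * (f i x * cos (\<xi> * x))) \<partial>lborel)"
    by (simp add: cos_transform_def sum_distrib_right mult.assoc)
  also have "\<dots> = (\<Sum>i\<in>I. \<integral>x. b i * (f i x * cos (\<xi> * x)) \<partial>lborel)"
    by (intro Bochner_Integration.integral_sum integrable_mult_right integrable_mult_cos assms)
  finally show ?thesis by (simp add: cos_transform_def)
qed

text \<open>The factor \<open>1 / (2 * y i)\<close> makes the transform a plain partial fraction sum
  with numerators \<open>b i\<close>.\<close>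

definition exp_sum :: "'i set \<Rightarrow> ('i \<Rightarrow> real) \<Rightarrow> ('i \<Rightarrow> real) \<Rightarrow> real \<Rightarrow> real" where
  "exp_sum I b y x = (\<Sum>i\<in>I. b i / (2 * y i) * exp (- y i * \<bar>x\<bar>))"

lemma exp_sum_props:
  assumes y: "\<And>i. i \<in> I \<Longrightarrow> y i > 0"
  shows integrable_exp_sum: "integrable lborel (exp_sum I b y)"
    and cos_transform_exp_sum: "cos_transform (exp_sum I b y) \<xi> = (\<Sum>i\<in>I. b i / (\<xi>\<^sup>2 + (y i)\<^sup>2))"
    and exp_sum_bound: "\<bar>exp_sum I b y x\<bar> \<le> (\<Sum>i\<in>I. \<bar>b i / (2 * y i)\<bar>)"
proof -
  show "integrable lborel (exp_sum I b y)"
    unfolding exp_sum_def using integrable_exp_abs[OF y] by (intro Bochner_Integration.integrable_sum integrable_mult_right) auto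
  have "cos_transform (exp_sum I b y) \<xi> = (\<Sum>i\<in>I. b i / (2 * y i) * cos_transform (\<lambda>x. exp (- y i * \<bar>x\<bar>)) \<xi>)"
    unfolding exp_sum_def by (rule cos_transform_sum[OF integrable_exp_abs[OF y]])
  also have "\<dots> = (\<Sum>i\<in>I. b i / (\<xi>\<^sup>2 + (y i)\<^sup>2))"
  proof (intro sum.cong refl)
    fix i assume "i \<in> I"
    then show "b i / (2 * y i) * cos_transform (\<lambda>x. exp (- y i * \<bar>x\<bar>)) \<xi> = b i / (\<xi>\<^sup>2 + (y i)\<^sup>2)"
      using y[of i] unfolding cos_transform_exp_abs[OF y[OF \<open>i \<in> I\<close>]] by simp
  qed
  finally show "cos_transform (exp_sum I b y) \<xi> = (\<Sum>i\<in>I. b i / (\<xi>\<^sup>2 + (y i)\<^sup>2))" .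
  show "\<bar>exp_sum I b y x\<bar> \<le> (\<Sum>i\<in>I. \<bar>b i / (2 * y i)\<bar>)"
    unfolding exp_sum_def
  proof (rule order_trans[OF sum_abs], rule sum_mono)
    fix i assume "i \<in> I"
    then have "- y i * \<bar>x\<bar> \<le> 0" using y[of i] by (simp add: less_imp_le)
    then have "exp (- y i * \<bar>x\<bar>) \<le> 1" by simp
    then show "\<bar>b i / (2 * y i) * exp (- y i * \<bar>x\<bar>)\<bar> \<le> \<bar>b i / (2 * y i)\<bar>"
      unfolding abs_mult by (intro mult_left_le) auto
  qed
qed

lemma continuous_on_exp_sum: "continuous_on UNIV (exp_sum I b y)"
  unfolding exp_sum_def by (intro continuous_intros)

lemma exp_sum_minus [simp]: "exp_sum I b y (- x) = exp_sum I b y x"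
  by (simp add: exp_sum_def)

lemma exp_kernel_exp_sum:
  assumes y: "\<And>i. i \<in> I \<Longrightarrow> y i \<ge> a" and a: "a > 0" and b: "\<And>i. i \<in> I \<Longrightarrow> b i > 0"
  shows "exp_kernel a (\<lambda>\<xi>. \<Sum>i\<in>I. b i / (\<xi>\<^sup>2 + (y i)\<^sup>2)) (exp_sum I b y)"
  unfolding exp_kernel_def
proof (intro conjI allI impI)
  have y': "y i > 0" if "i \<in> I" for i using y[OF that] a by simp
  show "integrable lborel (exp_sum I b y)" by (rule integrable_exp_sum[OF y'])
  show "cos_transform (exp_sum I b y) \<xi> = (\<Sum>i\<in>I. b i / (\<xi>\<^sup>2 + (y i)\<^sup>2))" for \<xi> 
    by (rule cos_transform_exp_sum[OF y'])
  show "0 \<le> exp_sum I b y x" for x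
    unfolding exp_sum_def using b y' by (intro sum_nonneg mult_nonneg_nonneg) (auto simp: less_imp_le)
  show "2 * exp_sum I b y ((x + z) / 2) \<le> s * exp_sum I b y x + exp_sum I b y z / s"
    if "x > 0" "z > 0" "s > 0" for x z s
    unfolding exp_sum_def sum_distrib_left sum_divide_distrib sum.distrib[symmetric]
  proof (rule sum_mono)
    fix i assume i: "i \<in> I"
    \<comment> \<open>In terms of these square roots of exponentials, the midpoint inequality for a
      single summand is \<open>0 \<le> (s * A - B)\<^sup>2 / s\<close>.\<close>
    define A where "A = exp (- y i * x / 2)"
    define B where "B = exp (- y i * z / 2)"
    have e: "exp (- y i * \<bar>(x + z) / 2\<bar>) = A * B" "exp (- y i * \<bar>x\<bar>) = A * A" "exp (- y i * \<bar>z\<bar>) = B * B"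
      unfolding A_def B_def using that by (simp_all add: field_simps flip: exp_add)
    have "0 \<le> (s * A - B)\<^sup>2 / s" using that by simp
    also have "(s * A - B)\<^sup>2 / s = s * (A * A) + B * B / s - 2 * (A * B)"
      using that by (simp add: field_simps power2_eq_square)
    finally have "b i / (2 * y i) * (2 * (A * B)) \<le> b i / (2 * y i) * (s * (A * A) + B * B / s)"
      using b[OF i] y'[OF i] by (intro mult_left_mono) auto
    then show "2 * (b i / (2 * y i) * exp (- y i * \<bar>(x + z) / 2\<bar>)) \<le>
        s * (b i / (2 * y i) * exp (- y i * \<bar>x\<bar>)) + b i / (2 * y i) * exp (- y i * \<bar>z\<bar>) / s"
      unfolding e by (simp add: algebra_simps)
  qed
  fix x d :: real assume xd: "x > 0" "d \<ge> 0"
  show "exp_sum I b y (x + d) \<le> exp (- a * d) * exp_sum I b y x"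
    unfolding exp_sum_def sum_distrib_left
  proof (rule sum_mono)
    fix i assume i: "i \<in> I"
    have "- y i * \<bar>x + d\<bar> \<le> - a * d + - y i * \<bar>x\<bar>"
      using mult_right_mono[OF y[OF i] xd(2)] xd by (simp add: algebra_simps)
    then have "exp (- y i * \<bar>x + d\<bar>) \<le> exp (- a * d) * exp (- y i * \<bar>x\<bar>)"
      by (simp flip: exp_add)
    then have "b i / (2 * y i) * exp (- y i * \<bar>x + d\<bar>) \<le> b i / (2 * y i) * (exp (- a * d) * exp (- y i * \<bar>x\<bar>))"
      using b[OF i] y'[OF i] by (intro mult_left_mono) auto
    then show "b i / (2 * y i) * exp (- y i * \<bar>x + d\<bar>) \<le> exp (- a * d) * (b i / (2 * y i) * exp (- y i * \<bar>x\<bar>))"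
      by (simp add: mult_ac)
  qed
qed simp

section \<open>Monotonicity, strict positivity and mass bounds\<close>

lemma exp_kernel_antimono:
  assumes "exp_kernel a E h" "a \<ge> 0" "0 < \<bar>x\<bar>" "\<bar>x\<bar> \<le> \<bar>y\<bar>"
  shows "h y \<le> exp (- a * (\<bar>y\<bar> - \<bar>x\<bar>)) * h x"
proof -
  have ev: "h \<bar>z\<bar> = h z" for z using assms(1) by (simp add: exp_kernel_def abs_if)
  have "h (\<bar>x\<bar> + (\<bar>y\<bar> - \<bar>x\<bar>)) \<le> exp (- a * (\<bar>y\<bar> - \<bar>x\<bar>)) * h \<bar>x\<bar>"
    using assms unfolding exp_kernel_def by (metis (no_types, opaque_lifting) diff_ge_0_iff_ge)
  then show ?thesis by (simp add: ev)
qed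

lemma exp_kernel_antimono':
  assumes "exp_kernel a E h" "a \<ge> 0" "0 < \<bar>x\<bar>" "\<bar>x\<bar> \<le> \<bar>y\<bar>"
  shows "h y \<le> h x"
proof -
  have "h y \<le> exp (- a * (\<bar>y\<bar> - \<bar>x\<bar>)) * h x" by (rule exp_kernel_antimono[OF assms])
  also have "\<dots> \<le> 1 * h x" using assms by (intro mult_right_mono) (auto simp: exp_kernel_def)
  finally show ?thesis by simp
qed

text \<open>A zero would spread: to the right by monotonicity, and towards the origin by the
  midpoint inequality, which halves the distance each time. It would finally cover
  \<open>x0\<close>.\<close>

lemma exp_kernel_pos:
  assumes h: "exp_kernel a E h" and a: "a \<ge> 0" and x0: "x0 > 0" "h x0 > 0" and y: "y > 0"
  shows "h y > 0"
proof (rule ccontr)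
  have nn: "0 \<le> h x" for x using h by (simp add: exp_kernel_def)
  assume "\<not> h y > 0"
  with nn[of y] have y0: "h y = 0" by simp
  have mid: "h ((x + z) / 2) = 0" if "x > 0" "z > 0" "h z = 0" for x z
  proof -
    have le: "2 * h ((x + z) / 2) \<le> s * h x" if "s > 0" for s
      using h \<open>x > 0\<close> \<open>z > 0\<close> \<open>h z = 0\<close> that unfolding exp_kernel_def by fastforce
    have *: "2 * h ((x + z) / 2) \<le> s * (h x + 1)" if "s > 0" for s
      using le[OF that] that by (simp add: distrib_left)
    \<comment> \<open>Since \<open>h z = 0\<close>, the right-hand side is a multiple of
      \<open>s\<close>, and \<open>s\<close> is arbitrarily small. Using \<open>h x + 1\<close> in
      place of \<open>h x\<close> keeps the quotient \<open>e / (h x + 1)\<close> meaningful when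
      \<open>h x = 0\<close>.\<close>
    have "2 * h ((x + z) / 2) \<le> 0"
    proof (rule field_le_epsilon)
      fix e :: real assume "e > 0"
      then show "2 * h ((x + z) / 2) \<le> 0 + e"
        using *[of "e / (h x + 1)"] nn[of x] by (simp add: add_nonneg_pos)
    qed
    then show ?thesis using nn[of "(x + z) / 2"] by simp
  qed
  have zero: "h x = 0" if "x > y / 2 ^ n" for n x
    using that
  proof (induction n arbitrary: x)
    case 0
    then have "h x \<le> h y" using exp_kernel_antimono'[OF h a, of y x] y by simp
    then show ?case using y0 nn[of x] by simp
  next
    case (Suc n)
    then have "y / 2 ^ n < 2 * x" by simp
    then obtain z where z: "y / 2 ^ n < z" "z < 2 * x" using dense by blast
    moreover have "z > 0" using z(1) y by (intro less_trans[OF _ z(1)]) simp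
    ultimately show ?case using mid[of "2 * x - z" z] Suc.IH by simp
  qed
  obtain n where "y / x0 < 2 ^ n" using real_arch_pow[of 2 "y / x0"] by auto
  then have "y / 2 ^ n < x0" using x0 by (simp add: field_simps)
  then show False using zero x0 by force
qed

text \<open>By monotonicity the mass on \<open>{-x..x}\<close> is at least
  \<open>2 * x * h x\<close>, and the total mass is the transform at 0.\<close>

lemma exp_kernel_le:
  assumes h: "exp_kernel a E h" and a: "a \<ge> 0" and x: "x > 0"
  shows "h x \<le> E 0 / (2 * x)"
proof -
  have "integrable lborel h" using h by (simp add: exp_kernel_def)
  have "2 * x * h x = (\<integral>y. h x * indicator {-x..x} y \<partial>lborel)"
    using x by simp
  also have "\<dots> \<le> (\<integral>y. h y \<partial>lborel)"
  proof (rule integral_mono_AE)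
    show "integrable lborel (\<lambda>y. h x * indicator {- x..x} y)"
      by (intro integrable_mult_right integrable_real_indicator) (auto simp: emeasure_lborel_Icc_eq)
    have "AE y in lborel. y \<noteq> (0::real)" by (rule AE_lborel_singleton)
    then show "AE y in lborel. h x * indicator {- x..x} y \<le> h y"
    proof eventually_elim
      case (elim y)
      show ?case
      proof (cases "y \<in> {-x..x}")
        case True then show ?thesis
          using exp_kernel_antimono'[OF h a, of y x] elim x by (simp add: abs_le_iff)
      next
        case False then show ?thesis using h by (simp add: exp_kernel_def)
      qed
    qed
  qed fact
  also have "\<dots> = cos_transform h 0" by (simp add: cos_transform_def)
  also have "\<dots> = E 0" using h unfolding exp_kernel_def by blast
  finally show ?thesis using x by (simp add: field_simps)
qed

section \<open>Limits of exponential kernels\<close>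

definition tanhc_kernel_part :: "nat \<Rightarrow> real \<Rightarrow> real" where
  "tanhc_kernel_part n = exp_sum {..<n} (\<lambda>_. 2) pole"

text \<open>The inverse transform of \<open>tanhc\<close>. At 0 the series diverges like the
  harmonic series, hence the restrictions to \<open>x \<noteq> 0\<close> below.\<close>

definition tanhc_kernel :: "real \<Rightarrow> real" where
  "tanhc_kernel x = (\<Sum>k. 1 / pole k * exp (- pole k * \<bar>x\<bar>))"

definition tanhc_part :: "nat \<Rightarrow> real \<Rightarrow> real" where
  "tanhc_part n \<xi> = (\<Sum>k<n. 2 / (\<xi>\<^sup>2 + (pole k)\<^sup>2))"

lemma tanhc_kernel_part_altdef: "tanhc_kernel_part n x = (\<Sum>k<n. 1 / pole k * exp (- pole k * \<bar>x\<bar>))"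
  by (simp add: tanhc_kernel_part_def exp_sum_def)

lemma cos_transform_tanhc_kernel_part: "cos_transform (tanhc_kernel_part n) \<xi> = tanhc_part n \<xi>"
  unfolding tanhc_kernel_part_def tanhc_part_def by (rule cos_transform_exp_sum) (rule pole_pos)

lemma integrable_tanhc_kernel_part: "integrable lborel (tanhc_kernel_part n)"
  unfolding tanhc_kernel_part_def by (rule integrable_exp_sum) (rule pole_pos)

lemma summable_tanhc_kernel:
  assumes "x \<noteq> 0" shows "summable (\<lambda>k. 1 / pole k * exp (- pole k * \<bar>x\<bar>))"
proof (rule summable_comparison_test')
  show "summable (\<lambda>k. exp (- pi * \<bar>x\<bar>) ^ k)"
    using assms by (intro summable_geometric) auto
  fix k
  have "1 / pole k \<le> 1" using pole_ge[of k] pi_gt3 by (simp add: divide_simps) 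
  moreover have "exp (- pole k * \<bar>x\<bar>) \<le> exp (- pi * \<bar>x\<bar>) ^ k"
    by (simp add: pole_def algebra_simps flip: exp_of_nat_mult)
  ultimately have "1 / pole k * exp (- pole k * \<bar>x\<bar>) \<le> 1 * exp (- pi * \<bar>x\<bar>) ^ k"
    by (intro mult_mono) auto
  then show "norm (1 / pole k * exp (- pole k * \<bar>x\<bar>)) \<le> exp (- pi * \<bar>x\<bar>) ^ k"
    using pole_pos[of k] by simp
qed

lemma tanhc_kernel_part_tendsto: "x \<noteq> 0 \<Longrightarrow> (\<lambda>n. tanhc_kernel_part n x) \<longlonglongrightarrow> tanhc_kernel x"
  unfolding tanhc_kernel_part_altdef tanhc_kernel_def using summable_tanhc_kernel[THEN summable_LIMSEQ] .

lemma tanhc_kernel_part_nonneg: "0 \<le> tanhc_kernel_part n x"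
  unfolding tanhc_kernel_part_altdef using pole_pos by (intro sum_nonneg) (simp add: less_imp_le)

lemma tanhc_kernel_part_le: "x \<noteq> 0 \<Longrightarrow> tanhc_kernel_part n x \<le> tanhc_kernel x"
  unfolding tanhc_kernel_part_altdef tanhc_kernel_def using summable_tanhc_kernel pole_pos 
  by (intro sum_le_suminf) (auto simp: less_imp_le)

lemma integrable_tanhc_kernel: "integrable lborel tanhc_kernel"
  unfolding tanhc_kernel_def
proof (rule integrable_suminf)
  show "integrable lborel (\<lambda>x. 1 / pole k * exp (- pole k * \<bar>x\<bar>))" for k
    by (intro integrable_mult_right integrable_exp_abs pole_pos)
  show "AE x in lborel. summable (\<lambda>k. norm (1 / pole k * exp (- pole k * \<bar>x\<bar>)))"
    using AE_lborel_singleton[of "0::real"]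
    by eventually_elim (use summable_tanhc_kernel pole_pos in \<open>simp add: less_imp_le abs_of_pos\<close>)
  have "(\<integral>x. norm (1 / pole k * exp (- pole k * \<bar>x\<bar>)) \<partial>lborel) = 2 * (1 / (pole k)\<^sup>2)" for k
  proof -
    have "(\<integral>x. norm (1 / pole k * exp (- pole k * \<bar>x\<bar>)) \<partial>lborel) = 1 / pole k * (\<integral>x. exp (- pole k * \<bar>x\<bar>) \<partial>lborel)"
      using pole_pos[of k] by (subst integral_mult_right_zero[symmetric]) (simp add: abs_of_pos)
    also have "(\<integral>x. exp (- pole k * \<bar>x\<bar>) \<partial>lborel) = 2 * pole k / (pole k)\<^sup>2"
      using cos_transform_exp_abs[OF pole_pos[of k], of 0] by (simp add: cos_transform_def)
    finally show ?thesis using pole_pos[of k] by simp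
  qed
  then show "summable (\<lambda>k. \<integral>x. norm (1 / pole k * exp (- pole k * \<bar>x\<bar>)) \<partial>lborel)"
    using summable_mult[OF summable_inverse_pole_sq, of 2] by simp
qed

lemma tanhc_part_tendsto: "(\<lambda>n. tanhc_part n \<xi>) \<longlonglongrightarrow> tanhc \<xi>"
  using tanhc_sums[of \<xi>] unfolding tanhc_part_def sums_def .

lemma tanhc_part_le: "tanhc_part n \<xi> \<le> tanhc \<xi>"
  unfolding tanhc_part_def tanhc_def
  by (rule sum_le_suminf[OF summable_tanh_terms]) auto

lemma tanhc_part_nonneg: "0 \<le> tanhc_part n \<xi>"
  unfolding tanhc_part_def by (intro sum_nonneg) auto

lemma measurable_tanhc [measurable]: "tanhc \<in> borel_measurable borel"
  by (rule borel_measurable_continuous_onI[OF continuous_on_tanhc])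

lemma measurable_tanhc_part [measurable]: "tanhc_part n \<in> borel_measurable borel"
  unfolding tanhc_part_def by measurable

lemma measurable_tanhc_kernel [measurable]: "tanhc_kernel \<in> borel_measurable borel"
  using integrable_tanhc_kernel by auto

text \<open>The inverse transform of \<open>\<alpha> * tanhc \<xi> + L \<xi>\<close>. It may be
  unbounded near the origin; the value 0 there makes nonnegativity hold at every point.\<close>

definition limit_kernel :: "real \<Rightarrow> (real \<Rightarrow> real) \<Rightarrow> real \<Rightarrow> real" where
  "limit_kernel \<alpha> L x = (if x = 0 then 0 else \<alpha> * tanhc_kernel x + cos_transform L x / (2 * pi))"

lemma abs_cos_transform_le:
  assumes "integrable lborel L" "integrable lborel G" "\<And>\<xi>. \<bar>L \<xi>\<bar> \<le> G \<xi>"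
  shows "\<bar>cos_transform L x\<bar> \<le> (\<integral>\<xi>. G \<xi> \<partial>lborel)"
proof -
  have "\<bar>cos_transform L x\<bar> \<le> (\<integral>\<xi>. \<bar>L \<xi> * cos (x * \<xi>)\<bar> \<partial>lborel)"
    unfolding cos_transform_def using integral_norm_bound[of lborel "\<lambda>\<xi>. L \<xi> * cos (x * \<xi>)"] by simp
  also have "\<dots> \<le> (\<integral>\<xi>. G \<xi> \<partial>lborel)"
  proof (rule integral_mono)
    show "integrable lborel (\<lambda>\<xi>. \<bar>L \<xi> * cos (x * \<xi>)\<bar>)"
      using integrable_mult_cos[OF assms(1)] by simp
    fix \<xi>
    have "\<bar>L \<xi> * cos (x * \<xi>)\<bar> \<le> \<bar>L \<xi>\<bar>" by (simp add: abs_mult mult_left_le)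
    then show "\<bar>L \<xi> * cos (x * \<xi>)\<bar> \<le> G \<xi>" using assms(3)[of \<xi>] by linarith
  qed fact
  finally show ?thesis .
qed

text \<open>Transforms of the form \<open>\<alpha> tanhc + L\<close> with integrable \<open>L\<close>: the first summand is inverted
  termwise and the second by the inversion formula, so the kernels converge pointwise off the origin;
  monotonicity of exponential kernels supplies the integrable majorant.\<close>

lemma exp_kernel_limit:
  fixes h :: "nat \<Rightarrow> real \<Rightarrow> real"
  assumes h: "\<And>n. exp_kernel a (E n) (h n)" and a: "a > 0"
    and cont: "\<And>n. continuous_on UNIV (h n)" and bdd: "\<And>n. \<exists>B. \<forall>x. \<bar>h n x\<bar> \<le> B"
    and split: "\<And>n \<xi>. E n \<xi> = \<alpha> n * tanhc_part (Suc n) \<xi> + L n \<xi>"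
    and \<alpha>: "\<And>n. 0 \<le> \<alpha> n" "\<And>n. \<alpha> n \<le> A" "\<alpha> \<longlonglongrightarrow> \<alpha>'"
    and L: "\<And>n. L n \<in> borel_measurable borel" "\<And>n \<xi>. \<bar>L n \<xi>\<bar> \<le> G \<xi>" "integrable lborel G" 
      "\<And>\<xi>. (\<lambda>n. L n \<xi>) \<longlonglongrightarrow> L' \<xi>" 
  shows "exp_kernel a (\<lambda>\<xi>. \<alpha>' * tanhc \<xi> + L' \<xi>) (limit_kernel \<alpha>' L')"
proof -
  have [measurable]: "L n \<in> borel_measurable borel" for n by (rule L)
  have L'_meas [measurable]: "L' \<in> borel_measurable borel"
    by (rule borel_measurable_LIMSEQ_real[OF L(4)]) measurable
  have G0: "0 \<le> G \<xi>" for \<xi> using L(2)[of 0 \<xi>] by linarith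
  have L'G: "\<bar>L' \<xi>\<bar> \<le> G \<xi>" for \<xi>
    by (rule LIMSEQ_le_const2[OF tendsto_rabs[OF L(4)]]) (use L(2) in auto)
  have L_int: "integrable lborel (L n)" for n
    using L(2) G0 by (intro Bochner_Integration.integrable_bound[OF L(3)]) auto
  have h_int: "integrable lborel (h n)" and h_even: "h n (- x) = h n x" and h_nn: "0 \<le> h n x" for n x
    using h[of n] by (auto simp: exp_kernel_def)
  \<comment> \<open>Subtracting the truncated series leaves a bounded continuous function whose
    transform \<open>L n\<close> is integrable, so the inversion formula holds for it at every
    point.\<close>
  have h_eq: "h n x = \<alpha> n * tanhc_kernel_part (Suc n) x + cos_transform (L n) x / (2 * pi)" for n x
  proof -
    define g where "g = (\<lambda>x. h n x - \<alpha> n * tanhc_kernel_part (Suc n) x)"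
    have g_int: "integrable lborel g"
      unfolding g_def by (intro Bochner_Integration.integrable_diff integrable_mult_right integrable_tanhc_kernel_part h_int)
    have "cos_transform g \<xi> = L n \<xi>" for \<xi>
    proof -
      have "cos_transform g \<xi> = (\<integral>x. h n x * cos (\<xi> * x) - \<alpha> n * (tanhc_kernel_part (Suc n) x * cos (\<xi> * x)) \<partial>lborel)"
        by (simp add: cos_transform_def g_def algebra_simps)
      also have "\<dots> = cos_transform (h n) \<xi> - \<alpha> n * cos_transform (tanhc_kernel_part (Suc n)) \<xi>"
        unfolding cos_transform_def
        by (subst Bochner_Integration.integral_diff) (auto intro!: integrable_mult_right integrable_mult_cos h_int integrable_tanhc_kernel_part)
      also have "\<dots> = L n \<xi>"
        using h[of n] split[of n \<xi>] by (simp add: exp_kernel_def cos_transform_tanhc_kernel_part)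
      finally show ?thesis .
    qed
    then have tr: "cos_transform g = L n" by auto
    obtain B where B: "\<bar>h n x\<bar> \<le> B" for x using bdd by blast
    have "cos_transform (cos_transform g) x = 2 * pi * g x"
    proof (rule cos_transform_inversion)
      show "continuous_on UNIV g" unfolding g_def tanhc_kernel_part_def
        by (intro continuous_intros cont continuous_on_exp_sum)
      show "\<bar>g x\<bar> \<le> B + \<alpha> n * (\<Sum>k<Suc n. \<bar>2 / (2 * pole k)\<bar>)" for x
      proof -
        have "\<bar>g x\<bar> \<le> \<bar>h n x\<bar> + \<alpha> n * \<bar>tanhc_kernel_part (Suc n) x\<bar>"
          unfolding g_def using \<alpha>(1)[of n] by (rule_tac order_trans[OF abs_triangle_ineq4]) (simp add: abs_mult)
        also have "\<dots> \<le> B + \<alpha> n * (\<Sum>k<Suc n. \<bar>2 / (2 * pole k)\<bar>)"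
          unfolding tanhc_kernel_part_def using \<alpha>(1)[of n] by (intro add_mono B mult_left_mono exp_sum_bound pole_pos) auto
        finally show ?thesis .
      qed
      show "g (- x) = g x" for x by (simp add: g_def h_even tanhc_kernel_part_def)
    qed (use g_int L_int tr in auto)
    then have "cos_transform (L n) x = 2 * pi * (h n x - \<alpha> n * tanhc_kernel_part (Suc n) x)"
      by (simp only: tr) (simp add: g_def)
    then show ?thesis by (simp add: field_simps)
  qed
  have lim: "(\<lambda>n. h n x) \<longlonglongrightarrow> limit_kernel \<alpha>' L' x" if "x \<noteq> 0" for x
  proof -
    have "(\<lambda>n. cos_transform (L n) x) \<longlonglongrightarrow> cos_transform L' x"
      unfolding cos_transform_def
    proof (rule integral_dominated_convergence[where w = G])
      show "AE \<xi> in lborel. (\<lambda>n. L n \<xi> * cos (x * \<xi>)) \<longlonglongrightarrow> L' \<xi> * cos (x * \<xi>)"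
        by (intro always_eventually allI tendsto_intros L)
      show "AE \<xi> in lborel. norm (L n \<xi> * cos (x * \<xi>)) \<le> G \<xi>" for n
      proof (intro always_eventually allI)
        fix \<xi>
        have "\<bar>L n \<xi> * cos (x * \<xi>)\<bar> \<le> \<bar>L n \<xi>\<bar>" by (simp add: abs_mult mult_left_le)
        then show "norm (L n \<xi> * cos (x * \<xi>)) \<le> G \<xi>" using L(2)[of n \<xi>] by simp
      qed
    qed (use L in measurable)
    moreover have "(\<lambda>n. tanhc_kernel_part (Suc n) x) \<longlonglongrightarrow> tanhc_kernel x"
      using tanhc_kernel_part_tendsto[OF that] by (rule LIMSEQ_Suc)
    ultimately show ?thesis
      unfolding h_eq limit_kernel_def using that \<alpha>(3) by (auto intro!: tendsto_intros)
  qed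
  \<comment> \<open>The first summand bounds the inverse transform of \<open>L n\<close>, which is
    used for \<open>\<bar>x\<bar> \<le> 1\<close>; the second bounds \<open>h n 1\<close> through
    the mass \<open>E n 0\<close>, and from the point 1 on the exponential decay takes over.\<close>
  define C where "C = (\<integral>\<xi>. G \<xi> \<partial>lborel) / (2 * pi) + (A + G 0) / 2"
  have A0: "0 \<le> A" using \<alpha>(1,2)[of 0] by linarith
  have iG: "0 \<le> (\<integral>\<xi>. G \<xi> \<partial>lborel)" using G0 by simp
  have dom: "h n x \<le> A * tanhc_kernel x + C * exp a * exp (- a * \<bar>x\<bar>)" if "x \<noteq> 0" for n x
  proof (cases "\<bar>x\<bar> \<le> 1")
    case True
    have "h n x \<le> A * tanhc_kernel x + (\<integral>\<xi>. G \<xi> \<partial>lborel) / (2 * pi)"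
      unfolding h_eq using abs_cos_transform_le[OF L_int L(3) L(2), of n x]
      by (intro add_mono mult_mono \<alpha> tanhc_kernel_part_le that A0 tanhc_kernel_part_nonneg divide_right_mono) auto
    also have "(\<integral>\<xi>. G \<xi> \<partial>lborel) / (2 * pi) \<le> C * 1"
      unfolding C_def using A0 G0[of 0] by simp
    also have "\<dots> \<le> C * exp (a + - a * \<bar>x\<bar>)"
    proof (rule mult_left_mono)
      have "a * \<bar>x\<bar> \<le> a * 1" using True a by (intro mult_left_mono) auto
      then show "1 \<le> exp (a + - a * \<bar>x\<bar>)" by simp
      show "0 \<le> C" unfolding C_def using iG A0 G0[of 0] by simp
    qed
    finally show ?thesis by (simp add: mult.assoc flip: exp_add)
  next
    case False
    have "h n 1 \<le> E n 0 / 2" using exp_kernel_le[OF h, of 1 n] a by simp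
    also have "E n 0 \<le> A * 1 + G 0" unfolding split
    proof (rule add_mono)
      have "tanhc_part (Suc n) 0 \<le> 1" using tanhc_part_le[of "Suc n" 0] tanhc_le_1[of 0] by linarith
      then show "\<alpha> n * tanhc_part (Suc n) 0 \<le> A * 1" by (intro mult_mono \<alpha> A0 tanhc_part_nonneg)
      show "L n 0 \<le> G 0" using L(2)[of n 0] by linarith
    qed
    finally have "h n 1 \<le> (A + G 0) / 2" by simp
    moreover have "0 \<le> (\<integral>\<xi>. G \<xi> \<partial>lborel) / (2 * pi)" using iG by simp
    ultimately have "h n 1 \<le> C" unfolding C_def by linarith
    have "h n x \<le> exp (- a * (\<bar>x\<bar> - \<bar>1\<bar>)) * h n 1"
      using False a by (intro exp_kernel_antimono[OF h]) auto
    also have "\<dots> \<le> exp (- a * (\<bar>x\<bar> - \<bar>1\<bar>)) * C" using \<open>h n 1 \<le> C\<close> by (intro mult_left_mono) auto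
    also have "\<dots> = C * exp a * exp (- a * \<bar>x\<bar>)" by (simp add: algebra_simps flip: exp_add)
    also have "\<dots> \<le> A * tanhc_kernel x + C * exp a * exp (- a * \<bar>x\<bar>)"
      using A0 tanhc_kernel_part_le[OF that, of 0] tanhc_kernel_part_nonneg[of 0 x] by simp
    finally show ?thesis .
  qed
  define w where "w = (\<lambda>x. A * tanhc_kernel x + C * exp a * exp (- a * \<bar>x\<bar>))"
  have w_int: "integrable lborel w"
    unfolding w_def using a by (intro Bochner_Integration.integrable_add integrable_mult_right integrable_tanhc_kernel integrable_exp_abs)
  have [measurable]: "h n \<in> borel_measurable borel" for n using h_int[of n] by auto
  have lk_meas [measurable]: "limit_kernel \<alpha>' L' \<in> borel_measurable borel"
    unfolding limit_kernel_def cos_transform_def by measurable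
  have lim': "AE x in lborel. (\<lambda>n. h n x) \<longlonglongrightarrow> limit_kernel \<alpha>' L' x"
    using AE_lborel_singleton[of "0::real"] by eventually_elim (rule lim)
  have dom': "AE x in lborel. norm (h n x) \<le> w x" for n
    using AE_lborel_singleton[of "0::real"] by eventually_elim (use dom h_nn w_def in auto)
  show ?thesis
    unfolding exp_kernel_def
  proof (intro conjI allI impI)
    show "integrable lborel (limit_kernel \<alpha>' L')"
      by (rule integrable_dominated_convergence[OF _ _ w_int lim' dom']) measurable
    show "limit_kernel \<alpha>' L' (- x) = limit_kernel \<alpha>' L' x" for x
      by (simp add: limit_kernel_def tanhc_kernel_def cos_transform_def)
    show "0 \<le> limit_kernel \<alpha>' L' x" for x
      using LIMSEQ_le_const[OF lim, of x 0] h_nn by (cases "x = 0") (auto simp: limit_kernel_def)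
    show "limit_kernel \<alpha>' L' (x + d) \<le> exp (- a * d) * limit_kernel \<alpha>' L' x" if "x > 0" "d \<ge> 0" for x d
    proof (rule LIMSEQ_le[OF lim tendsto_mult_left[OF lim]])
      show "\<exists>N. \<forall>n\<ge>N. h n (x + d) \<le> exp (- a * d) * h n x"
        using h that unfolding exp_kernel_def by blast
    qed (use that in auto)
    show "2 * limit_kernel \<alpha>' L' ((x + y) / 2) \<le> s * limit_kernel \<alpha>' L' x + limit_kernel \<alpha>' L' y / s"
      if "x > 0" "y > 0" "s > 0" for x y s
    proof (rule LIMSEQ_le[OF tendsto_mult_left[OF lim] tendsto_add[OF tendsto_mult_left[OF lim] tendsto_divide[OF lim tendsto_const]]])
      show "\<exists>N. \<forall>n\<ge>N. 2 * h n ((x + y) / 2) \<le> s * h n x + h n y / s"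
        using h that unfolding exp_kernel_def by blast
    qed (use that in auto)
    fix \<xi>
    have "(\<lambda>n. cos_transform (h n) \<xi>) \<longlonglongrightarrow> cos_transform (limit_kernel \<alpha>' L') \<xi>"
      unfolding cos_transform_def
    proof (rule integral_dominated_convergence[OF _ _ w_int])
      show "AE x in lborel. (\<lambda>n. h n x * cos (\<xi> * x)) \<longlonglongrightarrow> limit_kernel \<alpha>' L' x * cos (\<xi> * x)"
        using lim' by eventually_elim (intro tendsto_intros)
      show "AE x in lborel. norm (h n x * cos (\<xi> * x)) \<le> w x" for n
        using dom'[of n]
      proof eventually_elim
        case (elim x)
        have "\<bar>h n x * cos (\<xi> * x)\<bar> \<le> \<bar>h n x\<bar>" by (simp add: abs_mult mult_left_le)
        then show ?case using elim by simp
      qed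
    qed measurable
    moreover have "(\<lambda>n. E n \<xi>) \<longlonglongrightarrow> \<alpha>' * tanhc \<xi> + L' \<xi>"
      unfolding split by (intro tendsto_intros \<alpha> L LIMSEQ_Suc tanhc_part_tendsto)
    moreover have "cos_transform (h n) \<xi> = E n \<xi>" for n using h[of n] by (simp add: exp_kernel_def)
    ultimately show "cos_transform (limit_kernel \<alpha>' L') \<xi> = \<alpha>' * tanhc \<xi> + L' \<xi>"
      using LIMSEQ_unique by auto
  qed
qed

section \<open>Kernels of S / (t + S) and of S / (c^2 - S) without its exceptional pole\<close>

lemma strict_mono_pole_sq: "strict_mono (\<lambda>k. (pole k)\<^sup>2)"
  using pole_strict_mono pole_pos unfolding strict_mono_def by (auto intro!: power_strict_mono simp: less_imp_le)

text \<open>In the variable \<open>\<xi>\<^sup>2\<close> a pole at \<open>- q\<close> is a pair of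
  imaginary poles at distance \<open>sqrt q\<close> from 0; the bound of \<open>q\<close> from below
  by \<open>(pole 0)\<^sup>2\<close> thus becomes the decay rate \<open>pi / 2\<close>.\<close>

lemma exp_kernel_stieltjes:
  assumes Q: "\<And>q. q \<in> Q \<Longrightarrow> (pole 0)\<^sup>2 < q \<and> 0 < b q"
    and E: "\<And>\<xi>. E \<xi> = (\<Sum>q\<in>Q. b q / (\<xi>\<^sup>2 + q))"
  shows "\<exists>h. exp_kernel (pi / 2) E h \<and> continuous_on UNIV h \<and> (\<exists>B. \<forall>x. \<bar>h x\<bar> \<le> B)"
proof (intro exI conjI allI)
  have y: "pi / 2 \<le> sqrt q" if "q \<in> Q" for q
    using Q[OF that] by (intro real_le_rsqrt) (simp add: pole_0)
  have y': "0 < sqrt q" "(sqrt q)\<^sup>2 = q" if "q \<in> Q" for q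
  proof -
    have "0 < q" using Q[OF that] zero_le_power2[of "pole 0"] by linarith
    then show "0 < sqrt q" "(sqrt q)\<^sup>2 = q" by auto
  qed
  have "E = (\<lambda>\<xi>. \<Sum>q\<in>Q. b q / (\<xi>\<^sup>2 + (sqrt q)\<^sup>2))"
    unfolding E by (intro ext sum.cong) (auto simp: y')
  then show "exp_kernel (pi / 2) E (exp_sum Q b sqrt)"
    using exp_kernel_exp_sum[of Q "pi / 2" sqrt b] y Q by simp
  show "continuous_on UNIV (exp_sum Q b sqrt)" by (rule continuous_on_exp_sum)
  show "\<bar>exp_sum Q b sqrt x\<bar> \<le> (\<Sum>q\<in>Q. \<bar>b q / (2 * sqrt q)\<bar>)" for x
    by (rule exp_sum_bound) (rule y')
qed

lemma integrable_tanhc_sq: "integrable lborel (\<lambda>\<xi>. (tanhc \<xi>)\<^sup>2)"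
proof (rule Bochner_Integration.integrable_bound)
  show "integrable lborel (\<lambda>\<xi>. 2 * (1 / (\<xi>\<^sup>2 + 1)) :: real)"
    by (intro integrable_mult_right integrable_lorentz) simp
  show "AE x in lborel. norm ((tanhc x)\<^sup>2) \<le> norm (2 * (1 / (x\<^sup>2 + 1)))"
    using tanhc_sq_le by (intro always_eventually allI) (simp add: add.commute)
qed measurable

text \<open>With \<open>S = tanhc \<xi>\<close>, this rests on
  \<open>S / (t + S) = S / t - S\<^sup>2 / (t * (t + S))\<close>, whose subtracted part is
  integrable.\<close>

definition resolvent_kernel :: "real \<Rightarrow> real \<Rightarrow> real" where
  "resolvent_kernel t = limit_kernel (1 / t) (\<lambda>\<xi>. - ((tanhc \<xi>)\<^sup>2 / (t * (t + tanhc \<xi>))))"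

lemma exp_kernel_resolvent:
  assumes t: "t > 0"
  shows "exp_kernel (pi / 2) (\<lambda>\<xi>. tanhc \<xi> / (t + tanhc \<xi>)) (resolvent_kernel t)"
proof -
  let ?E = "\<lambda>n \<xi>. tanhc_part (Suc n) \<xi> / (t + tanhc_part (Suc n) \<xi>)"
  have "\<exists>h. exp_kernel (pi / 2) (?E n) h \<and> continuous_on UNIV h \<and> (\<exists>B. \<forall>x. \<bar>h x\<bar> \<le> B)" for n
  proof -
    obtain Q and b :: "real \<Rightarrow> real" where Q: "\<forall>q\<in>Q. (pole 0)\<^sup>2 < q \<and> 0 < b q"
      "\<forall>z\<ge>0. (\<Sum>k<Suc n. 2 / (z + (pole k)\<^sup>2)) / (t + (\<Sum>k<Suc n. 2 / (z + (pole k)\<^sup>2))) = (\<Sum>q\<in>Q. b q / (z + q))"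
      using stieltjes_div_add[OF strict_mono_pole_sq _ _ t, of "\<lambda>_. 2" n] pole_pos[of 0] by auto
    show ?thesis
      using Q by (intro exp_kernel_stieltjes[of Q b]) (simp_all only: tanhc_part_def zero_le_power2)
  qed
  then obtain h where h: "\<And>n. exp_kernel (pi / 2) (?E n) (h n)" "\<And>n. continuous_on UNIV (h n)" 
    "\<And>n. \<exists>B. \<forall>x. \<bar>h n x\<bar> \<le> B" by metis
  have nn: "0 < t + tanhc_part n \<xi>" "0 < t + tanhc \<xi>" for n \<xi>
    using t tanhc_part_nonneg[of n \<xi>] tanhc_pos[of \<xi>] by auto
  have "exp_kernel (pi / 2) (\<lambda>\<xi>. 1 / t * tanhc \<xi> + - ((tanhc \<xi>)\<^sup>2 / (t * (t + tanhc \<xi>)))) (resolvent_kernel t)"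
    unfolding resolvent_kernel_def
  proof (rule exp_kernel_limit[OF h(1)])
    let ?L = "\<lambda>n \<xi>. - ((tanhc_part (Suc n) \<xi>)\<^sup>2 / (t * (t + tanhc_part (Suc n) \<xi>)))"
    show "?E n \<xi> = 1 / t * tanhc_part (Suc n) \<xi> + ?L n \<xi>" for n \<xi>
      using t nn(1)[of "Suc n" \<xi>] by (simp add: divide_simps) (simp add: algebra_simps power2_eq_square)
    show "?L n \<in> borel_measurable borel" for n by measurable
    show "integrable lborel (\<lambda>\<xi>. (tanhc \<xi>)\<^sup>2 / (t * t))" using integrable_tanhc_sq by simp
    show "\<bar>?L n \<xi>\<bar> \<le> (tanhc \<xi>)\<^sup>2 / (t * t)" for n \<xi>
      using t nn(1)[of "Suc n" \<xi>] tanhc_part_le[of "Suc n" \<xi>] tanhc_part_nonneg[of "Suc n" \<xi>]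
      by (simp add: abs_mult) (intro frac_le power_mono mult_left_mono mult_pos_pos; simp)
    show "(\<lambda>n. ?L n \<xi>) \<longlonglongrightarrow> - ((tanhc \<xi>)\<^sup>2 / (t * (t + tanhc \<xi>)))" for \<xi>
      using t nn(2)[of \<xi>] by (intro tendsto_intros LIMSEQ_Suc tanhc_part_tendsto) auto
  qed (use t h in auto)
  moreover have "1 / t * tanhc \<xi> + - ((tanhc \<xi>)\<^sup>2 / (t * (t + tanhc \<xi>))) = tanhc \<xi> / (t + tanhc \<xi>)" for \<xi>
    using t nn(2)[of \<xi>] by (simp add: divide_simps) (simp add: algebra_simps power2_eq_square)
  ultimately show ?thesis by simp
qed

text \<open>The residue of \<open>S / (\<kappa> - S)\<close>, where
  \<open>\<kappa> = tan \<delta> / \<delta>\<close>, in the variable \<open>\<xi>\<^sup>2\<close> at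
  the point \<open>- \<delta>\<^sup>2\<close>: the numerator is the value of \<open>S\<close> at
  this pole, the denominator the sum from \<open>tan_deriv_partial_fractions\<close>.\<close>

definition residue_coeff :: "real \<Rightarrow> real" where
  "residue_coeff \<delta> = (tan \<delta> / \<delta>) / ((\<delta> * (1 / cos \<delta>)\<^sup>2 - tan \<delta>) / (2 * \<delta> ^ 3))"

text \<open>From \<open>S / (\<kappa> - S) = S / \<kappa> + S\<^sup>2 / (\<kappa> * (\<kappa> -
  S))\<close>, with the one pole removed whose kernel decays more slowly than at the rate
  \<open>pi / 2\<close>.\<close>

definition remainder_kernel :: "real \<Rightarrow> real \<Rightarrow> real" where
  "remainder_kernel \<delta> = limit_kernel (1 / (tan \<delta> / \<delta>))
     (\<lambda>\<xi>. (tanhc \<xi>)\<^sup>2 / (tan \<delta> / \<delta> * (tan \<delta> / \<delta> - tanhc \<xi>)) - residue_coeff \<delta> / (\<xi>\<^sup>2 + \<delta>\<^sup>2))"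

text \<open>The two partial fraction series compare term by term, as
  \<open>- \<delta>\<^sup>2 < \<xi>\<^sup>2\<close>. This keeps the denominator of the symbol
  positive on the real line.\<close>

lemma tan_div_gt_tanhc:
  assumes \<delta>: "0 < \<delta>" "\<delta> < pi / 2"
  shows "tanhc \<xi> < tan \<delta> / \<delta>"
proof -
  have p: "\<delta>\<^sup>2 < (pole k)\<^sup>2" for k using pole_sq_gt[of \<delta>] \<delta> by simp
  have le: "2 / (\<xi>\<^sup>2 + (pole k)\<^sup>2) < 2 / ((pole k)\<^sup>2 - \<delta>\<^sup>2)" for k
  proof (rule divide_strict_left_mono)
    have "0 < \<delta>\<^sup>2" using \<delta> by simp
    then show "(pole k)\<^sup>2 - \<delta>\<^sup>2 < \<xi>\<^sup>2 + (pole k)\<^sup>2" using zero_le_power2[of \<xi>] by linarith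
    show "0 < (\<xi>\<^sup>2 + (pole k)\<^sup>2) * ((pole k)\<^sup>2 - \<delta>\<^sup>2)"
      using p[of k] pole_pos[of k] by (intro mult_pos_pos add_nonneg_pos) auto
  qed simp
  have sm: "summable (\<lambda>k. 2 / ((pole k)\<^sup>2 - \<delta>\<^sup>2))"
    using tan_partial_fractions[OF \<delta>] by (rule sums_summable)
  have "0 < (\<Sum>k. 2 / ((pole k)\<^sup>2 - \<delta>\<^sup>2) - 2 / (\<xi>\<^sup>2 + (pole k)\<^sup>2))"
    using le by (intro suminf_pos summable_diff sm summable_tanh_terms) simp
  then have "(\<Sum>k. 2 / (\<xi>\<^sup>2 + (pole k)\<^sup>2)) < (\<Sum>k. 2 / ((pole k)\<^sup>2 - \<delta>\<^sup>2))"
    by (simp only: suminf_diff[OF sm summable_tanh_terms, symmetric] diff_gt_0_iff_gt)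
  then show ?thesis
    using tan_partial_fractions[OF \<delta>] by (simp add: tanhc_def sums_iff)
qed

lemma exp_kernel_remainder:
  assumes \<delta>: "0 < \<delta>" "\<delta> < pi / 2"
  shows "exp_kernel (pi / 2) (\<lambda>\<xi>. tanhc \<xi> / (tan \<delta> / \<delta> - tanhc \<xi>) - residue_coeff \<delta> / (\<xi>\<^sup>2 + \<delta>\<^sup>2)) (remainder_kernel \<delta>)"
    and remainder_symbol_nonneg: "0 \<le> tanhc \<xi> / (tan \<delta> / \<delta> - tanhc \<xi>) - residue_coeff \<delta> / (\<xi>\<^sup>2 + \<delta>\<^sup>2)"
    and residue_coeff_pos: "0 < residue_coeff \<delta>"
proof -
  \<comment> \<open>These values of the truncated sums at \<open>- \<delta>\<^sup>2\<close> give
    every truncation its exceptional pole exactly at \<open>\<delta>\<close>; they reach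
    \<open>tan \<delta> / \<delta>\<close> only in the limit.\<close>
  define \<kappa> where "\<kappa> = (\<lambda>n. \<Sum>k<Suc n. 2 / ((pole k)\<^sup>2 - \<delta>\<^sup>2))"
  define D where "D = (\<lambda>n. \<Sum>k<Suc n. 2 / ((pole k)\<^sup>2 - \<delta>\<^sup>2)\<^sup>2)"
  define \<kappa>' where "\<kappa>' = tan \<delta> / \<delta>"
  define D' where "D' = (\<delta> * (1 / cos \<delta>)\<^sup>2 - tan \<delta>) / (2 * \<delta> ^ 3)"
  have B: "residue_coeff \<delta> = \<kappa>' / D'" by (simp add: residue_coeff_def \<kappa>'_def D'_def)
  have p: "\<delta>\<^sup>2 < (pole k)\<^sup>2" for k using pole_sq_gt[of \<delta>] \<delta> by simp
  have \<kappa>_lim: "\<kappa> \<longlonglongrightarrow> \<kappa>'" 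
    using tan_partial_fractions[OF \<delta>] unfolding \<kappa>_def \<kappa>'_def sums_def by (rule LIMSEQ_Suc)
  have D_lim: "D \<longlonglongrightarrow> D'" 
    using tan_deriv_partial_fractions[OF \<delta>] unfolding D_def D'_def sums_def by (rule LIMSEQ_Suc)
  have "incseq \<kappa>" unfolding \<kappa>_def using p by (intro incseq_SucI) (simp add: less_imp_le)
  have "incseq D" unfolding D_def by (intro incseq_SucI) simp
  have \<kappa>_bnd: "\<kappa> 0 \<le> \<kappa> n" "\<kappa> n \<le> \<kappa>'" for n
    using \<open>incseq \<kappa>\<close> incseq_le[OF \<open>incseq \<kappa>\<close> \<kappa>_lim] by (auto simp: incseq_def)
  have D_bnd: "D 0 \<le> D n" "D n \<le> D'" for n
    using \<open>incseq D\<close> incseq_le[OF \<open>incseq D\<close> D_lim] by (auto simp: incseq_def)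
  have pos0: "0 < \<kappa> 0" "0 < D 0" using p[of 0] by (auto simp: \<kappa>_def D_def)
  have \<kappa>D_pos: "0 < \<kappa> n" "0 < D n" "0 < \<kappa>'" "0 < D'" for n
    using pos0 \<kappa>_bnd[of n] D_bnd[of n] by linarith+
  show "0 < residue_coeff \<delta>" using \<kappa>D_pos by (simp add: B)
  \<comment> \<open>The gap that the term \<open>k = 0\<close> alone produces at
    \<open>\<xi> = 0\<close>. It bounds all denominators from below, uniformly in \<open>n\<close>
    and \<open>\<xi>\<close>.\<close>
  define e where "e = 2 / ((pole 0)\<^sup>2 - \<delta>\<^sup>2) - 2 / (pole 0)\<^sup>2"
  have e_pos: "e > 0"
    unfolding e_def using p[of 0] \<delta> pole_pos[of 0] by (simp add: divide_strict_left_mono)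
  have e_le: "e \<le> \<kappa> n - tanhc_part (Suc n) \<xi>" for n \<xi>
  proof -
    have "2 / (\<xi>\<^sup>2 + (pole k)\<^sup>2) \<le> 2 / (pole k)\<^sup>2" for k
      using pole_pos[of k] by (intro frac_le) auto
    moreover have "2 / (pole k)\<^sup>2 \<le> 2 / ((pole k)\<^sup>2 - \<delta>\<^sup>2)" for k
      using p[of k] by (intro frac_le) auto
    ultimately have t: "2 / (\<xi>\<^sup>2 + (pole 0)\<^sup>2) \<le> 2 / (pole 0)\<^sup>2" "2 / (\<xi>\<^sup>2 + (pole k)\<^sup>2) \<le> 2 / ((pole k)\<^sup>2 - \<delta>\<^sup>2)" for k
      by (auto intro: order_trans)
    have "e \<le> 2 / ((pole 0)\<^sup>2 - \<delta>\<^sup>2) - 2 / (\<xi>\<^sup>2 + (pole 0)\<^sup>2)"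
      using t(1) by (simp add: e_def)
    also have "\<dots> \<le> (\<Sum>k<Suc n. 2 / ((pole k)\<^sup>2 - \<delta>\<^sup>2) - 2 / (\<xi>\<^sup>2 + (pole k)\<^sup>2))"
      using t(2) by (intro member_le_sum[of 0 _ "\<lambda>k. 2 / ((pole k)\<^sup>2 - \<delta>\<^sup>2) - 2 / (\<xi>\<^sup>2 + (pole k)\<^sup>2)"]) auto
    finally show ?thesis by (simp only: \<kappa>_def tanhc_part_def sum_subtractf)
  qed
  have nn: "0 < \<kappa> n - tanhc_part (Suc n) \<xi>" for n \<xi> using e_le[of n \<xi>] e_pos by linarith
  have nn': "0 < \<kappa>' - tanhc \<xi>" for \<xi> using tan_div_gt_tanhc[OF \<delta>, of \<xi>] by (simp add: \<kappa>'_def)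
  let ?E = "\<lambda>n \<xi>. tanhc_part (Suc n) \<xi> / (\<kappa> n - tanhc_part (Suc n) \<xi>) - \<kappa> n / D n / (\<xi>\<^sup>2 + \<delta>\<^sup>2)"
  have "\<exists>h. (exp_kernel (pi / 2) (?E n) h \<and> continuous_on UNIV h \<and> (\<exists>B. \<forall>x. \<bar>h x\<bar> \<le> B)) \<and> (\<forall>\<xi>. 0 \<le> ?E n \<xi>)" for n
  proof -
    have d: "0 < \<delta>\<^sup>2" "\<delta>\<^sup>2 < (pole 0)\<^sup>2" "0 < (pole 0)\<^sup>2" using \<delta> p[of 0] pole_pos[of 0] by auto
    have \<kappa>': "(\<Sum>k<Suc n. 2 / (- \<delta>\<^sup>2 + (pole k)\<^sup>2)) = \<kappa> n" unfolding \<kappa>_def by simp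
    obtain Q and b :: "real \<Rightarrow> real" where Q: "\<forall>q\<in>Q. (pole 0)\<^sup>2 < q \<and> 0 < b q"
      "\<forall>z\<ge>0. (\<Sum>k<Suc n. 2 / (z + (pole k)\<^sup>2)) / (\<kappa> n - (\<Sum>k<Suc n. 2 / (z + (pole k)\<^sup>2)))
         = \<kappa> n / D n / (z + \<delta>\<^sup>2) + (\<Sum>q\<in>Q. b q / (z + q))"
      using stieltjes_div_diff[OF strict_mono_pole_sq d(3) _ d(1,2), of "\<lambda>_. 2" n] unfolding \<kappa>' D_def by auto
    have E: "?E n \<xi> = (\<Sum>q\<in>Q. b q / (\<xi>\<^sup>2 + q))" for \<xi>
      using Q(2)[rule_format, of "\<xi>\<^sup>2"] by (simp only: tanhc_part_def zero_le_power2)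
    have "0 \<le> ?E n \<xi>" for \<xi>
      unfolding E
    proof (intro sum_nonneg divide_nonneg_nonneg add_nonneg_nonneg)
      fix q assume "q \<in> Q"
      then have "(pole 0)\<^sup>2 < q" "0 < b q" using Q(1) by auto
      then show "0 \<le> b q" "0 \<le> q" using d(3) by linarith+
    qed simp
    then show ?thesis
      using exp_kernel_stieltjes[of Q b "?E n"] Q(1) E by blast
  qed
  then have "\<forall>n. \<exists>h. (exp_kernel (pi / 2) (?E n) h \<and> continuous_on UNIV h \<and> (\<exists>B. \<forall>x. \<bar>h x\<bar> \<le> B)) \<and> (\<forall>\<xi>. 0 \<le> ?E n \<xi>)"
    by (rule allI)
  from choice[OF this] obtain h where hh: "\<forall>n. (exp_kernel (pi / 2) (?E n) (h n) \<and> continuous_on UNIV (h n)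
      \<and> (\<exists>B. \<forall>x. \<bar>h n x\<bar> \<le> B)) \<and> (\<forall>\<xi>. 0 \<le> ?E n \<xi>)" ..
  have h: "exp_kernel (pi / 2) (?E n) (h n)" "continuous_on UNIV (h n)" "\<exists>B. \<forall>x. \<bar>h n x\<bar> \<le> B"
    and E_nn: "0 \<le> ?E n \<xi>" for n \<xi>
    by (rule hh[THEN spec, THEN conjunct1, THEN conjunct1] hh[THEN spec, THEN conjunct1, THEN conjunct2, THEN conjunct1]
      hh[THEN spec, THEN conjunct1, THEN conjunct2, THEN conjunct2] hh[THEN spec, THEN conjunct2, THEN spec])+
  let ?L' = "\<lambda>\<xi>. (tanhc \<xi>)\<^sup>2 / (\<kappa>' * (\<kappa>' - tanhc \<xi>)) - \<kappa>' / D' / (\<xi>\<^sup>2 + \<delta>\<^sup>2)"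
  have \<delta>2: "0 < \<xi>\<^sup>2 + \<delta>\<^sup>2" for \<xi> using \<delta> by (simp add: add_nonneg_pos)
  have "exp_kernel (pi / 2) (\<lambda>\<xi>. 1 / \<kappa>' * tanhc \<xi> + ?L' \<xi>) (remainder_kernel \<delta>)"
    unfolding remainder_kernel_def B \<kappa>'_def[symmetric]
  proof (rule exp_kernel_limit[OF h(1)])
    let ?L = "\<lambda>n \<xi>. (tanhc_part (Suc n) \<xi>)\<^sup>2 / (\<kappa> n * (\<kappa> n - tanhc_part (Suc n) \<xi>)) - \<kappa> n / D n / (\<xi>\<^sup>2 + \<delta>\<^sup>2)"
    let ?G = "\<lambda>\<xi>. (tanhc \<xi>)\<^sup>2 / (\<kappa> 0 * e) + \<kappa>' / D 0 * (1 / (\<xi>\<^sup>2 + \<delta>\<^sup>2))"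
    show "?E n \<xi> = 1 / \<kappa> n * tanhc_part (Suc n) \<xi> + ?L n \<xi>" for n \<xi>
    proof -
      have "s / (k - s) = 1 / k * s + s\<^sup>2 / (k * (k - s))" if "0 < k" "0 < k - s" for k s :: real
        using that by (simp add: divide_simps) (simp add: algebra_simps power2_eq_square)
      from this[OF \<kappa>D_pos(1)[of n] nn[of n \<xi>]] show ?thesis by simp
    qed
    show "?L n \<in> borel_measurable borel" for n by measurable
    show "integrable lborel ?G" 
      using integrable_tanhc_sq integrable_lorentz[of "\<delta>\<^sup>2"] \<delta> 
      by (intro Bochner_Integration.integrable_add integrable_mult_right) auto
    show "\<bar>?L n \<xi>\<bar> \<le> ?G \<xi>" for n \<xi>
    proof -
      have "(tanhc_part (Suc n) \<xi>)\<^sup>2 / (\<kappa> n * (\<kappa> n - tanhc_part (Suc n) \<xi>)) \<le> (tanhc \<xi>)\<^sup>2 / (\<kappa> 0 * e)"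
        using tanhc_part_le tanhc_part_nonneg \<kappa>_bnd pos0 e_pos e_le \<kappa>D_pos(1)[of n]
        by (intro frac_le power_mono mult_mono mult_pos_pos) (auto simp: less_imp_le)
      moreover have "\<kappa> n / D n / (\<xi>\<^sup>2 + \<delta>\<^sup>2) \<le> \<kappa>' / D 0 * (1 / (\<xi>\<^sup>2 + \<delta>\<^sup>2))"
        using \<kappa>_bnd D_bnd pos0 \<kappa>D_pos \<delta>2[of \<xi>]
        by (simp, intro divide_right_mono frac_le) (auto simp: less_imp_le)
      moreover have "0 \<le> (tanhc_part (Suc n) \<xi>)\<^sup>2 / (\<kappa> n * (\<kappa> n - tanhc_part (Suc n) \<xi>))"
        using \<kappa>D_pos(1)[of n] nn[of n \<xi>] by (intro divide_nonneg_pos mult_pos_pos) auto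
      moreover have "0 \<le> \<kappa> n / D n / (\<xi>\<^sup>2 + \<delta>\<^sup>2)"
        using \<kappa>D_pos(1,2)[of n] \<delta>2[of \<xi>] by (intro divide_nonneg_pos) auto
      ultimately show ?thesis by (simp only: abs_le_iff) linarith
    qed
    show "(\<lambda>n. ?L n \<xi>) \<longlonglongrightarrow> ?L' \<xi>" for \<xi>
      using nn'[of \<xi>] \<kappa>D_pos \<delta>2[of \<xi>] by (intro tendsto_intros LIMSEQ_Suc[OF tanhc_part_tendsto] \<kappa>_lim D_lim) auto
    show "(\<lambda>n. 1 / \<kappa> n) \<longlonglongrightarrow> 1 / \<kappa>'" using \<kappa>D_pos(3) by (intro tendsto_intros \<kappa>_lim) auto
    show "1 / \<kappa> n \<le> 1 / \<kappa> 0" for n using \<kappa>_bnd pos0 by (intro frac_le) auto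
    show "0 \<le> 1 / \<kappa> n" for n using \<kappa>D_pos(1)[of n] by simp
  qed (use h in auto)
  moreover have "1 / \<kappa>' * tanhc \<xi> + ?L' \<xi> = tanhc \<xi> / (\<kappa>' - tanhc \<xi>) - \<kappa>' / D' / (\<xi>\<^sup>2 + \<delta>\<^sup>2)" for \<xi>
  proof -
    have "s / (k - s) = 1 / k * s + s\<^sup>2 / (k * (k - s))" if "0 < k" "0 < k - s" for k s :: real
      using that by (simp add: divide_simps) (simp add: algebra_simps power2_eq_square)
    from this[OF \<kappa>D_pos(3) nn'[of \<xi>]] show ?thesis by simp
  qed
  ultimately show "exp_kernel (pi / 2) (\<lambda>\<xi>. tanhc \<xi> / (tan \<delta> / \<delta> - tanhc \<xi>) - residue_coeff \<delta> / (\<xi>\<^sup>2 + \<delta>\<^sup>2)) (remainder_kernel \<delta>)"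
    by (simp only: B \<kappa>'_def[symmetric])
  have "(\<lambda>n. ?E n \<xi>) \<longlonglongrightarrow> tanhc \<xi> / (\<kappa>' - tanhc \<xi>) - \<kappa>' / D' / (\<xi>\<^sup>2 + \<delta>\<^sup>2)"
    using nn'[of \<xi>] \<kappa>D_pos \<delta>2[of \<xi>] by (intro tendsto_intros LIMSEQ_Suc[OF tanhc_part_tendsto] \<kappa>_lim D_lim) auto
  then have "0 \<le> tanhc \<xi> / (\<kappa>' - tanhc \<xi>) - \<kappa>' / D' / (\<xi>\<^sup>2 + \<delta>\<^sup>2)"
    by (rule LIMSEQ_le_const) (use E_nn in auto)
  then show "0 \<le> tanhc \<xi> / (tan \<delta> / \<delta> - tanhc \<xi>) - residue_coeff \<delta> / (\<xi>\<^sup>2 + \<delta>\<^sup>2)"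
    by (simp only: B \<kappa>'_def[symmetric])
qed

section \<open>The kernel of m / (c + m) as a mixture\<close>

lemma tanhc_0 [simp]: "tanhc 0 = 1"
  by (simp add: tanhc_eq)

text \<open>At \<open>t = 0\<close> all divisions by 0 return 0. With this default, nonnegativity
  and the pointwise bounds hold for every parameter \<open>r\<close>; the transform identity fails
  for \<open>r = 0\<close> alone, a null set.\<close>

lemma resolvent_kernel_0 [simp]: "resolvent_kernel 0 x = 0"
  by (simp add: resolvent_kernel_def limit_kernel_def cos_transform_def)

lemma measurable_resolvent_kernel [measurable]:
  "(\<lambda>(r, x). resolvent_kernel (r\<^sup>2) x) \<in> borel_measurable (borel \<Otimes>\<^sub>M borel)"
  unfolding resolvent_kernel_def limit_kernel_def cos_transform_def by measurable

lemma resolvent_kernel_nonneg: "0 \<le> resolvent_kernel (r\<^sup>2) x"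
  using exp_kernel_resolvent[of "r\<^sup>2"] by (cases "r = 0") (auto simp: exp_kernel_def)

text \<open>The kernel has mass \<open>1 / (r\<^sup>2 + 1)\<close>, which is at most 1, so the bound
  is uniform in \<open>r\<close> and the mixture below converges.\<close>

lemma resolvent_kernel_bound: "resolvent_kernel (r\<^sup>2) x \<le> 1 / (2 * \<bar>x\<bar>)"
proof (cases "r = 0 \<or> x = 0")
  case True then show ?thesis by (auto simp: resolvent_kernel_def limit_kernel_def cos_transform_def)
next
  case False
  note k = exp_kernel_resolvent[of "r\<^sup>2"]
  have "resolvent_kernel (r\<^sup>2) x = resolvent_kernel (r\<^sup>2) \<bar>x\<bar>"
    using k False by (simp add: exp_kernel_def abs_if)
  also have "\<dots> \<le> (tanhc 0 / (r\<^sup>2 + tanhc 0)) / (2 * \<bar>x\<bar>)"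
    using k False by (intro exp_kernel_le[OF k]) auto
  also have "\<dots> \<le> 1 / (2 * \<bar>x\<bar>)"
    by (intro divide_right_mono) (auto simp: divide_le_eq add_nonneg_pos)
  finally show ?thesis .
qed

text \<open>The weight is the Cauchy density of scale \<open>c\<close>. With
  \<open>t = r\<^sup>2\<close> parametrized by \<open>r\<close>, only Lorentz integrals in
  \<open>r\<close> arise, and their values contain the square root.\<close>

definition branch_kernel :: "real \<Rightarrow> real \<Rightarrow> real" where
  "branch_kernel c x = (\<integral>r. c / pi * (1 / (r\<^sup>2 + c\<^sup>2)) * resolvent_kernel (r\<^sup>2) x \<partial>lborel)"

text \<open>A mixture with nonnegative weights inherits every linear condition in
  \<open>exp_kernel\<close>. Each component has mass at most its weight, which makes the kernel
  jointly integrable and justifies Fubini.\<close>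

lemma exp_kernel_branch:
  assumes c: "c > 1"
  shows "exp_kernel (pi / 2) (\<lambda>\<xi>. sqrt (tanhc \<xi>) / (c + sqrt (tanhc \<xi>))) (branch_kernel c)"
proof -
  define R where "R = (\<lambda>r x. c / pi * (1 / (r\<^sup>2 + c\<^sup>2)) * resolvent_kernel (r\<^sup>2) x)"
  have R_meas [measurable]: "(\<lambda>(r, x). R r x) \<in> borel_measurable (borel \<Otimes>\<^sub>M borel)"
    unfolding R_def using measurable_resolvent_kernel by measurable
  have c2: "0 < r\<^sup>2 + c\<^sup>2" for r using c by (simp add: add_nonneg_pos)
  have R_nn: "0 \<le> R r x" for r x
    unfolding R_def using c c2[of r] by (intro mult_nonneg_nonneg resolvent_kernel_nonneg) auto
  have w_int: "integrable lborel (\<lambda>r. c / pi * (1 / (r\<^sup>2 + c\<^sup>2)) * B)" for B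
    using c by (intro integrable_mult_left integrable_mult_right integrable_lorentz) auto
  have R_int: "integrable lborel (\<lambda>r. R r x)" for x
  proof (rule Bochner_Integration.integrable_bound[OF w_int[of "1 / (2 * \<bar>x\<bar>)"]])
    show "AE r in lborel. norm (R r x) \<le> norm (c / pi * (1 / (r\<^sup>2 + c\<^sup>2)) * (1 / (2 * \<bar>x\<bar>)))"
    proof (intro always_eventually allI)
      fix r
      have "R r x \<le> c / pi * (1 / (r\<^sup>2 + c\<^sup>2)) * (1 / (2 * \<bar>x\<bar>))"
        unfolding R_def using c c2[of r] by (intro mult_left_mono resolvent_kernel_bound) auto
      then show "norm (R r x) \<le> norm (c / pi * (1 / (r\<^sup>2 + c\<^sup>2)) * (1 / (2 * \<bar>x\<bar>)))"
        using R_nn[of r x] c by simp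
    qed
  qed measurable
  have R_x: "exp_kernel (pi / 2) (\<lambda>\<xi>. c / pi * (1 / (r\<^sup>2 + c\<^sup>2)) * (tanhc \<xi> / (r\<^sup>2 + tanhc \<xi>))) (R r)" if "r \<noteq> 0" for r
    unfolding exp_kernel_def
  proof (intro conjI allI impI)
    have k: "exp_kernel (pi / 2) (\<lambda>\<xi>. tanhc \<xi> / (r\<^sup>2 + tanhc \<xi>)) (resolvent_kernel (r\<^sup>2))"
      using exp_kernel_resolvent[of "r\<^sup>2"] that by simp
    define q where "q = c / pi * (1 / (r\<^sup>2 + c\<^sup>2))"
    have q: "q \<ge> 0" unfolding q_def using c c2[of r] by simp
    have R: "R r x = q * resolvent_kernel (r\<^sup>2) x" for x by (simp add: R_def q_def)
    show "integrable lborel (R r)" unfolding R using k by (intro integrable_mult_right) (simp add: exp_kernel_def)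
    show "R r (- x) = R r x" for x unfolding R using k by (simp add: exp_kernel_def)
    show "R r (x + d) \<le> exp (- (pi / 2) * d) * R r x" if "x > 0" "d \<ge> 0" for x d
    proof -
      have "resolvent_kernel (r\<^sup>2) (x + d) \<le> exp (- (pi / 2) * d) * resolvent_kernel (r\<^sup>2) x"
        using k that unfolding exp_kernel_def by blast
      from mult_left_mono[OF this q] show ?thesis unfolding R by (simp add: mult_ac)
    qed
    show "2 * R r ((x + y) / 2) \<le> s * R r x + R r y / s" if "x > 0" "y > 0" "s > 0" for x y s
    proof -
      have "2 * resolvent_kernel (r\<^sup>2) ((x + y) / 2) \<le> s * resolvent_kernel (r\<^sup>2) x + resolvent_kernel (r\<^sup>2) y / s"
        using k that unfolding exp_kernel_def by blast
      from mult_left_mono[OF this q] show ?thesis unfolding R by (simp add: algebra_simps)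
    qed
    have "cos_transform (resolvent_kernel (r\<^sup>2)) \<xi> = tanhc \<xi> / (r\<^sup>2 + tanhc \<xi>)" for \<xi>
      using k unfolding exp_kernel_def by blast
    then show "cos_transform (R r) \<xi> = c / pi * (1 / (r\<^sup>2 + c\<^sup>2)) * (tanhc \<xi> / (r\<^sup>2 + tanhc \<xi>))" for \<xi>
      unfolding R cos_transform_def by (simp add: mult.assoc q_def)
  qed (rule R_nn)
  have R0: "R 0 = (\<lambda>x. 0)" by (simp add: R_def)
  have R_x_int: "integrable lborel (R r)" for r
    using R_x[of r] by (cases "r = 0") (auto simp: exp_kernel_def R0)
  have R_even: "R r (- x) = R r x" for r x
    using R_x[of r] R0 by (cases "r = 0") (auto simp: exp_kernel_def)
  have pair_int: "integrable (lborel \<Otimes>\<^sub>M lborel) (\<lambda>(r, x). R r x)"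
  proof (rule lborel_pair.Fubini_integrable)
    show "integrable lborel (\<lambda>r. \<integral>x. norm (case (r, x) of (r, x) \<Rightarrow> R r x) \<partial>lborel)"
    proof (rule Bochner_Integration.integrable_bound[OF w_int[of 1]])
      show "AE r in lborel. norm (\<integral>x. norm (case (r, x) of (r, x) \<Rightarrow> R r x) \<partial>lborel) \<le> norm (c / pi * (1 / (r\<^sup>2 + c\<^sup>2)) * 1)"
      proof (intro always_eventually allI)
        fix r
        have "(\<integral>x. R r x \<partial>lborel) \<le> c / pi * (1 / (r\<^sup>2 + c\<^sup>2)) * 1"
        proof (cases "r = 0")
          case False
          have "(\<integral>x. R r x \<partial>lborel) = cos_transform (R r) 0" by (simp add: cos_transform_def)
          also have "\<dots> = c / pi * (1 / (r\<^sup>2 + c\<^sup>2)) * (1 / (r\<^sup>2 + 1))"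
            using R_x[OF False] unfolding exp_kernel_def by simp
          also have "\<dots> \<le> c / pi * (1 / (r\<^sup>2 + c\<^sup>2)) * 1"
            using c c2[of r] by (intro mult_left_mono) (auto simp: divide_le_eq add_nonneg_pos)
          finally show ?thesis .
        qed (use c in \<open>simp add: R0\<close>)
        moreover have "0 \<le> (\<integral>x. R r x \<partial>lborel)" using R_nn by simp
        ultimately show "norm (\<integral>x. norm (case (r, x) of (r, x) \<Rightarrow> R r x) \<partial>lborel) \<le> norm (c / pi * (1 / (r\<^sup>2 + c\<^sup>2)) * 1)"
          using R_nn c by simp
      qed
    qed (use R_meas in measurable)
    show "AE r in lborel. integrable lborel (\<lambda>x. case (r, x) of (r, x) \<Rightarrow> R r x)"
      using R_x_int by simp
  qed (use R_meas in measurable)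
  have bk: "branch_kernel c x = (\<integral>r. R r x \<partial>lborel)" for x by (simp add: branch_kernel_def R_def)
  show ?thesis
    unfolding exp_kernel_def
  proof (intro conjI allI impI)
    show "integrable lborel (branch_kernel c)"
      using lborel_pair.integrable_snd[OF pair_int] by (simp add: bk[abs_def])
    show "branch_kernel c (- x) = branch_kernel c x" for x by (simp add: bk R_even)
    show "0 \<le> branch_kernel c x" for x using R_nn by (simp add: bk)
    show "branch_kernel c (x + d) \<le> exp (- (pi / 2) * d) * branch_kernel c x" if "x > 0" "d \<ge> 0" for x d
      unfolding bk integral_mult_right_zero[symmetric]
    proof (rule integral_mono)
      show "R r (x + d) \<le> exp (- (pi / 2) * d) * R r x" for r
        using R_x[of r] R0 that unfolding exp_kernel_def by (cases "r = 0") auto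
    qed (intro integrable_mult_right R_int)+
    show "2 * branch_kernel c ((x + y) / 2) \<le> s * branch_kernel c x + branch_kernel c y / s" 
      if "x > 0" "y > 0" "s > 0" for x y s
    proof -
      have "(\<integral>r. 2 * R r ((x + y) / 2) \<partial>lborel) \<le> (\<integral>r. s * R r x + R r y / s \<partial>lborel)"
      proof (rule integral_mono)
        show "2 * R r ((x + y) / 2) \<le> s * R r x + R r y / s" for r
          using R_x[of r] R0 that unfolding exp_kernel_def by (cases "r = 0") auto
      qed (intro integrable_mult_right R_int Bochner_Integration.integrable_add integrable_divide)+
      then show ?thesis
        unfolding bk by (subst (asm) Bochner_Integration.integral_add) (auto intro!: integrable_mult_right R_int integrable_divide)
    qed
    fix \<xi>
    define S where "S = tanhc \<xi>"
    have S: "0 < S" "S \<le> 1" unfolding S_def by (rule tanhc_pos, rule tanhc_le_1)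
    then have Sc: "S < c\<^sup>2" using c by (intro le_less_trans[OF S(2)]) (simp add: one_less_power)
    have "cos_transform (branch_kernel c) \<xi> = (\<integral>x. (\<integral>r. R r x * cos (\<xi> * x) \<partial>lborel) \<partial>lborel)"
      by (simp add: cos_transform_def bk)
    also have "\<dots> = (\<integral>r. (\<integral>x. R r x * cos (\<xi> * x) \<partial>lborel) \<partial>lborel)"
    proof (rule lborel_pair.Fubini_integral)
      show "integrable (lborel \<Otimes>\<^sub>M lborel) (\<lambda>(r, x). R r x * cos (\<xi> * x))"
      proof (rule Bochner_Integration.integrable_bound[OF pair_int])
        show "AE p in lborel \<Otimes>\<^sub>M lborel. norm (case p of (r, x) \<Rightarrow> R r x * cos (\<xi> * x)) \<le> norm (case p of (r, x) \<Rightarrow> R r x)"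
          by (intro always_eventually allI) (auto simp: abs_mult mult_left_le split: prod.split)
      qed (use R_meas in measurable)
    qed
    \<comment> \<open>Partial fractions in \<open>r\<close>. The integral of
      \<open>1 / (r\<^sup>2 + S)\<close> is \<open>pi / sqrt S\<close>, and this is where the square
      root of the symbol comes from.\<close>
    also have "\<dots> = (\<integral>r. c * S / (pi * (c\<^sup>2 - S)) * (1 / (r\<^sup>2 + S) - 1 / (r\<^sup>2 + c\<^sup>2)) \<partial>lborel)"
    proof (rule integral_cong_AE)
      show "AE r in lborel. (\<integral>x. R r x * cos (\<xi> * x) \<partial>lborel)
          = c * S / (pi * (c\<^sup>2 - S)) * (1 / (r\<^sup>2 + S) - 1 / (r\<^sup>2 + c\<^sup>2))"
        using AE_lborel_singleton[of "0::real"]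
      proof eventually_elim
        case (elim r)
        have "(\<integral>x. R r x * cos (\<xi> * x) \<partial>lborel) = c / pi * (1 / (r\<^sup>2 + c\<^sup>2)) * (S / (r\<^sup>2 + S))"
          using R_x[OF elim] unfolding exp_kernel_def cos_transform_def S_def by blast
        also have "1 / (r\<^sup>2 + S) - 1 / (r\<^sup>2 + c\<^sup>2) = (c\<^sup>2 - S) / ((r\<^sup>2 + S) * (r\<^sup>2 + c\<^sup>2))"
          using c2[of r] S by (subst diff_frac_eq) (auto simp: add_nonneg_eq_0_iff)
        then have "c / pi * (1 / (r\<^sup>2 + c\<^sup>2)) * (S / (r\<^sup>2 + S)) = c * S / (pi * (c\<^sup>2 - S)) * (1 / (r\<^sup>2 + S) - 1 / (r\<^sup>2 + c\<^sup>2))"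
          using Sc by simp
        finally show ?case .
      qed
    qed (use R_meas in measurable)
    also have "\<dots> = c * S / (pi * (c\<^sup>2 - S)) * (pi / sqrt S - pi / sqrt (c\<^sup>2))"
      using integrable_lorentz[OF S(1)] integrable_lorentz[of "c\<^sup>2"] integral_lorentz[OF S(1)] integral_lorentz[of "c\<^sup>2"] c
      by (subst integral_mult_right_zero) (subst Bochner_Integration.integral_diff, auto)
    also have "\<dots> = sqrt S / (c + sqrt S)"
    proof -
      define m where "m = sqrt S"
      have m: "0 < m" "S = m\<^sup>2" "m < c" unfolding m_def using S Sc c by (auto intro: real_less_lsqrt)
      have "c * m\<^sup>2 / (pi * (c\<^sup>2 - m\<^sup>2)) * (pi / m - pi / c) = c * m\<^sup>2 / ((c - m) * (c + m)) * ((c - m) / (m * c))"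
        using m c by (simp add: power2_eq_square algebra_simps divide_simps)
      also have "\<dots> = m / (c + m)"
        using m c by (simp add: power2_eq_square)
      finally show ?thesis using c m by (simp flip: m_def)
    qed
    finally show "cos_transform (branch_kernel c) \<xi> = sqrt (tanhc \<xi>) / (c + sqrt (tanhc \<xi>))"
      by (simp add: S_def)
  qed
qed

section \<open>Behaviour at the origin\<close>

lemma powr_minus_half_abs_integrable:
  shows integrable_powr_lorentz: "integrable lborel (\<lambda>u::real. \<bar>u\<bar> powr (-1/2) * (2 / (u\<^sup>2 + 1)))"
    and integrable_powr_ball: "integrable lborel (\<lambda>u::real. indicator {-1..1} u * \<bar>u\<bar> powr (-1/2))"
proof -
  have "(\<lambda>x::real. x powr (-1/2)) absolutely_integrable_on {0..1}"
    by (intro nonnegative_absolutely_integrable_1 integrable_on_powr_from_0) auto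
  then have "integrable lebesgue (\<lambda>x::real. indicator {0..1} x * x powr (-1/2))"
    by (simp add: set_integrable_def)
  then have 1: "integrable lborel (\<lambda>x::real. indicator {0..1} x * x powr (-1/2))"
    by (subst (asm) integrable_completion) auto
  have "integrable lborel (\<lambda>x::real. indicator {0..1} x * x powr (-1/2) + indicator {0..1} (0 + (-1) * x) * (0 + (-1) * x) powr (-1/2))"
    using lborel_integrable_real_affine[OF 1, of "-1" 0] 1 by (intro Bochner_Integration.integrable_add) auto
  then show 2: "integrable lborel (\<lambda>u::real. indicator {-1..1} u * \<bar>u\<bar> powr (-1/2))"
    by (rule Bochner_Integration.integrable_bound) (auto simp: indicator_def)
  have "integrable lborel (\<lambda>u::real. 2 * (indicator {-1..1} u * \<bar>u\<bar> powr (-1/2)) + 2 * (1 / (u\<^sup>2 + 1)))"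
    by (intro Bochner_Integration.integrable_add integrable_mult_right 2 integrable_lorentz) simp
  then show "integrable lborel (\<lambda>u::real. \<bar>u\<bar> powr (-1/2) * (2 / (u\<^sup>2 + 1)))"
  proof (rule Bochner_Integration.integrable_bound)
    show "AE u::real in lborel. norm (\<bar>u\<bar> powr (-1/2) * (2 / (u\<^sup>2 + 1))) \<le> norm (2 * (indicator {-1..1} u * \<bar>u\<bar> powr (-1/2)) + 2 * (1 / (u\<^sup>2 + 1)))"
    proof (intro always_eventually allI)
      fix u :: real
      have p: "0 < u\<^sup>2 + 1" by (simp add: add_nonneg_pos)
      show "norm (\<bar>u\<bar> powr (-1/2) * (2 / (u\<^sup>2 + 1))) \<le> norm (2 * (indicator {-1..1} u * \<bar>u\<bar> powr (-1/2)) + 2 * (1 / (u\<^sup>2 + 1)))"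
      proof (cases "\<bar>u\<bar> \<le> 1")
        case True
        then have u: "u \<in> {-1..1}" by auto
        have "2 / (u\<^sup>2 + 1) \<le> 2" by (simp add: divide_le_eq p)
        then have "\<bar>u\<bar> powr (-1/2) * (2 / (u\<^sup>2 + 1)) \<le> \<bar>u\<bar> powr (-1/2) * 2" by (intro mult_left_mono) auto
        then show ?thesis using u p by (simp add: abs_mult add_nonneg_pos add_increasing2)
      next
        case False
        then have "\<bar>u\<bar> powr (-1/2) \<le> \<bar>u\<bar> powr 0" by (intro powr_mono) auto
        then have "\<bar>u\<bar> powr (-1/2) * (2 / (u\<^sup>2 + 1)) \<le> 1 * (2 / (u\<^sup>2 + 1))"
          using False p by (intro mult_right_mono) (auto split: if_splits)
        moreover have "0 \<le> 2 * (indicator {-1..1} u * \<bar>u\<bar> powr (-1/2))" by simp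
        moreover have "u \<notin> {-1..1}" using False by auto
        ultimately show ?thesis using p by (simp add: abs_mult)
      qed
    qed
  qed measurable
qed

lemma scaled_powr_integrals:
  fixes l :: real
  assumes l: "l > 0"
  shows scaled_powr_lorentz: "integrable lborel (\<lambda>\<xi>::real. \<bar>\<xi>\<bar> powr (-1/2) * (2 * l / (\<xi>\<^sup>2 + l\<^sup>2)))"
     "(\<integral>\<xi>. \<bar>\<xi>\<bar> powr (-1/2) * (2 * l / (\<xi>\<^sup>2 + l\<^sup>2)) \<partial>lborel) = l powr (-1/2) * (\<integral>u. \<bar>u\<bar> powr (-1/2) * (2 / (u\<^sup>2 + 1)) \<partial>lborel)"
    and scaled_powr_ball: "integrable lborel (\<lambda>\<xi>::real. indicator {-l..l} \<xi> * \<bar>\<xi>\<bar> powr (-1/2))"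
     "(\<integral>\<xi>. indicator {-l..l} \<xi> * \<bar>\<xi>\<bar> powr (-1/2) \<partial>lborel) = l powr (1/2) * (\<integral>u. indicator {-1..1} u * \<bar>u\<bar> powr (-1/2) \<partial>lborel)"
proof -
  have e1: "\<bar>0 + l * u\<bar> powr (-1/2) * (2 * l / ((0 + l * u)\<^sup>2 + l\<^sup>2)) = (l powr (-1/2) / l) * (\<bar>u\<bar> powr (-1/2) * (2 / (u\<^sup>2 + 1)))" for u
  proof -
    have "(0 + l * u)\<^sup>2 + l\<^sup>2 = l * l * (u\<^sup>2 + 1)" by (simp add: power2_eq_square algebra_simps)
    moreover have "\<bar>0 + l * u\<bar> powr (-1/2) = l powr (-1/2) * \<bar>u\<bar> powr (-1/2)" using l by (simp add: abs_mult powr_mult)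
    ultimately show ?thesis using l by (simp add: mult_ac)
  qed
  have "integrable lborel (\<lambda>u. \<bar>0 + l * u\<bar> powr (-1/2) * (2 * l / ((0 + l * u)\<^sup>2 + l\<^sup>2)))"
    unfolding e1 by (rule integrable_mult_right[OF integrable_powr_lorentz])
  then show "integrable lborel (\<lambda>\<xi>::real. \<bar>\<xi>\<bar> powr (-1/2) * (2 * l / (\<xi>\<^sup>2 + l\<^sup>2)))"
    using l by (subst lborel_integrable_real_affine_iff[of l _ 0, symmetric]) (simp_all only: less_imp_neq[THEN not_sym] not_False_eq_True)
  have "(\<integral>\<xi>. \<bar>\<xi>\<bar> powr (-1/2) * (2 * l / (\<xi>\<^sup>2 + l\<^sup>2)) \<partial>lborel)
      = \<bar>l\<bar> *\<^sub>R (\<integral>u. \<bar>0 + l * u\<bar> powr (-1/2) * (2 * l / ((0 + l * u)\<^sup>2 + l\<^sup>2)) \<partial>lborel)"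
    using l by (intro lborel_integral_real_affine) auto
  then show "(\<integral>\<xi>. \<bar>\<xi>\<bar> powr (-1/2) * (2 * l / (\<xi>\<^sup>2 + l\<^sup>2)) \<partial>lborel) = l powr (-1/2) * (\<integral>u. \<bar>u\<bar> powr (-1/2) * (2 / (u\<^sup>2 + 1)) \<partial>lborel)"
    unfolding e1 integral_mult_right_zero using l by simp
  have e2: "indicator {-l..l} (0 + l * u) * \<bar>0 + l * u\<bar> powr (-1/2) = l powr (-1/2) * (indicator {-1..1} u * \<bar>u\<bar> powr (-1/2))" for u
  proof -
    have "(- l \<le> l * u) = (-1 \<le> u)" "(l * u \<le> l) = (u \<le> 1)" 
      using mult_le_cancel_left_pos[OF l, of "-1" u] mult_le_cancel_left_pos[OF l, of u 1] by auto
    then have "indicator {-l..l} (0 + l * u) = (indicator {-1..1} u :: real)" by (auto simp: indicator_def)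
    moreover have "\<bar>0 + l * u\<bar> powr (-1/2) = l powr (-1/2) * \<bar>u\<bar> powr (-1/2)" using l by (simp add: abs_mult powr_mult)
    ultimately show ?thesis by (simp add: mult_ac)
  qed
  have "integrable lborel (\<lambda>u. indicator {-l..l} (0 + l * u) * \<bar>0 + l * u\<bar> powr (-1/2))"
    unfolding e2 by (rule integrable_mult_right[OF integrable_powr_ball])
  then show "integrable lborel (\<lambda>\<xi>::real. indicator {-l..l} \<xi> * \<bar>\<xi>\<bar> powr (-1/2))"
    using l by (subst lborel_integrable_real_affine_iff[of l _ 0, symmetric]) (simp_all only: less_imp_neq[THEN not_sym] not_False_eq_True)
  have "(\<integral>\<xi>. indicator {-l..l} \<xi> * \<bar>\<xi>\<bar> powr (-1/2) \<partial>lborel)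
     = \<bar>l\<bar> *\<^sub>R (\<integral>u. indicator {-l..l} (0 + l * u) * \<bar>0 + l * u\<bar> powr (-1/2) \<partial>lborel)"
    using l by (intro lborel_integral_real_affine) auto
  also have "\<dots> = l * l powr (-1/2) * (\<integral>u. indicator {-1..1} u * \<bar>u\<bar> powr (-1/2) \<partial>lborel)"
    unfolding e2 integral_mult_right_zero using l by simp
  also have "l * l powr (-1/2) = l powr (1/2)" using l powr_add[of l 1 "-1/2"] by simp
  finally show "(\<integral>\<xi>. indicator {-l..l} \<xi> * \<bar>\<xi>\<bar> powr (-1/2) \<partial>lborel) = l powr (1/2) * (\<integral>u. indicator {-1..1} u * \<bar>u\<bar> powr (-1/2) \<partial>lborel)" .
qed

section \<open>Laplace averages of a kernel and its singularity\<close>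

lemma exp_abs_inversion:
  fixes l :: real
  assumes l: "l > 0"
  shows "cos_transform (\<lambda>\<xi>. 2 * l / (\<xi>\<^sup>2 + l\<^sup>2)) y = 2 * pi * exp (- l * \<bar>y\<bar>)"
    and integrable_lorentz': "integrable lborel (\<lambda>\<xi>. 2 * l / (\<xi>\<^sup>2 + l\<^sup>2))"
proof -
  show i: "integrable lborel (\<lambda>\<xi>. 2 * l / (\<xi>\<^sup>2 + l\<^sup>2))"
    using integrable_mult_right[OF integrable_lorentz[of "l\<^sup>2"], of "2 * l"] l by simp
  have e: "cos_transform (\<lambda>x. exp (- l * \<bar>x\<bar>)) = (\<lambda>\<xi>. 2 * l / (\<xi>\<^sup>2 + l\<^sup>2))"
    by (intro ext cos_transform_exp_abs[OF l])
  have "cos_transform (cos_transform (\<lambda>x. exp (- l * \<bar>x\<bar>))) y = 2 * pi * exp (- l * \<bar>y\<bar>)"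
  proof (rule cos_transform_inversion[where B = 1])
    show "continuous_on UNIV (\<lambda>x. exp (- l * \<bar>x\<bar>))" by (intro continuous_intros)
    show "integrable lborel (\<lambda>x. exp (- l * \<bar>x\<bar>))" by (rule integrable_exp_abs[OF l])
    show "integrable lborel (cos_transform (\<lambda>x. exp (- l * \<bar>x\<bar>)))" unfolding e by (rule i)
  qed (use l in auto)
  then show "cos_transform (\<lambda>\<xi>. 2 * l / (\<xi>\<^sup>2 + l\<^sup>2)) y = 2 * pi * exp (- l * \<bar>y\<bar>)" unfolding e .
qed

text \<open>A Parseval identity for \<open>exp (- l * \<bar>y\<bar>)\<close> and its transform. Both
  weights are nonnegative, so one-sided bounds on the symbol turn into bounds on averages of
  \<open>h\<close>, even where the symbol is not integrable.\<close>

lemma integral_exp_abs_eq: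
  assumes h: "integrable lborel h" and l: "l > 0"
  shows "2 * pi * (\<integral>y. h y * exp (- l * \<bar>y\<bar>) \<partial>lborel) = (\<integral>\<xi>. cos_transform h \<xi> * (2 * l / (\<xi>\<^sup>2 + l\<^sup>2)) \<partial>lborel)"
    and "integrable lborel (\<lambda>\<xi>. cos_transform h \<xi> * (2 * l / (\<xi>\<^sup>2 + l\<^sup>2)))"
proof -
  have pi: "integrable (lborel \<Otimes>\<^sub>M lborel) (\<lambda>(y, \<xi>). h y * (2 * l / (\<xi>\<^sup>2 + l\<^sup>2)) * (case (y, \<xi>) of (y, \<xi>) \<Rightarrow> cos (y * \<xi>)))"
    by (rule integrable_pair_mult[OF h integrable_lorentz'[OF l], of _ 1]) auto
  have e: "(\<integral>y. h y * (2 * l / (\<xi>\<^sup>2 + l\<^sup>2)) * cos (y * \<xi>) \<partial>lborel) = cos_transform h \<xi> * (2 * l / (\<xi>\<^sup>2 + l\<^sup>2))" for \<xi>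
    unfolding cos_transform_def by (subst integral_mult_left_zero[symmetric]) (simp add: mult_ac)
  have "2 * pi * (\<integral>y. h y * exp (- l * \<bar>y\<bar>) \<partial>lborel) = (\<integral>y. h y * cos_transform (\<lambda>\<xi>. 2 * l / (\<xi>\<^sup>2 + l\<^sup>2)) y \<partial>lborel)"
    unfolding exp_abs_inversion(1)[OF l] by (subst integral_mult_right_zero[symmetric]) (simp only: mult_ac)
  also have "\<dots> = (\<integral>y. (\<integral>\<xi>. h y * (2 * l / (\<xi>\<^sup>2 + l\<^sup>2)) * cos (y * \<xi>) \<partial>lborel) \<partial>lborel)"
    by (simp add: cos_transform_def mult.assoc flip: integral_mult_right_zero)
  also have "\<dots> = (\<integral>\<xi>. (\<integral>y. h y * (2 * l / (\<xi>\<^sup>2 + l\<^sup>2)) * cos (y * \<xi>) \<partial>lborel) \<partial>lborel)"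
    by (rule lborel_pair.Fubini_integral[symmetric]) (use pi in simp)
  finally show "2 * pi * (\<integral>y. h y * exp (- l * \<bar>y\<bar>) \<partial>lborel) = (\<integral>\<xi>. cos_transform h \<xi> * (2 * l / (\<xi>\<^sup>2 + l\<^sup>2)) \<partial>lborel)"
    by (simp only: e)
  have "integrable lborel (\<lambda>\<xi>. \<integral>y. h y * (2 * l / (\<xi>\<^sup>2 + l\<^sup>2)) * cos (y * \<xi>) \<partial>lborel)"
    using lborel_pair.integrable_snd[OF pi] by simp
  then show "integrable lborel (\<lambda>\<xi>. cos_transform h \<xi> * (2 * l / (\<xi>\<^sup>2 + l\<^sup>2)))" by (simp only: e)
qed

lemma integrable_mult_exp_abs:
  fixes h :: "real \<Rightarrow> real"
  assumes [measurable]: "integrable lborel h" and "l \<ge> 0"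
  shows "integrable lborel (\<lambda>y. h y * exp (- l * \<bar>y\<bar>))"
proof (rule Bochner_Integration.integrable_bound[OF assms(1)])
  show "AE y in lborel. norm (h y * exp (- l * \<bar>y\<bar>)) \<le> norm (h y)"
    using assms(2) by (intro always_eventually allI) (simp add: abs_mult mult_left_le)
qed measurable

text \<open>Monotonicity passes from averages to values: \<open>h\<close> is at least
  \<open>h x\<close> almost everywhere on \<open>{-\<bar>x\<bar>..\<bar>x\<bar>}\<close>, while the
  average with \<open>l = 1 / \<bar>x\<bar>\<close> is at most a multiple of
  \<open>l powr (-1/2)\<close>, which is \<open>\<bar>x\<bar> powr (1/2)\<close>.\<close>

lemma exp_kernel_upper_bound:
  assumes h: "exp_kernel a E h" and a: "a \<ge> 0" and E: "\<And>\<xi>. \<xi> \<noteq> 0 \<Longrightarrow> E \<xi> \<le> C * \<bar>\<xi>\<bar> powr (-1/2)"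
  shows "\<exists>K>0. \<forall>x. x \<noteq> 0 \<longrightarrow> h x \<le> K * \<bar>x\<bar> powr (-1/2)"
proof -
  have hi: "integrable lborel h" and hE: "cos_transform h = E" and hn: "0 \<le> h x" for x
    using h by (auto simp: exp_kernel_def)
  define J where "J = (\<integral>u. \<bar>u :: real\<bar> powr (-1/2) * (2 / (u\<^sup>2 + 1)) \<partial>lborel)"
  define K where "K = \<bar>exp 1 * C * J / (4 * pi)\<bar> + 1"
  have "h x \<le> K * \<bar>x\<bar> powr (-1/2)" if "x \<noteq> 0" for x
  proof -
    define l where "l = 1 / \<bar>x\<bar>"
    have l: "l > 0" using that by (simp add: l_def)
    have "2 * \<bar>x\<bar> * (h x * exp (-1)) = (\<integral>y. h x * exp (-1) * indicator {-\<bar>x\<bar>..\<bar>x\<bar>} y \<partial>lborel)"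
      by simp
    also have "\<dots> \<le> (\<integral>y. h y * exp (- l * \<bar>y\<bar>) \<partial>lborel)"
    proof (rule integral_mono_AE)
      show "integrable lborel (\<lambda>y. h x * exp (-1) * indicator {-\<bar>x\<bar>..\<bar>x\<bar>} y)"
        by (intro integrable_mult_right integrable_real_indicator) (auto simp: emeasure_lborel_Icc_eq)
      show "integrable lborel (\<lambda>y. h y * exp (- l * \<bar>y\<bar>))" using integrable_mult_exp_abs[OF hi] l by simp
      show "AE y in lborel. h x * exp (-1) * indicator {-\<bar>x\<bar>..\<bar>x\<bar>} y \<le> h y * exp (- l * \<bar>y\<bar>)"
        using AE_lborel_singleton[of "0::real"]
      proof eventually_elim
        case (elim y)
        show ?case
        proof (cases "y \<in> {-\<bar>x\<bar>..\<bar>x\<bar>}")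
          case True
          then have "\<bar>y\<bar> \<le> \<bar>x\<bar>" by auto
          then have "l * \<bar>y\<bar> \<le> 1" "h x \<le> h y"
            using exp_kernel_antimono'[OF h a, of y x] elim that by (auto simp: l_def)
          then show ?thesis using True hn by (auto intro!: mult_mono)
        qed (use hn in auto)
      qed
    qed
    also have "\<dots> = (\<integral>\<xi>. E \<xi> * (2 * l / (\<xi>\<^sup>2 + l\<^sup>2)) \<partial>lborel) / (2 * pi)"
      using integral_exp_abs_eq(1)[OF hi l] unfolding hE by (simp add: field_simps)
    also have "(\<integral>\<xi>. E \<xi> * (2 * l / (\<xi>\<^sup>2 + l\<^sup>2)) \<partial>lborel) \<le> (\<integral>\<xi>. C * (\<bar>\<xi>\<bar> powr (-1/2) * (2 * l / (\<xi>\<^sup>2 + l\<^sup>2))) \<partial>lborel)"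
    proof (rule integral_mono_AE)
      show "integrable lborel (\<lambda>\<xi>. E \<xi> * (2 * l / (\<xi>\<^sup>2 + l\<^sup>2)))" using integral_exp_abs_eq(2)[OF hi l] unfolding hE .
      show "integrable lborel (\<lambda>\<xi>. C * (\<bar>\<xi>\<bar> powr (-1/2) * (2 * l / (\<xi>\<^sup>2 + l\<^sup>2))))"
        by (rule integrable_mult_right[OF scaled_powr_lorentz(1)[OF l]])
      show "AE \<xi> in lborel. E \<xi> * (2 * l / (\<xi>\<^sup>2 + l\<^sup>2)) \<le> C * (\<bar>\<xi>\<bar> powr (-1/2) * (2 * l / (\<xi>\<^sup>2 + l\<^sup>2)))"
        using AE_lborel_singleton[of "0::real"]
      proof eventually_elim
        case (elim \<xi>)
        from mult_right_mono[OF E[OF elim], of "2 * l / (\<xi>\<^sup>2 + l\<^sup>2)"] l show ?case by (simp add: mult_ac)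
      qed
    qed
    also have "\<dots> = C * (l powr (-1/2) * J)" unfolding J_def integral_mult_right_zero scaled_powr_lorentz(2)[OF l] ..
    finally have "2 * \<bar>x\<bar> * (h x * exp (-1)) \<le> C * (l powr (-1/2) * J) / (2 * pi)" by (simp add: divide_right_mono)
    also have "l powr (-1/2) = \<bar>x\<bar> powr (1/2)"
      using that by (simp add: l_def powr_divide powr_minus divide_simps)
    finally have "(2 * \<bar>x\<bar> * (h x * exp (-1))) * (exp 1 / (2 * \<bar>x\<bar>)) \<le> C * (\<bar>x\<bar> powr (1/2) * J) / (2 * pi) * (exp 1 / (2 * \<bar>x\<bar>))"
      using that by (intro mult_right_mono) auto
    also have "(2 * \<bar>x\<bar> * (h x * exp (-1))) * (exp 1 / (2 * \<bar>x\<bar>)) = h x" using that by (simp add: exp_minus)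
    also have "C * (\<bar>x\<bar> powr (1/2) * J) / (2 * pi) * (exp 1 / (2 * \<bar>x\<bar>)) = exp 1 * C * J / (4 * pi) * (\<bar>x\<bar> powr (1/2) / \<bar>x\<bar>)"
      by (simp add: mult_ac)
    also have "\<bar>x\<bar> powr (1/2) / \<bar>x\<bar> = \<bar>x\<bar> powr (-1/2)"
      using that powr_diff[of "\<bar>x\<bar>" "1/2" 1] by simp
    also have "exp 1 * C * J / (4 * pi) * \<bar>x\<bar> powr (-1/2) \<le> K * \<bar>x\<bar> powr (-1/2)"
      unfolding K_def by (intro mult_right_mono) (linarith, simp)
    finally show ?thesis .
  qed
  moreover have "K > 0" unfolding K_def by (rule add_nonneg_pos) auto
  ultimately show ?thesis by blast
qed

text \<open>The Tauberian half. With \<open>l = \<eta> / x\<close> the average is at least a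
  multiple of \<open>(x / \<eta>) powr (1/2)\<close>. The upper bound limits the part over
  \<open>\<bar>y\<bar> \<le> x\<close> to \<open>K * J * x powr (1/2)\<close>, monotonicity limits
  the rest to \<open>h x * (2 / l)\<close>. For small \<open>\<eta>\<close> the first part cannot
  account for the whole average, which forces \<open>h x\<close> to be large.\<close>

lemma exp_kernel_lower_bound:
  assumes h: "exp_kernel a E h" and a: "a \<ge> 0" and K: "K > 0" "\<And>x. x \<noteq> 0 \<Longrightarrow> h x \<le> K * \<bar>x\<bar> powr (-1/2)"
    and E: "\<And>\<xi>. \<bar>\<xi>\<bar> \<ge> 1 \<Longrightarrow> C * \<bar>\<xi>\<bar> powr (-1/2) \<le> E \<xi>" "\<And>\<xi>. 0 \<le> E \<xi>" and C: "C > 0"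
  shows "\<exists>k>0. \<forall>x. 0 < \<bar>x\<bar> \<and> \<bar>x\<bar> < 1 \<longrightarrow> k * \<bar>x\<bar> powr (-1/2) \<le> h x"
proof -
  have hi: "integrable lborel h" and hE: "cos_transform h = E" and hn: "0 \<le> h x" and ev: "h (- x) = h x" for x
    using h by (auto simp: exp_kernel_def)
  define J where "J = (\<integral>u. indicator {-1..1} u * \<bar>u :: real\<bar> powr (-1/2) \<partial>lborel)"
  have J: "0 \<le> J" unfolding J_def by simp
  \<comment> \<open>Chosen so that \<open>C / 5 * (x powr (1/2) / r) * 2\<close> equals
    \<open>2 * pi * (2 * (K * J + 1) * x powr (1/2))\<close>, more than twice what the part near the
    origin can absorb. Then \<open>2 * \<eta> \<le> r\<^sup>2\<close> puts the true lower bound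
    above this value.\<close>
  define r where "r = C / (10 * pi * (K * J + 1))"
  have KJ: "K * J \<ge> 0" using K J by simp
  have r: "r > 0" unfolding r_def using C KJ by (intro divide_pos_pos mult_pos_pos) auto
  define \<eta> where "\<eta> = min 1 (r\<^sup>2 / 2)"
  have \<eta>: "0 < \<eta>" "\<eta> \<le> 1" "2 * \<eta> \<le> r\<^sup>2" unfolding \<eta>_def using r by auto
  have main: "\<eta> / 2 * x powr (-1/2) \<le> h x" if x: "0 < x" "x \<le> \<eta>" for x
  proof -
    define l where "l = \<eta> / x"
    have l: "l \<ge> 1" "l > 0" using x \<eta> by (auto simp: l_def)
    \<comment> \<open>Only the frequencies in \<open>{l..2*l}\<close> are kept: there the Lorentz
      weight is at least \<open>2 / (5 * l)\<close>, and \<open>l \<ge> 1\<close> puts them within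
      reach of the lower bound on \<open>E\<close>.\<close>
    have "C / 5 * (2 * l) powr (-1/2) * 2 = (\<integral>\<xi>. C * (2 * l) powr (-1/2) * (2 / (5 * l)) * indicator {l..2*l} \<xi> \<partial>lborel)"
      using l by simp
    also have "\<dots> \<le> (\<integral>\<xi>. E \<xi> * (2 * l / (\<xi>\<^sup>2 + l\<^sup>2)) \<partial>lborel)"
    proof (rule integral_mono)
      show "integrable lborel (\<lambda>\<xi>. C * (2 * l) powr (-1/2) * (2 / (5 * l)) * indicator {l..2*l} \<xi>)"
        by (intro integrable_mult_right integrable_real_indicator) (auto simp: emeasure_lborel_Icc_eq)
      show "integrable lborel (\<lambda>\<xi>. E \<xi> * (2 * l / (\<xi>\<^sup>2 + l\<^sup>2)))" using integral_exp_abs_eq(2)[OF hi l(2)] unfolding hE .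
      fix \<xi>
      show "C * (2 * l) powr (-1/2) * (2 / (5 * l)) * indicator {l..2*l} \<xi> \<le> E \<xi> * (2 * l / (\<xi>\<^sup>2 + l\<^sup>2))"
      proof (cases "\<xi> \<in> {l..2*l}")
        case True
        then have \<xi>: "l \<le> \<xi>" "\<xi> \<le> 2 * l" by auto
        have "(2 * l) powr (-1/2) \<le> \<bar>\<xi>\<bar> powr (-1/2)" using \<xi> l by (intro powr_mono2') auto
        then have "C * (2 * l) powr (-1/2) \<le> C * \<bar>\<xi>\<bar> powr (-1/2)" using C by simp
        also have "\<dots> \<le> E \<xi>" using \<xi> l by (intro E) auto
        finally have 1: "C * (2 * l) powr (-1/2) \<le> E \<xi>" .
        have "\<xi>\<^sup>2 + l\<^sup>2 \<le> (2 * l)\<^sup>2 + l\<^sup>2" using \<xi> l by (intro add_mono power_mono) auto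
        then have "2 * l / (5 * l\<^sup>2) \<le> 2 * l / (\<xi>\<^sup>2 + l\<^sup>2)"
          using l by (intro divide_left_mono mult_pos_pos add_nonneg_pos) (auto simp: power_mult_distrib)
        also have "2 * l / (5 * l\<^sup>2) = 2 / (5 * l)" using l by (simp add: power2_eq_square)
        finally have "C * (2 * l) powr (-1/2) * (2 / (5 * l)) \<le> E \<xi> * (2 * l / (\<xi>\<^sup>2 + l\<^sup>2))"
          using 1 l E(2) by (intro mult_mono) auto
        then show ?thesis using True by simp
      next
        case False then show ?thesis using E(2) l by simp
      qed
    qed
    also have "\<dots> = 2 * pi * (\<integral>y. h y * exp (- l * \<bar>y\<bar>) \<partial>lborel)"
      using integral_exp_abs_eq(1)[OF hi l(2)] unfolding hE by simp
    also have "(\<integral>y. h y * exp (- l * \<bar>y\<bar>) \<partial>lborel) \<le> (\<integral>y. K * (indicator {-x..x} y * \<bar>y\<bar> powr (-1/2)) + h x * exp (- l * \<bar>y\<bar>) \<partial>lborel)"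
    proof (rule integral_mono_AE)
      show "integrable lborel (\<lambda>y. h y * exp (- l * \<bar>y\<bar>))" using integrable_mult_exp_abs[OF hi] l by simp
      show "integrable lborel (\<lambda>y. K * (indicator {-x..x} y * \<bar>y\<bar> powr (-1/2)) + h x * exp (- l * \<bar>y\<bar>))"
        using x l by (intro Bochner_Integration.integrable_add integrable_mult_right scaled_powr_ball(1) integrable_exp_abs) auto
      show "AE y in lborel. h y * exp (- l * \<bar>y\<bar>) \<le> K * (indicator {-x..x} y * \<bar>y\<bar> powr (-1/2)) + h x * exp (- l * \<bar>y\<bar>)"
        using AE_lborel_singleton[of "0::real"]
      proof eventually_elim
        case (elim y)
        show ?case
        proof (cases "\<bar>y\<bar> \<le> x")
          case True
          then have i: "y \<in> {-x..x}" by auto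
          have "h y * exp (- l * \<bar>y\<bar>) \<le> h y * 1" using hn l by (intro mult_left_mono) auto
          also have "\<dots> \<le> K * \<bar>y\<bar> powr (-1/2)" using K(2)[OF elim] by simp
          finally show ?thesis using i hn[of x] by (simp add: add_increasing2)
        next
          case False
          then have "h y \<le> h x" using exp_kernel_antimono'[OF h a, of x y] x by auto
          then have "h y * exp (- l * \<bar>y\<bar>) \<le> h x * exp (- l * \<bar>y\<bar>)" by (intro mult_right_mono) auto
          moreover have "0 \<le> K * (indicator {-x..x} y * \<bar>y\<bar> powr (-1/2))" using K by simp
          ultimately show ?thesis by linarith
        qed
      qed
    qed
    also have "\<dots> = K * (x powr (1/2) * J) + h x * (2 / l)"
    proof -
      have "(\<integral>y. exp (- l * \<bar>y\<bar>) \<partial>lborel) = 2 / l"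
        using cos_transform_exp_abs[OF l(2), of 0] l by (simp add: cos_transform_def power2_eq_square)
      then show ?thesis
        using scaled_powr_ball[OF x(1)] integrable_exp_abs[OF l(2)]
        by (subst Bochner_Integration.integral_add) (auto simp: J_def)
    qed
    finally have *: "C / 5 * (2 * l) powr (-1/2) * 2 \<le> 2 * pi * (K * (x powr (1/2) * J) + h x * (2 / l))"
      by simp
    have "(2 * l) powr (-1/2) = x powr (1/2) / (2 * \<eta>) powr (1/2)"
      using x \<eta> by (simp add: l_def powr_divide powr_minus divide_simps)
    moreover have "(2 * \<eta>) powr (1/2) \<le> (r\<^sup>2) powr (1/2)" using \<eta> by (intro powr_mono2) auto
    then have "(2 * \<eta>) powr (1/2) \<le> r" using r by (simp add: powr_half_sqrt)
    then have "x powr (1/2) / r \<le> x powr (1/2) / (2 * \<eta>) powr (1/2)"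
      using \<eta> r by (intro divide_left_mono) auto
    ultimately have "x powr (1/2) / r \<le> (2 * l) powr (-1/2)" by simp
    then have "C / 5 * (x powr (1/2) / r) * 2 \<le> C / 5 * (2 * l) powr (-1/2) * 2"
      using C by (intro mult_right_mono mult_left_mono) auto
    also have "C / 5 * (x powr (1/2) / r) * 2 = 2 * pi * (2 * (K * J + 1) * x powr (1/2))"
      unfolding r_def using C KJ by (simp add: field_simps)
    finally have "2 * pi * (2 * (K * J + 1) * x powr (1/2)) \<le> 2 * pi * (K * (x powr (1/2) * J) + h x * (2 / l))"
      using * by linarith
    then have "2 * (K * J + 1) * x powr (1/2) \<le> K * (x powr (1/2) * J) + h x * (2 / l)"
      by (subst (asm) mult_le_cancel_left_pos) auto
    then have "x powr (1/2) + (K * J + 1) * x powr (1/2) \<le> h x * (2 / l)"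
      by (simp add: algebra_simps)
    moreover have "0 \<le> (K * J + 1) * x powr (1/2)" using KJ by simp
    ultimately have "x powr (1/2) \<le> h x * (2 / l)" by linarith
    then have "x powr (1/2) * (l / 2) \<le> h x * (2 / l) * (l / 2)" using l by (intro mult_right_mono) auto
    also have "h x * (2 / l) * (l / 2) = h x" using l by simp
    also have "x powr (1/2) * (l / 2) = \<eta> / 2 * (x powr (1/2) / x)" by (simp add: l_def mult_ac)
    also have "x powr (1/2) / x = x powr (-1/2)" using x powr_diff[of x "1/2" 1] by simp
    finally show ?thesis .
  qed
  \<comment> \<open>Beyond \<open>\<eta>\<close> the averaging argument says nothing;
    \<open>exp_kernel_pos\<close> carries strict positivity out to 1, and monotonicity gives a
    constant lower bound on the rest of the interval.\<close>
  have "h \<eta> > 0" using main[of \<eta>] \<eta> by (intro less_le_trans[OF _ main[of \<eta>]]) auto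
  then have h1: "h 1 > 0" using exp_kernel_pos[OF h a \<eta>(1), of 1] by simp
  define k where "k = min (\<eta> / 2) (h 1 / \<eta> powr (-1/2))"
  have k2: "k \<le> \<eta> / 2" unfolding k_def by (rule min.cobounded1)
  have k: "k > 0" unfolding k_def using \<eta> h1 by auto
  have "k * \<bar>x\<bar> powr (-1/2) \<le> h x" if x: "0 < \<bar>x\<bar>" "\<bar>x\<bar> < 1" for x
  proof -
    have hx: "h \<bar>x\<bar> = h x" using ev by (simp add: abs_if)
    show ?thesis
    proof (cases "\<bar>x\<bar> \<le> \<eta>")
      case True
      have "k * \<bar>x\<bar> powr (-1/2) \<le> \<eta> / 2 * \<bar>x\<bar> powr (-1/2)" using k2 by (intro mult_right_mono) auto
      then show ?thesis using main[OF x(1) True] hx by linarith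
    next
      case False
      then have "\<bar>x\<bar> powr (-1/2) \<le> \<eta> powr (-1/2)" using \<eta> by (intro powr_mono2') auto
      then have "k * \<bar>x\<bar> powr (-1/2) \<le> h 1 / \<eta> powr (-1/2) * \<eta> powr (-1/2)"
        using k h1 \<eta> by (intro mult_mono) (auto simp: k_def)
      also have "\<dots> = h 1" using \<eta> by simp
      also have "\<dots> \<le> h x" using exp_kernel_antimono'[OF h a, of x 1] x by simp
      finally show ?thesis .
    qed
  qed
  then show ?thesis using k by blast
qed

section \<open>Tempered inverse Fourier transforms\<close>

lemma integral_derivative_zero:
  fixes F f :: "real \<Rightarrow> complex"
  assumes F: "\<And>x. (F has_vector_derivative f x) (at x)" and f: "continuous_on UNIV f" "integrable lborel f"
    and lim: "(F \<longlongrightarrow> 0) at_top" "(F \<longlongrightarrow> 0) at_bot"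
  shows "(\<integral>x. f x \<partial>lborel) = 0"
proof -
  have "(LBINT x=-\<infinity>..\<infinity>. f x) = 0 - 0"
  proof (rule interval_integral_FTC_integrable[where F = F])
    show "((F \<circ> real_of_ereal) \<longlongrightarrow> 0) (at_right (- \<infinity>))" "((F \<circ> real_of_ereal) \<longlongrightarrow> 0) (at_left \<infinity>)"
      unfolding ereal_tendsto_simps using lim by auto
    show "set_integrable lborel (einterval (- \<infinity>) \<infinity>) f" using f by (simp add: set_integrable_def)
  qed (use F f in \<open>auto simp: continuous_on_eq_continuous_at\<close>)
  then show ?thesis by (simp add: interval_lebesgue_integral_def set_lebesgue_integral_def)
qed

lemma schwartz_decay:
  assumes "bounded (range (\<lambda>x::real. x ^ 0 *\<^sub>R f x :: complex))" "bounded (range (\<lambda>x. x ^ 2 *\<^sub>R f x))"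
  shows "\<exists>M>0. \<forall>x. norm (f x) \<le> M * (1 / (x\<^sup>2 + 1))"
proof -
  obtain a b where a: "\<And>x. norm (f x) \<le> a" and b: "\<And>x. norm (x ^ 2 *\<^sub>R f x) \<le> b"
    using assms unfolding bounded_iff by auto
  have "norm (f x) \<le> (\<bar>a\<bar> + \<bar>b\<bar> + 1) * (1 / (x\<^sup>2 + 1))" for x
  proof -
    have "norm (f x) * (x\<^sup>2 + 1) \<le> \<bar>a\<bar> + \<bar>b\<bar> + 1"
      using a[of x] b[of x] by (simp add: algebra_simps)
    moreover have "0 < x\<^sup>2 + 1" by (simp add: add_nonneg_pos)
    ultimately show ?thesis by (simp add: pos_le_divide_eq)
  qed
  moreover have "0 < \<bar>a\<bar> + \<bar>b\<bar> + 1" by simp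
  ultimately show ?thesis by blast
qed

lemma lorentz_majorized:
  fixes f :: "real \<Rightarrow> complex"
  assumes "f \<in> borel_measurable borel" and f: "\<And>x. norm (f x) \<le> M * (1 / (x\<^sup>2 + 1))"
  shows "integrable lborel f"
proof (rule Bochner_Integration.integrable_bound)
  show "integrable lborel (\<lambda>x. M * (1 / (x\<^sup>2 + 1)))"
    by (intro integrable_mult_right integrable_lorentz) simp
  show "AE x in lborel. norm (f x) \<le> norm (M * (1 / (x\<^sup>2 + 1)))"
    using f by (intro always_eventually allI) (smt (verit) real_norm_def)
qed (use assms in simp)

lemma lorentz_majorized_lim:
  fixes f :: "real \<Rightarrow> complex"
  assumes f: "\<And>x. norm (f x) \<le> M * (1 / (x\<^sup>2 + 1))"
  shows "(f \<longlongrightarrow> 0) at_top" "(f \<longlongrightarrow> 0) at_bot"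
proof -
  have "((\<lambda>x::real. M * (1 / (x\<^sup>2 + 1))) \<longlongrightarrow> 0) at_top" "((\<lambda>x::real. M * (1 / (x\<^sup>2 + 1))) \<longlongrightarrow> 0) at_bot"
    by real_asymp+
  from this[THEN Lim_null_comparison[OF always_eventually[OF allI[OF f]]]]
  show "(f \<longlongrightarrow> 0) at_top" "(f \<longlongrightarrow> 0) at_bot" .
qed

text \<open>Integrating by parts twice turns the second derivative into the factor
  \<open>- \<xi>\<^sup>2\<close> on the transform. Both transforms are bounded, so the one of
  \<open>\<phi>\<close> is at most a multiple of \<open>1 / (\<xi>\<^sup>2 + 1)\<close>.\<close>

lemma schwartz_fourier:
  assumes "schwartz \<phi>"
  shows schwartz_continuous: "continuous_on UNIV \<phi>"
    and schwartz_integrable: "integrable lborel \<phi>"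
    and schwartz_bounded: "\<exists>B. \<forall>x. norm (\<phi> x) \<le> B"
    and schwartz_fourier_integrable: "integrable lborel (\<lambda>\<xi>. \<integral>y. \<phi> y * iexp (\<xi> * y) \<partial>lborel)"
proof -
  obtain D where D0: "D 0 = \<phi>" and D: "\<And>k x. (D k has_vector_derivative D (Suc k) x) (at x)"
    and Db: "\<And>j k. bounded (range (\<lambda>x. x ^ j *\<^sub>R D k x))"
    using assms unfolding schwartz_def by auto
  have Dc: "continuous_on UNIV (D k)" for k
    using D by (auto simp: continuous_on_eq_continuous_at intro: has_vector_derivative_continuous)
  have [measurable]: "D k \<in> borel_measurable borel" for k
    by (rule borel_measurable_continuous_onI[OF Dc])
  have "\<exists>M. \<forall>k. M k > 0 \<and> (\<forall>x. norm (D k x) \<le> M k * (1 / (x\<^sup>2 + 1)))"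
    using schwartz_decay[OF Db Db] by (intro choice allI) blast
  then obtain M where M: "\<And>k. M k > 0" "\<And>k x. norm (D k x) \<le> M k * (1 / (x\<^sup>2 + 1))" by blast
  have Di: "integrable lborel (D k)" for k by (rule lorentz_majorized[OF _ M(2)]) measurable
  show "continuous_on UNIV \<phi>" "integrable lborel \<phi>" using Dc[of 0] Di[of 0] D0 by auto
  obtain B where B: "\<And>x. norm (\<phi> x) \<le> B" using Db[of 0 0] D0 by (auto simp: bounded_iff)
  then show "\<exists>B. \<forall>x. norm (\<phi> x) \<le> B" by blast
  define F where "F = (\<lambda>k \<xi>. \<integral>y. D k y * iexp (\<xi> * y) \<partial>lborel)"
  have Fi: "integrable lborel (\<lambda>y. D k y * iexp (\<xi> * y))" for k \<xi>
    by (rule Bochner_Integration.integrable_bound[OF Di[of k]]) (auto simp: norm_mult)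
  have F_le: "norm (F k \<xi>) \<le> (\<integral>y. norm (D k y) \<partial>lborel)" for k \<xi>
  proof -
    have "norm (F k \<xi>) \<le> (\<integral>y. norm (D k y * iexp (\<xi> * y)) \<partial>lborel)"
      unfolding F_def by (rule integral_norm_bound)
    then show ?thesis by (simp add: norm_mult)
  qed
  have F_Suc: "F (Suc k) \<xi> = - (\<i> * \<xi>) * F k \<xi>" for k \<xi>
  proof -
    have "(\<integral>y. D (Suc k) y * iexp (\<xi> * y) + \<i> * \<xi> * (D k y * iexp (\<xi> * y)) \<partial>lborel) = 0"
    proof (rule integral_derivative_zero[where F = "\<lambda>y. D k y * iexp (\<xi> * y)"])
      fix y
      have "((\<lambda>y. iexp (\<xi> * y)) has_vector_derivative \<i> * \<xi> * iexp (\<xi> * y)) (at y)"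
      proof -
        have "((\<lambda>z. exp (\<i> * (of_real \<xi> * z))) has_field_derivative \<i> * \<xi> * exp (\<i> * (of_real \<xi> * of_real y))) (at (of_real y))"
          by (auto intro!: derivative_eq_intros)
        from has_vector_derivative_real_field[OF this] show ?thesis by simp
      qed
      from has_vector_derivative_mult[OF D[of k y] this]
      show "((\<lambda>y. D k y * iexp (\<xi> * y)) has_vector_derivative D (Suc k) y * iexp (\<xi> * y) + \<i> * \<xi> * (D k y * iexp (\<xi> * y))) (at y)"
        by (simp add: algebra_simps)
    next
      show "continuous_on UNIV (\<lambda>y. D (Suc k) y * iexp (\<xi> * y) + \<i> * \<xi> * (D k y * iexp (\<xi> * y)))"
        by (intro continuous_intros Dc)
      show "integrable lborel (\<lambda>y. D (Suc k) y * iexp (\<xi> * y) + \<i> * \<xi> * (D k y * iexp (\<xi> * y)))"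
        by (intro Bochner_Integration.integrable_add integrable_mult_right Fi)
      show "((\<lambda>y. D k y * iexp (\<xi> * y)) \<longlongrightarrow> 0) at_top" "((\<lambda>y. D k y * iexp (\<xi> * y)) \<longlongrightarrow> 0) at_bot"
        using M(2)[of k] by (auto intro!: lorentz_majorized_lim[of _ "M k"] simp: norm_mult)
    qed
    also have "(\<integral>y. D (Suc k) y * iexp (\<xi> * y) + \<i> * \<xi> * (D k y * iexp (\<xi> * y)) \<partial>lborel) = F (Suc k) \<xi> + \<i> * \<xi> * F k \<xi>"
      unfolding F_def Bochner_Integration.integral_add[OF Fi integrable_mult_right[OF Fi]] integral_mult_right_zero ..
    finally show ?thesis by (simp add: add_eq_0_iff2)
  qed
  have F2: "F 2 \<xi> = - (of_real (\<xi>\<^sup>2) * F 0 \<xi>)" for \<xi>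
    using F_Suc[of 1 \<xi>] F_Suc[of 0 \<xi>] by (simp add: numeral_2_eq_2 power2_eq_square algebra_simps)
  define C where "C = (\<integral>y. norm (D 0 y) \<partial>lborel) + (\<integral>y. norm (D 2 y) \<partial>lborel)"
  have "norm (F 0 \<xi>) \<le> C * (1 / (\<xi>\<^sup>2 + 1))" for \<xi>
  proof -
    have "norm (F 2 \<xi>) = \<xi>\<^sup>2 * norm (F 0 \<xi>)" unfolding F2 by (simp add: norm_mult norm_power)
    then have "norm (F 0 \<xi>) * (\<xi>\<^sup>2 + 1) \<le> C"
      using F_le[of 0 \<xi>] F_le[of 2 \<xi>] by (simp add: C_def algebra_simps)
    moreover have "0 < \<xi>\<^sup>2 + 1" by (simp add: add_nonneg_pos)
    ultimately show ?thesis by (simp add: pos_le_divide_eq)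
  qed
  moreover have "F 0 \<in> borel_measurable borel" unfolding F_def by measurable
  ultimately have "integrable lborel (F 0)" by (intro lorentz_majorized)
  then show "integrable lborel (\<lambda>\<xi>. \<integral>y. \<phi> y * iexp (\<xi> * y) \<partial>lborel)"
    by (simp add: F_def D0)
qed

lemma inv_fourier_lborel:
  assumes "integrable lborel \<phi>"
  shows "inv_fourier \<phi> \<xi> = of_real (1 / sqrt (2 * pi)) * (\<integral>y. \<phi> y * iexp (\<xi> * y) \<partial>lborel)"
proof -
  have [measurable]: "\<phi> \<in> borel_measurable borel" using assms by auto
  show ?thesis unfolding inv_fourier_def by (subst integral_completion) auto
qed

text \<open>The symbol enters as the transform of the integrable \<open>h\<close>; after exchanging
  the integrals, the inversion formula is applied to the test function, where it holds
  pointwise.\<close>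

lemma fourier_pairing:
  assumes h: "integrable lborel h" and even: "\<And>x. h (- x) = h x"
    and f: "\<And>\<xi>. cos_transform h \<xi> = sqrt (2 * pi) * f \<xi>" and \<phi>: "schwartz \<phi>"
  shows "(\<integral>x. of_real (h x) * \<phi> x \<partial>lebesgue) = (\<integral>\<xi>. of_real (f \<xi>) * inv_fourier \<phi> \<xi> \<partial>lebesgue)"
proof -
  define F where "F = (\<lambda>\<xi>. \<integral>y. \<phi> y * iexp (\<xi> * y) \<partial>lborel)"
  note i = schwartz_integrable[OF \<phi>]
  have Fi: "integrable lborel F" unfolding F_def by (rule schwartz_fourier_integrable[OF \<phi>])
  obtain B where B: "\<And>x. norm (\<phi> x) \<le> B" using schwartz_bounded[OF \<phi>] by blast
  have [measurable]: "h \<in> borel_measurable borel" "\<phi> \<in> borel_measurable borel" "F \<in> borel_measurable borel"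
    using h i Fi by auto
  have ct: "cos_transform h \<in> borel_measurable borel" unfolding cos_transform_def by measurable
  have f_eq: "f \<xi> = cos_transform h \<xi> / sqrt (2 * pi)" for \<xi> by (simp add: f)
  have [measurable]: "f \<in> borel_measurable borel" unfolding f_eq[abs_def] using ct by measurable
  have inv_F: "inv_fourier \<phi> \<xi> = of_real (1 / sqrt (2 * pi)) * F \<xi>" for \<xi>
    unfolding F_def by (rule inv_fourier_lborel[OF i])
  have "(\<integral>\<xi>. of_real (f \<xi>) * inv_fourier \<phi> \<xi> \<partial>lebesgue) = (\<integral>\<xi>. of_real (f \<xi>) * (of_real (1 / sqrt (2 * pi)) * F \<xi>) \<partial>lborel)"
    unfolding inv_F by (rule integral_completion) measurable
  \<comment> \<open>The transform of \<open>h\<close> is even; passing to \<open>- \<xi>\<close>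
    gives the exponential the sign that the inversion formula expects.\<close>
  also have "\<dots> = (\<integral>\<xi>. of_real (1 / (2 * pi)) * (of_real (cos_transform h (- \<xi>)) * F \<xi>) \<partial>lborel)"
  proof (intro Bochner_Integration.integral_cong refl)
    fix \<xi>
    have "f \<xi> * (1 / sqrt (2 * pi)) = 1 / (2 * pi) * cos_transform h (- \<xi>)"
      by (simp add: f_eq cos_transform_def)
    then have "complex_of_real (f \<xi>) * of_real (1 / sqrt (2 * pi)) = of_real (1 / (2 * pi)) * of_real (cos_transform h (- \<xi>))"
      by (simp only: of_real_mult[symmetric])
    then show "of_real (f \<xi>) * (of_real (1 / sqrt (2 * pi)) * F \<xi>) = of_real (1 / (2 * pi)) * (of_real (cos_transform h (- \<xi>)) * F \<xi>)"
      by (simp only: mult.assoc[symmetric])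
  qed
  also have "\<dots> = of_real (1 / (2 * pi)) * (\<integral>\<xi>. of_real (cos_transform h (- \<xi>)) * F \<xi> \<partial>lborel)"
    by (rule integral_mult_right_zero)
  also have "(\<integral>\<xi>. of_real (cos_transform h (- \<xi>)) * F \<xi> \<partial>lborel) = (\<integral>\<xi>. (\<integral>x. of_real (h x) * F \<xi> * iexp (- \<xi> * x) \<partial>lborel) \<partial>lborel)"
    unfolding even_fourier_transform[OF h even, symmetric]
    by (simp add: mult_ac flip: integral_mult_left_zero integral_mult_right_zero)
  also have "\<dots> = (\<integral>x. (\<integral>\<xi>. of_real (h x) * F \<xi> * iexp (- \<xi> * x) \<partial>lborel) \<partial>lborel)"
  proof (rule lborel_pair.Fubini_integral)
    show "integrable (lborel \<Otimes>\<^sub>M lborel) (\<lambda>(x, \<xi>). of_real (h x) * F \<xi> * iexp (- \<xi> * x))"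
      using integrable_pair_mult[OF integrable_of_real[OF h] Fi, of "\<lambda>(x, \<xi>). iexp (- \<xi> * x)" 1] by simp
  qed
  also have "\<dots> = (\<integral>x. of_real (h x) * (2 * pi * \<phi> x) \<partial>lborel)"
  proof (intro Bochner_Integration.integral_cong refl)
    fix x
    have "(\<integral>\<xi>. of_real (h x) * F \<xi> * iexp (- \<xi> * x) \<partial>lborel) = of_real (h x) * (\<integral>\<xi>. F \<xi> * iexp (- \<xi> * x) \<partial>lborel)"
      by (simp only: mult.assoc integral_mult_right_zero)
    also have "(\<integral>\<xi>. F \<xi> * iexp (- \<xi> * x) \<partial>lborel) = 2 * pi * \<phi> x"
      unfolding F_def by (rule fourier_inversion[OF schwartz_continuous[OF \<phi>] B i schwartz_fourier_integrable[OF \<phi>]])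
    finally show "(\<integral>\<xi>. of_real (h x) * F \<xi> * iexp (- \<xi> * x) \<partial>lborel) = of_real (h x) * (2 * pi * \<phi> x)" .
  qed
  also have "of_real (1 / (2 * pi)) * \<dots> = (\<integral>x. of_real (h x) * \<phi> x \<partial>lborel)"
    by (subst integral_mult_right_zero[symmetric]) (simp add: mult_ac)
  also have "\<dots> = (\<integral>x. of_real (h x) * \<phi> x \<partial>lebesgue)"
    by (rule integral_completion[symmetric]) measurable
  finally show ?thesis by simp
qed

section \<open>Uniqueness of tempered inverse transforms\<close>

primrec gauss_poly :: "real \<Rightarrow> nat \<Rightarrow> complex poly" where
  "gauss_poly t 0 = 1"
| "gauss_poly t (Suc k) = pderiv (gauss_poly t k) + gauss_poly t k * [:\<i> * t, - 2:]"

text \<open>Induction over the coefficients: the new factor \<open>x\<close> is paid for with one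
  half of the rate, the shorter polynomial with the other half. The rate therefore has to be
  arbitrary in the induction hypothesis.\<close>

lemma norm_poly_le_exp:
  fixes p :: "complex poly" and s :: real
  assumes "s > 0"
  shows "\<exists>C\<ge>0. \<forall>x::real. norm (poly p (of_real x)) \<le> C * exp (s * \<bar>x\<bar>)"
  using assms
proof (induction p arbitrary: s)
  case 0
  then show ?case by (intro exI[of _ 0]) auto
next
  case (pCons a p)
  obtain C where C: "C \<ge> 0" "\<And>x::real. norm (poly p (of_real x)) \<le> C * exp (s / 2 * \<bar>x\<bar>)"
    using pCons.IH[of "s / 2"] pCons.prems by auto
  have "norm (poly (pCons a p) (of_real x)) \<le> (norm a + 2 / s * C) * exp (s * \<bar>x\<bar>)" for x :: real
  proof -
    have "norm (poly (pCons a p) (of_real x)) \<le> norm a + \<bar>x\<bar> * norm (poly p (of_real x))"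
      by (simp add: norm_triangle_le norm_mult)
    also have "\<dots> \<le> norm a * exp (s * \<bar>x\<bar>) + (2 / s * exp (s / 2 * \<bar>x\<bar>)) * (C * exp (s / 2 * \<bar>x\<bar>))"
    proof (rule add_mono)
      show "norm a \<le> norm a * exp (s * \<bar>x\<bar>)" using pCons.prems by (simp add: mult_le_cancel_left1)
      have "s / 2 * \<bar>x\<bar> \<le> exp (s / 2 * \<bar>x\<bar>)" using exp_ge_add_one_self[of "s / 2 * \<bar>x\<bar>"] by linarith
      then have "\<bar>x\<bar> \<le> 2 / s * exp (s / 2 * \<bar>x\<bar>)" using pCons.prems by (simp add: field_simps)
      then show "\<bar>x\<bar> * norm (poly p (of_real x)) \<le> (2 / s * exp (s / 2 * \<bar>x\<bar>)) * (C * exp (s / 2 * \<bar>x\<bar>))"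
        using C pCons.prems by (intro mult_mono) auto
    qed
    also have "(2 / s * exp (s / 2 * \<bar>x\<bar>)) * (C * exp (s / 2 * \<bar>x\<bar>)) = 2 / s * C * (exp (s / 2 * \<bar>x\<bar>) * exp (s / 2 * \<bar>x\<bar>))"
      by simp
    also have "exp (s / 2 * \<bar>x\<bar>) * exp (s / 2 * \<bar>x\<bar>) = exp (s * \<bar>x\<bar>)" by (simp flip: exp_add)
    finally show ?thesis by (simp add: algebra_simps)
  qed
  moreover have "0 \<le> norm a + 2 / s * C" using C pCons.prems by simp
  ultimately show ?case by blast
qed

text \<open>Modulated Gaussians are the test functions that reduce uniqueness to ordinary Fourier
  transforms. The derivative of order \<open>k\<close> is \<open>gauss_poly t k\<close> times the
  function itself; in its recursion \<open>[:\<i> * t, - 2:]\<close> is the derivative of the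
  exponent.\<close>

lemma schwartz_gaussian:
  fixes t :: real
  shows "schwartz (\<lambda>x. exp (- (of_real x)\<^sup>2 + \<i> * t * of_real x))"
proof -
  define D where "D = (\<lambda>k x. poly (gauss_poly t k) (of_real x) * exp (- (of_real x)\<^sup>2 + \<i> * t * of_real x :: complex))"
  have "(D k has_vector_derivative D (Suc k) x) (at x)" for k x
  proof -
    have "((\<lambda>z. poly (gauss_poly t k) z * exp (- z\<^sup>2 + \<i> * t * z)) has_field_derivative D (Suc k) x) (at (of_real x))"
      unfolding D_def by (auto intro!: derivative_eq_intros simp: algebra_simps)
    from has_vector_derivative_real_field[OF this] show ?thesis by (simp add: D_def)
  qed
  moreover have "bounded (range (\<lambda>x. x ^ j *\<^sub>R D k x))" for j k
  proof -
    obtain C where C: "C \<ge> 0" "\<And>x::real. norm (poly (monom 1 j * gauss_poly t k) (of_real x)) \<le> C * exp (1 * \<bar>x\<bar>)"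
      using norm_poly_le_exp[of 1 "monom 1 j * gauss_poly t k"] by auto
    have "norm (x ^ j *\<^sub>R D k x) \<le> C * exp 1" for x
    proof -
      have "norm (x ^ j *\<^sub>R D k x) = norm (poly (monom 1 j * gauss_poly t k) (of_real x)) * exp (- x\<^sup>2)"
        by (simp add: D_def norm_mult poly_monom norm_power power_abs power2_eq_square)
      also have "\<dots> \<le> C * exp (1 * \<bar>x\<bar>) * exp (- x\<^sup>2)" by (intro mult_right_mono C) simp
      also have "\<dots> = C * exp (\<bar>x\<bar> - x\<^sup>2)" by (simp add: exp_diff exp_minus divide_inverse)
      also have "\<dots> \<le> C * exp 1"
      proof -
        have "0 \<le> (\<bar>x\<bar> - 1)\<^sup>2 + \<bar>x\<bar>" by simp
        then have "\<bar>x\<bar> - x\<^sup>2 \<le> 1" by (simp add: power2_diff)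
        then show ?thesis using C by (intro mult_left_mono) auto
      qed
      finally show ?thesis .
    qed
    then show ?thesis by (auto simp: bounded_iff)
  qed
  moreover have "D 0 = (\<lambda>x. exp (- (of_real x)\<^sup>2 + \<i> * t * of_real x))" by (auto simp: D_def)
  ultimately show ?thesis unfolding schwartz_def by blast
qed

text \<open>The positive and negative parts have equal mass, by \<open>t = 0\<close>. Normalized,
  they are densities of two laws with the same characteristic function, which coincide by Levy's
  uniqueness theorem; mass 0 is a separate trivial case.\<close>

lemma fourier_injective:
  fixes k :: "real \<Rightarrow> real"
  assumes k: "integrable lborel k" and z: "\<And>t. (\<integral>x. of_real (k x) * iexp (t * x) \<partial>lborel) = 0"
  shows "AE x in lborel. k x = 0"
proof -
  define p where "p = (\<lambda>x. max (k x) 0)"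
  define n where "n = (\<lambda>x. max (- k x) 0)"
  have [measurable]: "k \<in> borel_measurable borel" using k by auto
  have [measurable]: "p \<in> borel_measurable borel" "n \<in> borel_measurable borel" unfolding p_def n_def by measurable
  have pi: "integrable lborel p" and ni: "integrable lborel n"
    by (rule Bochner_Integration.integrable_bound[OF k]; auto simp: p_def n_def)+
  have k_eq: "k x = p x - n x" for x by (simp add: p_def n_def)
  have pn0: "0 \<le> p x" "0 \<le> n x" for x by (auto simp: p_def n_def)
  have int1: "integrable lborel (\<lambda>x. complex_of_real (g x) * iexp (t * x))" if "integrable lborel g" for g :: "real \<Rightarrow> real" and t
  proof (rule Bochner_Integration.integrable_bound[OF that])
    have [measurable]: "g \<in> borel_measurable borel" using that by auto
    show "(\<lambda>x. complex_of_real (g x) * iexp (t * x)) \<in> borel_measurable lborel" by measurable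
  qed (auto simp: norm_mult)
  have eq: "(\<integral>x. of_real (p x) * iexp (t * x) \<partial>lborel) = (\<integral>x. of_real (n x) * iexp (t * x) \<partial>lborel)" for t
  proof -
    have "(\<integral>x. of_real (p x) * iexp (t * x) \<partial>lborel) - (\<integral>x. of_real (n x) * iexp (t * x) \<partial>lborel) = (\<integral>x. of_real (k x) * iexp (t * x) \<partial>lborel)"
      unfolding Bochner_Integration.integral_diff[OF int1[OF pi] int1[OF ni], symmetric]
      by (simp add: k_eq left_diff_distrib)
    then show ?thesis using z[of t] by simp
  qed
  define m where "m = (\<integral>x. p x \<partial>lborel)"
  have mn: "m = (\<integral>x. n x \<partial>lborel)"
    using eq[of 0] by (simp add: m_def)
  show ?thesis
  proof (cases "m = 0")
    case True
    then have "AE x in lborel. p x = 0" "AE x in lborel. n x = 0"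
      using integral_nonneg_eq_0_iff_AE[OF pi] integral_nonneg_eq_0_iff_AE[OF ni] mn pn0 by (auto simp: m_def)
    then show ?thesis by eventually_elim (simp add: k_eq)
  next
    case False
    moreover have "m \<ge> 0" unfolding m_def using pn0 by simp
    ultimately have m: "m > 0" by simp
    have dist: "real_distribution (density lborel (\<lambda>x. ennreal (g x / m)))"
      and ch: "char (density lborel (\<lambda>x. ennreal (g x / m))) t = of_real (1 / m) * (\<integral>x. of_real (g x) * iexp (t * x) \<partial>lborel)"
      if g: "integrable lborel g" "\<And>x. 0 \<le> g x" "(\<integral>x. g x \<partial>lborel) = m" for g t
    proof -
      have [measurable]: "g \<in> borel_measurable borel" using g by auto
      have "emeasure (density lborel (\<lambda>x. ennreal (g x / m))) UNIV = (\<integral>\<^sup>+x. ennreal (g x / m) \<partial>lborel)"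
        by (subst emeasure_density) auto
      also have "\<dots> = ennreal (\<integral>x. g x / m \<partial>lborel)"
        using g m by (intro nn_integral_eq_integral) auto
      also have "\<dots> = 1" using g m by simp
      finally have "prob_space (density lborel (\<lambda>x. ennreal (g x / m)))"
        by (intro prob_spaceI) simp
      then show "real_distribution (density lborel (\<lambda>x. ennreal (g x / m)))"
        by (simp add: real_distribution_def real_distribution_axioms_def)
      have "char (density lborel (\<lambda>x. ennreal (g x / m))) t = (\<integral>x. (g x / m) *\<^sub>R iexp (t * x) \<partial>lborel)"
        unfolding char_def using g m by (subst integral_density) auto
      also have "\<dots> = (\<integral>x. of_real (1 / m) * (of_real (g x) * iexp (t * x)) \<partial>lborel)"
        by (simp add: scaleR_conv_of_real)
      finally show "char (density lborel (\<lambda>x. ennreal (g x / m))) t = of_real (1 / m) * (\<integral>x. of_real (g x) * iexp (t * x) \<partial>lborel)"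
        by (simp only: integral_mult_right_zero)
    qed
    have "density lborel (\<lambda>x. ennreal (p x / m)) = density lborel (\<lambda>x. ennreal (n x / m))"
    proof (rule Levy_uniqueness)
      show "real_distribution (density lborel (\<lambda>x. ennreal (p x / m)))"
        by (rule dist[OF pi pn0(1) m_def[symmetric]])
      show "real_distribution (density lborel (\<lambda>x. ennreal (n x / m)))"
        by (rule dist[OF ni pn0(2) mn[symmetric]])
      show "char (density lborel (\<lambda>x. ennreal (p x / m))) = char (density lborel (\<lambda>x. ennreal (n x / m)))"
        by (intro ext) (simp only: ch[OF pi pn0(1) m_def[symmetric]] ch[OF ni pn0(2) mn[symmetric]] eq)
    qed
    then have "AE x in lborel. ennreal (p x / m) = ennreal (n x / m)"
      by (subst (asm) sigma_finite_measure.density_unique_iff) (auto simp: sigma_finite_lborel)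
    then show ?thesis
      by eventually_elim (use m pn0 in \<open>simp add: k_eq\<close>)
  qed
qed

lemma tempered_schwartz_integrable:
  assumes g: "tempered_fun g" and \<phi>: "schwartz \<phi>"
  shows "integrable lebesgue (\<lambda>x. g x * \<phi> x)"
proof -
  obtain N :: nat where N: "integrable lebesgue (\<lambda>x. g x / of_real ((1 + \<bar>x\<bar>) ^ N))"
    using g unfolding tempered_fun_def by blast
  obtain D where D0: "D 0 = \<phi>" and Db: "\<And>j k. bounded (range (\<lambda>x. x ^ j *\<^sub>R (D k x :: complex)))"
    using \<phi> unfolding schwartz_def by auto
  obtain a b where a: "\<And>x. norm (\<phi> x) \<le> a" and b: "\<And>x. norm (x ^ N *\<^sub>R \<phi> x) \<le> b"
    using Db[of 0 0] Db[of N 0] D0 unfolding bounded_iff by auto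
  have [measurable]: "\<phi> \<in> borel_measurable lebesgue"
    using borel_measurable_continuous_onI[OF schwartz_continuous[OF \<phi>]] by (intro measurable_completion) auto
  have bnd: "norm (of_real ((1 + \<bar>x\<bar>) ^ N) * \<phi> x) \<le> 2 ^ N * (a + b)" for x
  proof -
    have "(1 + \<bar>x\<bar>) ^ N \<le> (2 * max 1 \<bar>x\<bar>) ^ N" by (intro power_mono) auto
    also have "\<dots> \<le> 2 ^ N * (1 + \<bar>x\<bar> ^ N)" by (auto simp: power_mult_distrib max_def)
    finally have "(1 + \<bar>x\<bar>) ^ N * norm (\<phi> x) \<le> 2 ^ N * (1 + \<bar>x\<bar> ^ N) * norm (\<phi> x)"
      by (intro mult_right_mono) auto
    also have "\<dots> = 2 ^ N * (norm (\<phi> x) + norm (x ^ N *\<^sub>R \<phi> x))"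
      by (simp add: algebra_simps power_abs)
    also have "\<dots> \<le> 2 ^ N * (a + b)" using a[of x] b[of x] by (intro mult_left_mono add_mono) auto
    also have "(1 + \<bar>x\<bar>) ^ N = norm (complex_of_real ((1 + \<bar>x\<bar>) ^ N))"
      by (simp only: norm_of_real) simp
    finally show ?thesis by (simp only: norm_mult)
  qed
  have i1: "integrable lebesgue (\<lambda>x. (2 ^ N * (a + b)) *\<^sub>R (g x / of_real ((1 + \<bar>x\<bar>) ^ N)))"
    using N by (rule integrable_scaleR_right)
  have [measurable]: "(\<lambda>x. \<bar>x :: real\<bar>) \<in> borel_measurable lebesgue"
    by (intro measurable_completion) measurable
  have m1: "(\<lambda>x. g x / of_real ((1 + \<bar>x\<bar>) ^ N) * (of_real ((1 + \<bar>x\<bar>) ^ N) * \<phi> x)) \<in> borel_measurable lebesgue"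
    using borel_measurable_integrable[OF N] by measurable
  have eq: "g x / of_real ((1 + \<bar>x\<bar>) ^ N) * (of_real ((1 + \<bar>x\<bar>) ^ N) * \<phi> x) = g x * \<phi> x" for x
  proof -
    have "(1 + \<bar>x\<bar>) ^ N \<noteq> 0" by simp
    then have "complex_of_real ((1 + \<bar>x\<bar>) ^ N) \<noteq> 0" by (simp only: of_real_eq_0_iff not_False_eq_True)
    then show ?thesis by (simp del: of_real_power)
  qed
  have le: "norm (g x * \<phi> x) \<le> norm ((2 ^ N * (a + b)) *\<^sub>R (g x / of_real ((1 + \<bar>x\<bar>) ^ N)))" for x
  proof -
    have "norm (g x * \<phi> x) = norm (g x / of_real ((1 + \<bar>x\<bar>) ^ N)) * norm (of_real ((1 + \<bar>x\<bar>) ^ N) * \<phi> x)"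
      by (subst eq[symmetric]) (rule norm_mult)
    also have "\<dots> \<le> norm (g x / of_real ((1 + \<bar>x\<bar>) ^ N)) * \<bar>2 ^ N * (a + b)\<bar>"
      using bnd[of x] by (intro mult_left_mono) auto
    finally show ?thesis by (simp only: norm_scaleR mult.commute)
  qed
  show ?thesis
    by (rule Bochner_Integration.integrable_bound[OF i1 _ AE_I2[OF le]]) (use m1 in \<open>simp only: eq\<close>)
qed

text \<open>Both functions have the same pairing with every modulated Gaussian, so the Fourier
  transform of the integrable function \<open>(H1 x - H2 x) * exp (- x\<^sup>2)\<close> vanishes
  identically.\<close>

lemma tempered_inv_fourier_unique:
  assumes "is_tempered_inv_fourier f (\<lambda>x. of_real (H1 x))" "is_tempered_inv_fourier f (\<lambda>x. of_real (H2 x))"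
  shows "AE x in lebesgue. H1 x = (H2 x :: real)"
proof -
  define e where "e = (\<lambda>t x. exp (- (of_real x)\<^sup>2 + \<i> * complex_of_real t * of_real x))"
  have S: "schwartz (e t)" for t unfolding e_def by (rule schwartz_gaussian)
  have T: "tempered_fun (\<lambda>x. of_real (H1 x))" "tempered_fun (\<lambda>x. of_real (H2 x))"
    using assms by (auto simp: is_tempered_inv_fourier_def)
  define k where "k = (\<lambda>x. (H1 x - H2 x) * exp (- x\<^sup>2))"
  have k: "of_real (k x) * iexp (t * x) = of_real (H1 x) * e t x - of_real (H2 x) * e t x" for t x
  proof -
    have "e t x = of_real (exp (- x\<^sup>2)) * iexp (t * x)"
      unfolding e_def exp_add by (simp add: mult.assoc flip: exp_of_real)
    then show ?thesis by (simp add: k_def left_diff_distrib mult.assoc)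
  qed
  have i: "integrable lebesgue (\<lambda>x. complex_of_real (H1 x) * e t x)" "integrable lebesgue (\<lambda>x. complex_of_real (H2 x) * e t x)" for t
    by (rule tempered_schwartz_integrable[OF T(1) S], rule tempered_schwartz_integrable[OF T(2) S])
  have k_zero: "(\<integral>x. of_real (k x) * iexp (t * x) \<partial>lebesgue) = 0" for t
    unfolding k Bochner_Integration.integral_diff[OF i] using assms S by (simp add: is_tempered_inv_fourier_def)
  have "integrable lebesgue (\<lambda>x. complex_of_real (k x) * iexp (0 * x))"
    unfolding k by (rule Bochner_Integration.integrable_diff[OF i])
  then have k_int: "integrable lebesgue k" by (simp add: complex_of_real_integrable_eq)
  then have k_meas [measurable]: "k \<in> borel_measurable lebesgue" by auto
  \<comment> \<open>Injectivity is available over \<open>lborel\<close>, so the Lebesgue measurable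
    \<open>k\<close> is replaced by a Borel representative.\<close>
  from completion_ex_borel_measurable_real[OF this]
  obtain k' where k' [measurable]: "k' \<in> borel_measurable lborel" and kk': "AE x in lborel. k x = k' x" by blast
  have kk: "AE x in lebesgue. k x = k' x" by (rule AE_completion[OF kk'])
  have k'_leb [measurable]: "k' \<in> borel_measurable lebesgue" by (rule measurable_completion) (use k' in simp)
  have "integrable lebesgue k'" using k_int kk by (subst integrable_cong_AE[of k' _ k]) auto
  then have "integrable lborel k'" by (simp add: integrable_completion)
  moreover have "(\<integral>x. of_real (k' x) * iexp (t * x) \<partial>lborel) = 0" for t
  proof -
    have [measurable]: "(\<lambda>x. iexp (t * x)) \<in> borel_measurable lebesgue"
      by (intro measurable_completion) measurable
    have "(\<integral>x. of_real (k' x) * iexp (t * x) \<partial>lborel) = (\<integral>x. of_real (k' x) * iexp (t * x) \<partial>lebesgue)"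
      by (rule integral_completion[symmetric]) measurable
    also have "\<dots> = (\<integral>x. of_real (k x) * iexp (t * x) \<partial>lebesgue)"
    proof (rule integral_cong_AE)
      show "AE x in lebesgue. complex_of_real (k' x) * iexp (t * x) = of_real (k x) * iexp (t * x)"
        using kk by eventually_elim simp
    qed measurable
    finally show ?thesis using k_zero by simp
  qed
  ultimately have "AE x in lborel. k' x = 0" by (rule fourier_injective)
  then have "AE x in lebesgue. k' x = 0" by (rule AE_completion)
  with kk show ?thesis by eventually_elim (simp add: k_def)
qed

section \<open>Decay of solutions\<close>

lemma exp_kernel_lincomb:
  assumes g: "exp_kernel a E g" and h: "exp_kernel a F h" and c: "\<alpha> \<ge> 0" "\<beta> \<ge> 0"
  shows "exp_kernel a (\<lambda>\<xi>. \<alpha> * E \<xi> + \<beta> * F \<xi>) (\<lambda>x. \<alpha> * g x + \<beta> * h x)"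
  unfolding exp_kernel_def
proof (intro conjI allI impI)
  have gi: "integrable lborel g" and hi: "integrable lborel h" using g h by (auto simp: exp_kernel_def)
  show "integrable lborel (\<lambda>x. \<alpha> * g x + \<beta> * h x)"
    by (intro Bochner_Integration.integrable_add integrable_mult_right gi hi)
  have gn: "0 \<le> g x" "g (- x) = g x" and hn: "0 \<le> h x" "h (- x) = h x" for x
    by (rule exp_kernelD[OF g] exp_kernelD[OF h])+
  show "\<alpha> * g (- x) + \<beta> * h (- x) = \<alpha> * g x + \<beta> * h x" "0 \<le> \<alpha> * g x + \<beta> * h x" for x
    using gn hn c by simp_all
  show "\<alpha> * g (x + d) + \<beta> * h (x + d) \<le> exp (- a * d) * (\<alpha> * g x + \<beta> * h x)" if "x > 0" "d \<ge> 0" for x d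
  proof -
    have "g (x + d) \<le> exp (- a * d) * g x" "h (x + d) \<le> exp (- a * d) * h x"
      by (rule exp_kernelD[OF g] exp_kernelD[OF h], (rule that)+)+
    from add_mono[OF mult_left_mono[OF this(1) c(1)] mult_left_mono[OF this(2) c(2)]]
    show ?thesis by (simp add: algebra_simps)
  qed
  show "2 * (\<alpha> * g ((x + y) / 2) + \<beta> * h ((x + y) / 2)) \<le> s * (\<alpha> * g x + \<beta> * h x) + (\<alpha> * g y + \<beta> * h y) / s"
    if "x > 0" "y > 0" "s > 0" for x y s
  proof -
    have "2 * g ((x + y) / 2) \<le> s * g x + g y / s" "2 * h ((x + y) / 2) \<le> s * h x + h y / s"
      by (rule exp_kernelD[OF g] exp_kernelD[OF h], (rule that)+)+
    from add_mono[OF mult_left_mono[OF this(1) c(1)] mult_left_mono[OF this(2) c(2)]]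
    show ?thesis by (simp add: algebra_simps add_divide_distrib)
  qed
  fix \<xi>
  have "cos_transform (\<lambda>x. \<alpha> * g x + \<beta> * h x) \<xi> = (\<integral>x. \<alpha> * (g x * cos (\<xi> * x)) + \<beta> * (h x * cos (\<xi> * x)) \<partial>lborel)"
    by (simp add: cos_transform_def algebra_simps)
  also have "\<dots> = \<alpha> * cos_transform g \<xi> + \<beta> * cos_transform h \<xi>"
    unfolding cos_transform_def
    by (subst Bochner_Integration.integral_add) (auto intro!: integrable_mult_right integrable_mult_cos gi hi)
  also have "\<dots> = \<alpha> * E \<xi> + \<beta> * F \<xi>" using g h by (simp add: exp_kernel_def)
  finally show "cos_transform (\<lambda>x. \<alpha> * g x + \<beta> * h x) \<xi> = \<alpha> * E \<xi> + \<beta> * F \<xi>" .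
qed

text \<open>Where \<open>\<bar>x\<bar> \<le> 1\<close> the weight is at most \<open>exp e\<close>;
  beyond, the decay starting from \<open>h 1\<close> wins over the weight, as
  \<open>e < b\<close>.\<close>

lemma exp_kernel_weighted_integrable:
  assumes h: "exp_kernel b W h" and e: "0 \<le> e" "e < b"
  shows "integrable lborel (\<lambda>x. exp (e * \<bar>x\<bar>) * h x)"
proof -
  have hi: "integrable lborel h" and hn: "0 \<le> h x" for x using h by (auto simp: exp_kernel_def)
  have [measurable]: "h \<in> borel_measurable borel" using hi by auto
  show ?thesis
  proof (rule Bochner_Integration.integrable_bound)
    show "integrable lborel (\<lambda>x. exp e * h x + exp b * h 1 * exp (- (b - e) * \<bar>x\<bar>))"
      using e by (intro Bochner_Integration.integrable_add integrable_mult_right hi integrable_exp_abs) auto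
    show "AE x in lborel. norm (exp (e * \<bar>x\<bar>) * h x) \<le> norm (exp e * h x + exp b * h 1 * exp (- (b - e) * \<bar>x\<bar>))"
    proof (intro always_eventually allI)
      fix x :: real
      have "exp (e * \<bar>x\<bar>) * h x \<le> exp e * h x + exp b * h 1 * exp (- (b - e) * \<bar>x\<bar>)"
      proof (cases "\<bar>x\<bar> \<le> 1")
        case True
        then have "e * \<bar>x\<bar> \<le> e * 1" using e by (intro mult_left_mono) auto
        then have "exp (e * \<bar>x\<bar>) * h x \<le> exp e * h x" using hn by (intro mult_right_mono) auto
        moreover have "0 \<le> exp b * h 1 * exp (- (b - e) * \<bar>x\<bar>)" using hn by simp
        ultimately show ?thesis by linarith
      next
        case False
        then have "h x \<le> exp (- b * (\<bar>x\<bar> - \<bar>1\<bar>)) * h 1" using e by (intro exp_kernel_antimono[OF h]) auto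
        then have "exp (e * \<bar>x\<bar>) * h x \<le> exp (e * \<bar>x\<bar>) * (exp (- b * (\<bar>x\<bar> - \<bar>1\<bar>)) * h 1)" by (intro mult_left_mono) auto
        also have "\<dots> = exp (e * \<bar>x\<bar> + - b * (\<bar>x\<bar> - \<bar>1\<bar>)) * h 1" by (simp only: exp_add mult.assoc)
        also have "e * \<bar>x\<bar> + - b * (\<bar>x\<bar> - \<bar>1\<bar>) = b + - (b - e) * \<bar>x\<bar>" by (simp add: algebra_simps)
        also have "exp (b + - (b - e) * \<bar>x\<bar>) * h 1 = exp b * h 1 * exp (- (b - e) * \<bar>x\<bar>)" by (simp only: exp_add mult_ac)
        finally show ?thesis using mult_nonneg_nonneg[OF exp_ge_zero[of e] hn[of x]] by linarith
      qed
      moreover have "0 \<le> exp (e * \<bar>x\<bar>) * h x" using hn by simp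
      ultimately show "norm (exp (e * \<bar>x\<bar>) * h x) \<le> norm (exp e * h x + exp b * h 1 * exp (- (b - e) * \<bar>x\<bar>))"
        unfolding real_norm_def by linarith
    qed
  qed measurable
qed

lemma integrable_reflect_shift:
  fixes h :: "real \<Rightarrow> real"
  assumes "integrable lborel h"
  shows "integrable lborel (\<lambda>y. h (x - y))" "(\<integral>y. h (x - y) \<partial>lborel) = (\<integral>y. h y \<partial>lborel)"
  using lborel_integrable_real_affine[OF assms, of "-1" x] lborel_integral_real_affine[of "-1" h x] by auto

lemma integrable_conv_bounded:
  fixes h g :: "real \<Rightarrow> real"
  assumes h: "integrable lborel h" and g [measurable]: "g \<in> borel_measurable borel" and "AE y in lborel. \<bar>g y\<bar> \<le> B"
  shows "integrable lborel (\<lambda>y. h (x - y) * g y)"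
proof (rule Bochner_Integration.integrable_bound)
  have [measurable]: "h \<in> borel_measurable borel" using h by auto
  show "integrable lborel (\<lambda>y. B * h (x - y))"
    by (intro integrable_mult_right integrable_reflect_shift h)
  show "AE y in lborel. norm (h (x - y) * g y) \<le> norm (B * h (x - y))"
    using assms(3)
  proof eventually_elim
    case (elim y)
    then have "\<bar>h (x - y)\<bar> * \<bar>g y\<bar> \<le> \<bar>h (x - y)\<bar> * \<bar>B\<bar>" by (intro mult_left_mono) auto
    then show ?case by (simp add: abs_mult mult.commute)
  qed
  show "(\<lambda>y. h (x - y) * g y) \<in> borel_measurable lborel" by measurable
qed

text \<open>The kernel enters through a nonnegative part of rate \<open>b > \<delta>\<close> and a
  positive multiple of the exact exponential of rate \<open>\<delta>\<close>. The exponential gives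
  the lower bound on \<open>u\<close>; the gap between the two rates lets \<open>w\<close> be
  absorbed at rate \<open>\<delta>\<close> in the upper bound.\<close>

lemma solution_decay:
  fixes u :: "real \<Rightarrow> real"
  assumes w: "exp_kernel b W w" and \<delta>: "0 < \<delta>" "\<delta> < b" and A: "A > 0" and c: "c > 0"
  defines "H \<equiv> \<lambda>x. w x + A * exp (- \<delta> * \<bar>x\<bar>)"
  assumes u [measurable]: "u \<in> borel_measurable borel" and M: "AE x in lborel. \<bar>u x\<bar> \<le> M"
    and lim: "\<And>e. e > 0 \<Longrightarrow> \<exists>R. AE x in lborel. R \<le> \<bar>x\<bar> \<longrightarrow> \<bar>u x\<bar> \<le> e"
    and nz: "\<not> (AE x in lborel. u x = 0)"
    and eq: "AE x in lborel. u x * (c - u x) = (\<integral>y. H (x - y) * (u y)\<^sup>2 \<partial>lborel)"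
  shows "\<exists>k>0. AE x in lborel. k \<le> exp (\<delta> * \<bar>x\<bar>) * u x"
    and "\<exists>K. AE x in lborel. exp (\<delta> * \<bar>x\<bar>) * u x \<le> K"
    and "AE x in lborel. 0 < u x"
proof -
  have w_int: "integrable lborel w" and wn: "0 \<le> w x" for x using w by (auto simp: exp_kernel_def)
  have [measurable]: "w \<in> borel_measurable borel" using w_int by auto
  have H_int: "integrable lborel H"
    unfolding H_def using \<delta> w_int by (intro Bochner_Integration.integrable_add integrable_mult_right integrable_exp_abs)
  have [measurable]: "H \<in> borel_measurable borel" using H_int by auto
  have H_ge: "A * exp (- \<delta> * \<bar>x\<bar>) \<le> H x" for x unfolding H_def using wn[of x] by simp
  have H_nn: "0 \<le> H x" for x using H_ge[of x] A by (smt (verit) exp_gt_zero mult_pos_pos)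
  have M0: "0 \<le> M"
  proof (rule ccontr)
    assume "\<not> 0 \<le> M"
    then have "AE x in lborel. u x = 0" using M by (auto elim!: eventually_mono)
    then show False using nz by simp
  qed
  have u2_bnd: "AE y in lborel. \<bar>(u y)\<^sup>2\<bar> \<le> M\<^sup>2"
    using M by eventually_elim (simp add: abs_le_square_iff[symmetric])
  define G where "G = (\<lambda>x. \<integral>y. H (x - y) * (u y)\<^sup>2 \<partial>lborel)"
  have Hu_int: "integrable lborel (\<lambda>y. H (x - y) * (u y)\<^sup>2)" for x
    by (rule integrable_conv_bounded[OF H_int _ u2_bnd]) measurable
  have eu_int: "integrable lborel (\<lambda>y. exp (- \<delta> * \<bar>y\<bar>) * (u y)\<^sup>2)"
    using integrable_conv_bounded[OF integrable_exp_abs[OF \<delta>(1)] _ u2_bnd, of 0] by simp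
  define k0 where "k0 = (\<integral>y. exp (- \<delta> * \<bar>y\<bar>) * (u y)\<^sup>2 \<partial>lborel)"
  have k0: "k0 > 0"
  proof -
    have "k0 \<ge> 0" unfolding k0_def by simp
    moreover have "k0 \<noteq> 0"
    proof
      assume "k0 = 0"
      then have "AE y in lborel. exp (- \<delta> * \<bar>y\<bar>) * (u y)\<^sup>2 = 0"
        unfolding k0_def by (subst (asm) integral_nonneg_eq_0_iff_AE[OF eu_int]) auto
      then have "AE y in lborel. u y = 0" by eventually_elim simp
      then show False using nz by simp
    qed
    ultimately show ?thesis by simp
  qed
  \<comment> \<open>\<open>\<bar>x - y\<bar> \<le> \<bar>x\<bar> + \<bar>y\<bar>\<close> separates
    the variables, and the integral over \<open>y\<close> becomes the positive constant
    \<open>k0\<close>.\<close>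
  have G_ge: "A * k0 * exp (- \<delta> * \<bar>x\<bar>) \<le> G x" for x
  proof -
    have "A * exp (- \<delta> * \<bar>x\<bar>) * k0 = (\<integral>y. A * exp (- \<delta> * \<bar>x\<bar>) * (exp (- \<delta> * \<bar>y\<bar>) * (u y)\<^sup>2) \<partial>lborel)"
      unfolding k0_def by simp
    also have "\<dots> \<le> G x" unfolding G_def
    proof (rule integral_mono[OF integrable_mult_right[OF eu_int] Hu_int])
      fix y
      have "\<delta> * \<bar>x - y\<bar> \<le> \<delta> * (\<bar>x\<bar> + \<bar>y\<bar>)" using \<delta> by (intro mult_left_mono) auto
      then have "exp (- \<delta> * \<bar>x\<bar> + - \<delta> * \<bar>y\<bar>) \<le> exp (- \<delta> * \<bar>x - y\<bar>)" by (simp add: algebra_simps)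
      then have "A * (exp (- \<delta> * \<bar>x\<bar>) * exp (- \<delta> * \<bar>y\<bar>)) \<le> A * exp (- \<delta> * \<bar>x - y\<bar>)"
        using A by (simp only: exp_add mult_le_cancel_left_pos)
      also have "\<dots> \<le> H (x - y)" by (rule H_ge)
      finally have "A * (exp (- \<delta> * \<bar>x\<bar>) * exp (- \<delta> * \<bar>y\<bar>)) * (u y)\<^sup>2 \<le> H (x - y) * (u y)\<^sup>2"
        by (rule mult_right_mono) simp
      then show "A * exp (- \<delta> * \<bar>x\<bar>) * (exp (- \<delta> * \<bar>y\<bar>) * (u y)\<^sup>2) \<le> H (x - y) * (u y)\<^sup>2"
        by (simp only: mult.assoc)
    qed
    finally show ?thesis by (simp only: mult_ac)
  qed
  have eqG: "AE x in lborel. u x * (c - u x) = G x" using eq by (simp add: G_def)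
  have G_pos: "G x > 0" for x
    by (rule less_le_trans[OF _ G_ge[of x]]) (intro mult_pos_pos A k0 exp_gt_zero)
  \<comment> \<open>\<open>u x\<close> and \<open>c - u x\<close> have a positive product and the
    positive sum \<open>c\<close>, so both are positive.\<close>
  have u_range: "AE x in lborel. 0 < u x \<and> u x < c"
    using eqG
  proof eventually_elim
    case (elim x)
    then have "0 < u x * (c - u x)" using G_pos[of x] by simp
    then show ?case using c by (auto simp: zero_less_mult_iff)
  qed
  then show "AE x in lborel. 0 < u x" by eventually_elim simp
  show "\<exists>k>0. AE x in lborel. k \<le> exp (\<delta> * \<bar>x\<bar>) * u x"
  proof (intro exI conjI)
    show "A * k0 / c > 0" using A k0 c by simp
    show "AE x in lborel. A * k0 / c \<le> exp (\<delta> * \<bar>x\<bar>) * u x"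
      using eqG u_range
    proof eventually_elim
      case (elim x)
      have "u x * (c - u x) \<le> u x * c" using elim by (intro mult_left_mono) auto
      then have "A * k0 * exp (- \<delta> * \<bar>x\<bar>) \<le> u x * c" using G_ge[of x] elim by linarith
      then have "exp (\<delta> * \<bar>x\<bar>) * (A * k0 * exp (- \<delta> * \<bar>x\<bar>)) \<le> exp (\<delta> * \<bar>x\<bar>) * (u x * c)"
        by (intro mult_left_mono) auto
      also have "exp (\<delta> * \<bar>x\<bar>) * (A * k0 * exp (- \<delta> * \<bar>x\<bar>)) = A * k0" by (simp add: exp_minus)
      finally show ?case using c by (simp add: pos_divide_le_eq mult_ac)
    qed
  qed
  \<comment> \<open>Far out \<open>u x \<le> c / 2\<close>, so \<open>c - u x\<close> is at least
    \<open>c / 2\<close> and the equation turns into a linear bound of \<open>u\<close> by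
    \<open>G\<close>.\<close>
  have u_le_G: "\<exists>R. AE x in lborel. R \<le> \<bar>x\<bar> \<longrightarrow> u x \<le> 2 / c * G x \<and> u x \<le> e" if "e > 0" for e
  proof -
    have "0 < min e (c / 2)" using that c by simp
    from lim[OF this] obtain R where R: "AE x in lborel. R \<le> \<bar>x\<bar> \<longrightarrow> \<bar>u x\<bar> \<le> min e (c / 2)" ..
    have "AE x in lborel. R \<le> \<bar>x\<bar> \<longrightarrow> u x \<le> 2 / c * G x \<and> u x \<le> e"
      using R eqG u_range
    proof eventually_elim
      case (elim x)
      show ?case
      proof
        assume "R \<le> \<bar>x\<bar>"
        then have *: "u x \<le> c / 2" "u x \<le> e" using elim by auto
        then have "u x * (c / 2) \<le> u x * (c - u x)" using elim by (intro mult_left_mono) auto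
        then show "u x \<le> 2 / c * G x \<and> u x \<le> e" using elim * c by (simp add: field_simps)
      qed
    qed
    then show ?thesis by blast
  qed
  \<comment> \<open>Any rate strictly between \<open>\<delta> / 2\<close> and
    \<open>\<delta>\<close> would serve: below \<open>\<delta>\<close> the weighted kernel stays
    integrable, above \<open>\<delta> / 2\<close> the square of \<open>u\<close> decays faster than
    at the rate \<open>\<delta>\<close>.\<close>
  define \<eta> where "\<eta> = 2 * \<delta> / 3"
  have \<eta>: "0 < \<eta>" "\<eta> < \<delta>" using \<delta> by (auto simp: \<eta>_def)
  have "integrable lborel (\<lambda>x. exp (\<eta> * \<bar>x\<bar>) * w x + A * exp (- (\<delta> - \<eta>) * \<bar>x\<bar>))"
    using \<eta> \<delta> by (intro Bochner_Integration.integrable_add integrable_mult_right integrable_exp_abs exp_kernel_weighted_integrable[OF w]) auto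
  moreover have "exp (\<eta> * \<bar>x\<bar>) * w x + A * exp (- (\<delta> - \<eta>) * \<bar>x\<bar>) = exp (\<eta> * \<bar>x\<bar>) * H x" for x
    unfolding H_def by (simp add: algebra_simps flip: exp_add)
  ultimately have eH_int: "integrable lborel (\<lambda>x. exp (\<eta> * \<bar>x\<bar>) * H x)" by simp
  define Q where "Q = (\<integral>x. exp (\<eta> * \<bar>x\<bar>) * H x \<partial>lborel)"
  have Q0: "0 \<le> Q" unfolding Q_def using H_nn by simp
  \<comment> \<open>The size allowed to one of the two factors of \<open>u\<^sup>2\<close> far out;
    it makes the contraction factor \<open>2 / c * Q * e\<close> at most 1/2.\<close>
  define e where "e = c / (4 * (Q + 1))"
  have e: "e > 0" "2 / c * Q * e \<le> 1 / 2"
  proof -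
    show "e > 0" using c Q0 by (simp add: e_def)
    have "2 / c * Q * (c / (4 * q)) = Q / (2 * q)" if "q > 0" for q using c that by simp
    from this[of "Q + 1"] have "2 / c * Q * e = Q / (2 * (Q + 1))" using Q0 by (simp only: e_def)
    also have "\<dots> \<le> 1 / 2" using Q0 by (simp add: divide_le_eq)
    finally show "2 / c * Q * e \<le> 1 / 2" .
  qed
  obtain R where R: "AE x in lborel. R \<le> \<bar>x\<bar> \<longrightarrow> u x \<le> 2 / c * G x \<and> u x \<le> e"
    using u_le_G[OF e(1)] by blast
  define K1 where "K1 = 2 / c * Q * (exp (\<eta> * \<bar>R\<bar>) * M\<^sup>2) + exp (\<eta> * \<bar>R\<bar>) * M"
  have K1: "K1 \<ge> 0" unfolding K1_def using c Q0 M0 by (intro add_nonneg_nonneg mult_nonneg_nonneg) auto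
  \<comment> \<open>With the weight cut off at \<open>n\<close>, a finite initial bound is
    available. Each pass improves a bound \<open>B\<close> to \<open>B / 2 + K1\<close>, where
    \<open>K1\<close> does not depend on \<open>n\<close>.\<close>
  have step: "AE x in lborel. min (exp (\<eta> * \<bar>x\<bar>)) n * u x \<le> B / 2 + K1"
    if n: "n \<ge> 1" and B: "B \<ge> 0" and hyp: "AE x in lborel. min (exp (\<eta> * \<bar>x\<bar>)) n * u x \<le> B" for n B :: real
  proof -
    define v where "v = (\<lambda>x. min (exp (\<eta> * \<bar>x\<bar>)) n)"
    have v0: "0 \<le> v x" "v x \<le> exp (\<eta> * \<bar>x\<bar>)" for x using n by (auto simp: v_def)
    have v_sub: "v x \<le> exp (\<eta> * \<bar>x - y\<bar>) * v y" for x y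
    proof -
      have "\<eta> * \<bar>x\<bar> \<le> \<eta> * (\<bar>x - y\<bar> + \<bar>y\<bar>)" using \<eta> by (intro mult_left_mono) auto
      then have "exp (\<eta> * \<bar>x\<bar>) \<le> exp (\<eta> * \<bar>x - y\<bar>) * exp (\<eta> * \<bar>y\<bar>)" by (simp add: distrib_left flip: exp_add)
      moreover have "1 * n \<le> exp (\<eta> * \<bar>x - y\<bar>) * n" using \<eta> n by (intro mult_right_mono) auto
      ultimately show ?thesis unfolding v_def by (auto simp: min_def)
    qed
    define b' where "b' = e * B + exp (\<eta> * \<bar>R\<bar>) * M\<^sup>2"
    \<comment> \<open>Outside radius \<open>R\<close> one factor \<open>u\<close> carries the weight
      and the other is at most \<open>e\<close>; inside, both the weight and \<open>u\<close> are
      bounded.\<close>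
    have vu2: "AE y in lborel. v y * (u y)\<^sup>2 \<le> b'"
      using hyp R M u_range
    proof eventually_elim
      case (elim y)
      show ?case
      proof (cases "R \<le> \<bar>y\<bar>")
        case True
        have "v y * (u y)\<^sup>2 = (v y * u y) * u y" by (simp add: power2_eq_square)
        also have "\<dots> \<le> B * e" using elim True v0[of y] B by (intro mult_mono) (auto simp: v_def)
        finally show ?thesis unfolding b'_def by (simp add: mult.commute add_increasing2)
      next
        case False
        then have "\<eta> * \<bar>y\<bar> \<le> \<eta> * \<bar>R\<bar>" using \<eta> by (intro mult_left_mono) auto
        then have "v y \<le> exp (\<eta> * \<bar>R\<bar>)" using v0(2)[of y] by (smt (verit) exp_le_cancel_iff)
        moreover have "(u y)\<^sup>2 \<le> M\<^sup>2" using elim by (intro power_mono) auto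
        ultimately have "v y * (u y)\<^sup>2 \<le> exp (\<eta> * \<bar>R\<bar>) * M\<^sup>2" by (intro mult_mono) auto
        then show ?thesis unfolding b'_def using e B by (simp add: add_increasing)
      qed
    qed
    have vG: "v x * G x \<le> Q * b'" for x
    proof -
      have "v x * G x = (\<integral>y. v x * (H (x - y) * (u y)\<^sup>2) \<partial>lborel)" unfolding G_def by simp
      also have "\<dots> \<le> (\<integral>y. b' * (exp (\<eta> * \<bar>x - y\<bar>) * H (x - y)) \<partial>lborel)"
      proof (rule integral_mono_AE[OF integrable_mult_right[OF Hu_int]])
        show "integrable lborel (\<lambda>y. b' * (exp (\<eta> * \<bar>x - y\<bar>) * H (x - y)))"
          by (intro integrable_mult_right integrable_reflect_shift(1)[OF eH_int])
        show "AE y in lborel. v x * (H (x - y) * (u y)\<^sup>2) \<le> b' * (exp (\<eta> * \<bar>x - y\<bar>) * H (x - y))"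
          using vu2
        proof eventually_elim
          case (elim y)
          have "v x * (H (x - y) * (u y)\<^sup>2) \<le> (exp (\<eta> * \<bar>x - y\<bar>) * v y) * (H (x - y) * (u y)\<^sup>2)"
            using H_nn by (intro mult_right_mono v_sub) auto
          also have "\<dots> = (v y * (u y)\<^sup>2) * (exp (\<eta> * \<bar>x - y\<bar>) * H (x - y))" by (simp only: mult_ac)
          also have "\<dots> \<le> b' * (exp (\<eta> * \<bar>x - y\<bar>) * H (x - y))"
            using elim H_nn by (intro mult_right_mono) auto
          finally show ?case .
        qed
      qed
      also have "\<dots> = b' * Q" 
        unfolding Q_def integral_mult_right_zero by (subst integrable_reflect_shift(2)[OF eH_int]) simp
      finally show ?thesis by (simp add: mult.commute)
    qed
    show ?thesis
      using R M u_range
    proof eventually_elim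
      case (elim x)
      show ?case
      proof (cases "R \<le> \<bar>x\<bar>")
        case True
        have "v x * u x \<le> v x * (2 / c * G x)" using elim True v0[of x] by (intro mult_left_mono) auto
        also have "\<dots> = 2 / c * (v x * G x)" by simp
        also have "\<dots> \<le> 2 / c * (Q * b')" using c by (intro mult_left_mono vG) auto
        also have "\<dots> = (2 / c * Q * e) * B + 2 / c * Q * (exp (\<eta> * \<bar>R\<bar>) * M\<^sup>2)"
          unfolding b'_def by (simp add: algebra_simps)
        also have "\<dots> \<le> 1 / 2 * B + 2 / c * Q * (exp (\<eta> * \<bar>R\<bar>) * M\<^sup>2)"
          using mult_right_mono[OF e(2) B] by (rule add_right_mono)
        also have "\<dots> \<le> B / 2 + K1" unfolding K1_def using mult_nonneg_nonneg[OF exp_ge_zero M0] by simp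
        finally show ?thesis by (simp add: v_def)
      next
        case False
        then have "\<eta> * \<bar>x\<bar> \<le> \<eta> * \<bar>R\<bar>" using \<eta> by (intro mult_left_mono) auto
        then have "v x \<le> exp (\<eta> * \<bar>R\<bar>)" using v0(2)[of x] by (smt (verit) exp_le_cancel_iff)
        then have "v x * u x \<le> exp (\<eta> * \<bar>R\<bar>) * M" using elim by (intro mult_mono) auto
        moreover have "0 \<le> 2 / c * Q * (exp (\<eta> * \<bar>R\<bar>) * M\<^sup>2)" using c Q0 by (intro mult_nonneg_nonneg) auto
        ultimately have "v x * u x \<le> K1" unfolding K1_def by linarith
        then show ?thesis using B by (simp add: v_def)
      qed
    qed
  qed
  \<comment> \<open>The start \<open>n * M\<close> depends on \<open>n\<close>, but its contribution
    is halved in each pass; \<open>2 * K1\<close> is the fixed point of \<open>B / 2 + K1\<close>.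
    Letting \<open>j\<close> grow leaves a bound free of \<open>n\<close>.\<close>
  have iter: "AE x in lborel. min (exp (\<eta> * \<bar>x\<bar>)) n * u x \<le> n * M / 2 ^ j + 2 * K1" if n: "n \<ge> 1" for n :: real and j :: nat
  proof (induction j)
    case 0
    show ?case using M u_range
    proof eventually_elim
      case (elim x)
      then have "min (exp (\<eta> * \<bar>x\<bar>)) n * u x \<le> n * M" using n by (intro mult_mono) auto
      then show ?case using K1 by simp
    qed
  next
    case (Suc j)
    have "0 \<le> n * M / 2 ^ j + 2 * K1" using n M0 K1 by simp
    from step[OF n this Suc] show ?case by (simp add: field_simps)
  qed
  have bnd: "AE x in lborel. min (exp (\<eta> * \<bar>x\<bar>)) n * u x \<le> 2 * K1" if n: "n \<ge> 1" for n :: real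
  proof -
    have "AE x in lborel. \<forall>j. min (exp (\<eta> * \<bar>x\<bar>)) n * u x \<le> n * M / 2 ^ j + 2 * K1"
      using iter[OF n] by (simp add: AE_all_countable)
    then show ?thesis
    proof eventually_elim
      case (elim x)
      have "(\<lambda>j. n * M / 2 ^ j + 2 * K1) \<longlonglongrightarrow> 0 + 2 * K1"
        by (intro tendsto_add tendsto_const) real_asymp
      then show ?case using elim by (intro LIMSEQ_le_const[of "\<lambda>j. n * M / 2 ^ j + 2 * K1"]) auto
    qed
  qed
  \<comment> \<open>At a given \<open>x\<close> the cutoff is inactive once \<open>n\<close> exceeds
    \<open>exp (\<eta> * \<bar>x\<bar>)\<close>; integer levels keep the exceptional set a countable
    union of null sets.\<close>
  have decay: "AE x in lborel. exp (\<eta> * \<bar>x\<bar>) * u x \<le> 2 * K1"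
  proof -
    have "AE x in lborel. \<forall>j::nat. min (exp (\<eta> * \<bar>x\<bar>)) (real (Suc j)) * u x \<le> 2 * K1"
      using bnd by (simp add: AE_all_countable)
    then show ?thesis
    proof eventually_elim
      case (elim x)
      obtain j :: nat where "exp (\<eta> * \<bar>x\<bar>) < real j" using reals_Archimedean2 by blast
      then have "min (exp (\<eta> * \<bar>x\<bar>)) (real (Suc j)) = exp (\<eta> * \<bar>x\<bar>)" by (simp add: min_def)
      then show ?case using elim[rule_format, of j] by simp
    qed
  qed
  define V where "V = (\<integral>x. exp (\<delta> * \<bar>x\<bar>) * w x \<partial>lborel)"
  have V_int: "integrable lborel (\<lambda>x. exp (\<delta> * \<bar>x\<bar>) * w x)"
    using \<delta> by (intro exp_kernel_weighted_integrable[OF w]) auto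
  \<comment> \<open>This is \<open>2 * \<eta> - \<delta>\<close>, the decay that
    \<open>u\<^sup>2\<close> has to spare over the rate \<open>\<delta>\<close>.\<close>
  define d where "d = \<delta> / 3"
  have d: "d > 0" using \<delta> by (simp add: d_def)
  define K2 where "K2 = 4 * K1\<^sup>2 * (V + A * (\<integral>y. exp (- d * \<bar>y\<bar>) \<partial>lborel))"
  have eu2: "AE y in lborel. exp (\<delta> * \<bar>y\<bar>) * (u y)\<^sup>2 \<le> 4 * K1\<^sup>2 * exp (- d * \<bar>y\<bar>)"
    using decay u_range
  proof eventually_elim
    case (elim y)
    have "(exp (\<eta> * \<bar>y\<bar>) * u y)\<^sup>2 \<le> (2 * K1)\<^sup>2" using elim by (intro power_mono) auto
    then have "exp (- d * \<bar>y\<bar>) * (exp (\<eta> * \<bar>y\<bar>) * u y)\<^sup>2 \<le> exp (- d * \<bar>y\<bar>) * (2 * K1)\<^sup>2"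
      by (intro mult_left_mono) auto
    also have "exp (- d * \<bar>y\<bar>) * (exp (\<eta> * \<bar>y\<bar>) * u y)\<^sup>2 = exp (- d * \<bar>y\<bar> + (\<eta> * \<bar>y\<bar> + \<eta> * \<bar>y\<bar>)) * (u y)\<^sup>2"
      by (simp only: exp_add power2_eq_square mult_ac)
    also have "- d * \<bar>y\<bar> + (\<eta> * \<bar>y\<bar> + \<eta> * \<bar>y\<bar>) = \<delta> * \<bar>y\<bar>" by (simp add: d_def \<eta>_def field_simps)
    finally show ?case by (simp add: power_mult_distrib mult_ac)
  qed
  \<comment> \<open>Under the weight of rate \<open>\<delta>\<close> the exponential part of the
    kernel becomes the constant \<open>A\<close>, so integrability in \<open>y\<close> must come
    from \<open>u\<^sup>2\<close>; for \<open>w\<close> it comes from \<open>V_int\<close>.\<close>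
  have G_le: "exp (\<delta> * \<bar>x\<bar>) * G x \<le> K2" for x
  proof -
    have i1: "integrable lborel (\<lambda>y. exp (\<delta> * \<bar>x - y\<bar>) * w (x - y))" by (rule integrable_reflect_shift(1)[OF V_int])
    have i2: "integrable lborel (\<lambda>y. A * exp (- d * \<bar>y\<bar>))" by (intro integrable_mult_right integrable_exp_abs d)
    have "exp (\<delta> * \<bar>x\<bar>) * G x = (\<integral>y. exp (\<delta> * \<bar>x\<bar>) * (H (x - y) * (u y)\<^sup>2) \<partial>lborel)" unfolding G_def by simp
    also have "\<dots> \<le> (\<integral>y. 4 * K1\<^sup>2 * (exp (\<delta> * \<bar>x - y\<bar>) * w (x - y) + A * exp (- d * \<bar>y\<bar>)) \<partial>lborel)"
    proof (rule integral_mono_AE[OF integrable_mult_right[OF Hu_int]])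
      show "integrable lborel (\<lambda>y. 4 * K1\<^sup>2 * (exp (\<delta> * \<bar>x - y\<bar>) * w (x - y) + A * exp (- d * \<bar>y\<bar>)))"
        by (intro integrable_mult_right Bochner_Integration.integrable_add i1 integrable_exp_abs d)
      show "AE y in lborel. exp (\<delta> * \<bar>x\<bar>) * (H (x - y) * (u y)\<^sup>2) \<le> 4 * K1\<^sup>2 * (exp (\<delta> * \<bar>x - y\<bar>) * w (x - y) + A * exp (- d * \<bar>y\<bar>))"
        using eu2
      proof eventually_elim
        case (elim y)
        have "\<delta> * \<bar>x\<bar> \<le> \<delta> * (\<bar>x - y\<bar> + \<bar>y\<bar>)" using \<delta> by (intro mult_left_mono) auto
        then have "exp (\<delta> * \<bar>x\<bar>) \<le> exp (\<delta> * \<bar>x - y\<bar>) * exp (\<delta> * \<bar>y\<bar>)" by (simp add: distrib_left flip: exp_add)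
        then have "exp (\<delta> * \<bar>x\<bar>) * (H (x - y) * (u y)\<^sup>2) \<le> (exp (\<delta> * \<bar>x - y\<bar>) * exp (\<delta> * \<bar>y\<bar>)) * (H (x - y) * (u y)\<^sup>2)"
          using H_nn by (intro mult_right_mono) auto
        also have "\<dots> = (exp (\<delta> * \<bar>x - y\<bar>) * H (x - y)) * (exp (\<delta> * \<bar>y\<bar>) * (u y)\<^sup>2)" by (simp only: mult_ac)
        also have "\<dots> \<le> (exp (\<delta> * \<bar>x - y\<bar>) * H (x - y)) * (4 * K1\<^sup>2 * exp (- d * \<bar>y\<bar>))"
          using elim H_nn by (intro mult_left_mono) auto
        also have "exp (\<delta> * \<bar>x - y\<bar>) * H (x - y) = exp (\<delta> * \<bar>x - y\<bar>) * w (x - y) + A"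
          unfolding H_def by (simp add: distrib_left exp_minus)
        also have "(exp (\<delta> * \<bar>x - y\<bar>) * w (x - y) + A) * (4 * K1\<^sup>2 * exp (- d * \<bar>y\<bar>))
            = 4 * K1\<^sup>2 * (exp (\<delta> * \<bar>x - y\<bar>) * w (x - y) * exp (- d * \<bar>y\<bar>) + A * exp (- d * \<bar>y\<bar>))"
          by (simp add: algebra_simps)
        also have "\<dots> \<le> 4 * K1\<^sup>2 * (exp (\<delta> * \<bar>x - y\<bar>) * w (x - y) + A * exp (- d * \<bar>y\<bar>))"
          using wn d A by (intro mult_left_mono add_mono mult_left_le) auto
        finally show ?case .
      qed
    qed
    also have "\<dots> = K2"
      unfolding K2_def V_def integral_mult_right_zero Bochner_Integration.integral_add[OF i1 i2]
      by (subst integrable_reflect_shift(2)[OF V_int]) simp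
    finally show ?thesis .
  qed
  have "AE x in lborel. exp (\<delta> * \<bar>x\<bar>) * u x \<le> max (2 / c * K2) (exp (\<delta> * \<bar>R\<bar>) * M)"
    using R M u_range
  proof eventually_elim
    case (elim x)
    show ?case
    proof (cases "R \<le> \<bar>x\<bar>")
      case True
      have "exp (\<delta> * \<bar>x\<bar>) * u x \<le> exp (\<delta> * \<bar>x\<bar>) * (2 / c * G x)" using elim True by (intro mult_left_mono) auto
      also have "\<dots> = 2 / c * (exp (\<delta> * \<bar>x\<bar>) * G x)" by simp
      also have "\<dots> \<le> 2 / c * K2" using c by (intro mult_left_mono G_le) auto
      finally show ?thesis by simp
    next
      case False
      then have "\<delta> * \<bar>x\<bar> \<le> \<delta> * \<bar>R\<bar>" using \<delta> by (intro mult_left_mono) auto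
      then have "exp (\<delta> * \<bar>x\<bar>) * u x \<le> exp (\<delta> * \<bar>R\<bar>) * M" using elim by (intro mult_mono) auto
      then show ?thesis by simp
    qed
  qed
  then show "\<exists>K. AE x in lborel. exp (\<delta> * \<bar>x\<bar>) * u x \<le> K" by blast
qed

section \<open>The Whitham whitham_kernel\<close>

text \<open>The factor 2 is the one in front of \<open>S / (c\<^sup>2 - S)\<close> in the splitting
  of the symbol; \<open>sqrt (2 * pi)\<close> converts from \<open>cos_transform\<close> to the
  normalization of \<open>inv_fourier\<close>.\<close>

definition regular_part :: "real \<Rightarrow> real \<Rightarrow> real \<Rightarrow> real" where
  "regular_part c \<delta> x = sqrt (2 * pi) * branch_kernel c x + 2 * sqrt (2 * pi) * remainder_kernel \<delta> x"

definition regular_symbol :: "real \<Rightarrow> real \<Rightarrow> real \<Rightarrow> real" where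
  "regular_symbol c \<delta> \<xi> = sqrt (2 * pi) * (sqrt (tanhc \<xi>) / (c + sqrt (tanhc \<xi>)))
     + 2 * sqrt (2 * pi) * (tanhc \<xi> / (tan \<delta> / \<delta> - tanhc \<xi>) - residue_coeff \<delta> / (\<xi>\<^sup>2 + \<delta>\<^sup>2))"

lemma sqrt_tanhc_bounds:
  assumes "\<xi> \<noteq> 0"
  shows "sqrt (tanhc \<xi>) \<le> \<bar>\<xi>\<bar> powr (-1/2)"
    and "\<bar>\<xi>\<bar> \<ge> 1 \<Longrightarrow> sqrt (tanh 1) * \<bar>\<xi>\<bar> powr (-1/2) \<le> sqrt (tanhc \<xi>)"
proof -
  have p: "\<bar>\<xi>\<bar> powr (-1/2) = sqrt (1 / \<bar>\<xi>\<bar>)"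
    using assms by (simp add: powr_minus_divide powr_half_sqrt real_sqrt_divide)
  show "sqrt (tanhc \<xi>) \<le> \<bar>\<xi>\<bar> powr (-1/2)"
    unfolding p using tanhc_le[OF assms] by (rule real_sqrt_le_mono)
  assume "\<bar>\<xi>\<bar> \<ge> 1"
  then have "tanh 1 * (1 / \<bar>\<xi>\<bar>) \<le> tanhc \<xi>"
    using tanhc_ge[OF assms] by (simp add: min_def split: if_splits)
  then have "sqrt (tanh 1 * (1 / \<bar>\<xi>\<bar>)) \<le> sqrt (tanhc \<xi>)" by (rule real_sqrt_le_mono)
  then show "sqrt (tanh 1) * \<bar>\<xi>\<bar> powr (-1/2) \<le> sqrt (tanhc \<xi>)"
    unfolding p real_sqrt_mult .
qed

context
  fixes c \<delta> :: real
  assumes c: "c > 1" and \<delta>: "0 < \<delta>" "\<delta> < pi / 2" and c\<delta>: "sqrt (tan \<delta> / \<delta>) = c"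
begin

lemma tan_div_eq: "tan \<delta> / \<delta> = c\<^sup>2"
proof -
  have "0 \<le> tan \<delta> / \<delta>" using tan_div_gt_tanhc[OF \<delta>, of 0] by simp
  then show ?thesis using c\<delta> by (metis real_sqrt_pow2)
qed

lemma exp_kernel_regular: "exp_kernel (pi / 2) (regular_symbol c \<delta>) (regular_part c \<delta>)"
  unfolding regular_part_def[abs_def] regular_symbol_def[abs_def]
  by (rule exp_kernel_lincomb[OF exp_kernel_branch[OF c] exp_kernel_remainder(1)[OF \<delta>]]) auto

text \<open>Written in the form of the final statement. Its origin is that
  \<open>polar_coeff * exp (- \<delta> * \<bar>x\<bar>)\<close> must have the transform \<open>2 *
  sqrt (2 * pi) * (residue_coeff \<delta> / (\<xi>\<^sup>2 + \<delta>\<^sup>2))\<close>.\<close>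

definition polar_coeff :: real where
  "polar_coeff = sqrt (2 * pi) * (2 * tan \<delta> * \<delta> / (\<delta> * (1 / cos \<delta>)\<^sup>2 - tan \<delta>))"

lemma polar_coeff_eq: "polar_coeff = sqrt (2 * pi) * (residue_coeff \<delta> / \<delta>)"
proof -
  have "residue_coeff \<delta> / \<delta> = 2 * tan \<delta> * \<delta> / (\<delta> * (1 / cos \<delta>)\<^sup>2 - tan \<delta>)"
    using \<delta> by (simp add: residue_coeff_def power3_eq_cube)
  then show ?thesis by (simp add: polar_coeff_def)
qed

lemma polar_coeff_pos: "polar_coeff > 0"
  unfolding polar_coeff_eq using residue_coeff_pos[OF \<delta>] \<delta> by simp

definition whitham_kernel :: "real \<Rightarrow> real" where
  "whitham_kernel x = regular_part c \<delta> x + polar_coeff * exp (- \<delta> * \<bar>x\<bar>)"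

lemma integrable_whitham_kernel: "integrable lborel whitham_kernel"
  unfolding whitham_kernel_def using \<delta> exp_kernelD(1)[OF exp_kernel_regular]
  by (intro Bochner_Integration.integrable_add integrable_mult_right integrable_exp_abs)

text \<open>The exponential restores exactly the pole that \<open>remainder_kernel\<close> leaves
  out; the rest is the algebraic splitting of the symbol, with
  \<open>tan \<delta> / \<delta>\<close> equal to \<open>c\<^sup>2\<close>.\<close>

lemma cos_transform_whitham_kernel:
  "cos_transform whitham_kernel \<xi> = sqrt (2 * pi) * (whitham_symbol \<xi> / (c - whitham_symbol \<xi>))"
proof -
  have i: "integrable lborel (\<lambda>x. exp (- \<delta> * \<bar>x\<bar>))" using \<delta> by (intro integrable_exp_abs)
  have "cos_transform whitham_kernel \<xi> = (\<integral>x. regular_part c \<delta> x * cos (\<xi> * x) + polar_coeff * (exp (- \<delta> * \<bar>x\<bar>) * cos (\<xi> * x)) \<partial>lborel)"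
    by (simp add: cos_transform_def whitham_kernel_def algebra_simps)
  also have "\<dots> = cos_transform (regular_part c \<delta>) \<xi> + polar_coeff * cos_transform (\<lambda>x. exp (- \<delta> * \<bar>x\<bar>)) \<xi>"
    unfolding cos_transform_def integral_mult_right_zero[symmetric]
    by (rule Bochner_Integration.integral_add[OF integrable_mult_cos[OF exp_kernelD(1)[OF exp_kernel_regular]]
          integrable_mult_right[OF integrable_mult_cos[OF i]]])
  also have "\<dots> = regular_symbol c \<delta> \<xi> + polar_coeff * (2 * \<delta> / (\<xi>\<^sup>2 + \<delta>\<^sup>2))"
    using \<delta> by (simp only: cos_transform_exp_abs exp_kernelD(4)[OF exp_kernel_regular])
  also have "polar_coeff * (2 * \<delta> / (\<xi>\<^sup>2 + \<delta>\<^sup>2)) = 2 * sqrt (2 * pi) * (residue_coeff \<delta> / (\<xi>\<^sup>2 + \<delta>\<^sup>2))"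
    unfolding polar_coeff_eq using \<delta> by simp
  also have "regular_symbol c \<delta> \<xi> + \<dots> = sqrt (2 * pi) * (sqrt (tanhc \<xi>) / (c + sqrt (tanhc \<xi>)) + 2 * (tanhc \<xi> / (c\<^sup>2 - tanhc \<xi>)))"
    unfolding regular_symbol_def tan_div_eq by (simp add: algebra_simps)
  also have "sqrt (tanhc \<xi>) / (c + sqrt (tanhc \<xi>)) + 2 * (tanhc \<xi> / (c\<^sup>2 - tanhc \<xi>)) = sqrt (tanhc \<xi>) / (c - sqrt (tanhc \<xi>))"
  proof -
    define m where "m = sqrt (tanhc \<xi>)"
    have m: "0 < m" "m < c" "tanhc \<xi> = m\<^sup>2"
      unfolding m_def using tanhc_pos[of \<xi>] tanhc_le_1[of \<xi>] c by (auto intro: le_less_trans[of _ 1])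
    have "c\<^sup>2 - m\<^sup>2 = (c - m) * (c + m)" by (simp add: power2_eq_square algebra_simps)
    then have "m / (c + m) + 2 * (m\<^sup>2 / (c\<^sup>2 - m\<^sup>2)) = m / (c - m)"
      using m by (simp add: divide_simps) (simp add: power2_eq_square algebra_simps)
    then show ?thesis using m by (simp flip: m_def)
  qed
  finally show ?thesis by (simp add: whitham_symbol_eq)
qed

lemma is_whitham_kernel_whitham_kernel: "is_whitham_kernel c whitham_kernel"
  unfolding is_whitham_kernel_def is_tempered_inv_fourier_def
proof (intro conjI allI impI)
  have wb: "0 < whitham_symbol \<xi>" "whitham_symbol \<xi> \<le> 1" for \<xi>
    unfolding whitham_symbol_eq using tanhc_pos[of \<xi>] tanhc_le_1[of \<xi>] by auto
  have [measurable]: "whitham_symbol \<in> borel_measurable borel"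
    unfolding whitham_symbol_eq[abs_def] by measurable
  \<comment> \<open>The symbol is bounded by \<open>1 / (c - 1)\<close>, so the exponent 2 suffices
    for it; the kernel is integrable itself and takes the exponent 0.\<close>
  let ?g = "\<lambda>\<xi>. complex_of_real (whitham_symbol \<xi> / (c - whitham_symbol \<xi>)) / of_real ((1 + \<bar>\<xi>\<bar>) ^ 2)"
  have "integrable lborel ?g"
  proof (rule lorentz_majorized[where M = "1 / (c - 1)"])
    show "norm (?g \<xi>) \<le> 1 / (c - 1) * (1 / (\<xi>\<^sup>2 + 1))" for \<xi>
    proof -
      have "norm (?g \<xi>) = whitham_symbol \<xi> / (c - whitham_symbol \<xi>) * (1 / (1 + \<bar>\<xi>\<bar>)\<^sup>2)"
        using wb[of \<xi>] c by (simp add: norm_divide norm_mult norm_power flip: of_real_add of_real_diff of_real_divide)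
      also have "\<dots> \<le> 1 / (c - 1) * (1 / (\<xi>\<^sup>2 + 1))"
      proof (rule mult_mono)
        show "whitham_symbol \<xi> / (c - whitham_symbol \<xi>) \<le> 1 / (c - 1)"
          using wb[of \<xi>] c by (intro frac_le) auto
        have "\<xi>\<^sup>2 + 1 \<le> (1 + \<bar>\<xi>\<bar>)\<^sup>2" by (simp add: power2_eq_square algebra_simps)
        then show "1 / (1 + \<bar>\<xi>\<bar>)\<^sup>2 \<le> 1 / (\<xi>\<^sup>2 + 1)"
          by (intro frac_le) (auto simp: add_nonneg_pos)
      qed (use c in auto)
      finally show ?thesis .
    qed
  qed measurable
  then have "integrable lebesgue ?g" by (subst integrable_completion) auto
  then show "tempered_fun (\<lambda>\<xi>. complex_of_real (whitham_symbol \<xi> / (c - whitham_symbol \<xi>)))"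
    unfolding tempered_fun_def by blast
  have "integrable lborel (\<lambda>x. complex_of_real (whitham_kernel x) / of_real ((1 + \<bar>x\<bar>) ^ 0))"
    using integrable_whitham_kernel by simp
  then have "integrable lebesgue (\<lambda>x. complex_of_real (whitham_kernel x) / of_real ((1 + \<bar>x\<bar>) ^ 0))"
    by (subst integrable_completion) auto
  then show "tempered_fun (\<lambda>x. complex_of_real (whitham_kernel x))"
    unfolding tempered_fun_def by blast
  have even: "whitham_kernel (- x) = whitham_kernel x" for x
    by (simp add: whitham_kernel_def exp_kernelD(2)[OF exp_kernel_regular])
  show "(\<integral>x. complex_of_real (whitham_kernel x) * \<phi> x \<partial>lebesgue)
     = (\<integral>\<xi>. complex_of_real (whitham_symbol \<xi> / (c - whitham_symbol \<xi>)) * inv_fourier \<phi> \<xi> \<partial>lebesgue)"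
    if "schwartz \<phi>" for \<phi>
    by (rule fourier_pairing[OF integrable_whitham_kernel even cos_transform_whitham_kernel that])
qed

text \<open>With \<open>m = sqrt (tanhc \<xi>)\<close>, which lies between 0 and 1, the summand from
  \<open>m / (c + m)\<close> has the exact order of \<open>m\<close>. The remainder is nonnegative
  and at most a multiple of the square of \<open>m\<close>, hence of \<open>m\<close>, so it spoils
  neither bound.\<close>

lemma regular_symbol_bounds:
  shows regular_symbol_nonneg: "0 \<le> regular_symbol c \<delta> \<xi>"
    and regular_symbol_upper: "\<exists>C. \<forall>\<xi>. \<xi> \<noteq> 0 \<longrightarrow> regular_symbol c \<delta> \<xi> \<le> C * \<bar>\<xi>\<bar> powr (-1/2)"
    and regular_symbol_lower: "\<exists>C>0. \<forall>\<xi>. \<bar>\<xi>\<bar> \<ge> 1 \<longrightarrow> C * \<bar>\<xi>\<bar> powr (-1/2) \<le> regular_symbol c \<delta> \<xi>"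
proof -
  have m: "0 < sqrt (tanhc \<xi>)" "sqrt (tanhc \<xi>) \<le> 1" for \<xi> using tanhc_pos[of \<xi>] tanhc_le_1[of \<xi>] by auto
  have rem: "0 \<le> 2 * sqrt (2 * pi) * (tanhc \<xi> / (tan \<delta> / \<delta> - tanhc \<xi>) - residue_coeff \<delta> / (\<xi>\<^sup>2 + \<delta>\<^sup>2))" for \<xi>
    using remainder_symbol_nonneg[OF \<delta>, of \<xi>] by (intro mult_nonneg_nonneg) auto
  have c2: "1 < c\<^sup>2" using c by (simp add: one_less_power)
  have ge: "sqrt (2 * pi) * (sqrt (tanhc \<xi>) / (c + 1)) \<le> regular_symbol c \<delta> \<xi>" for \<xi>
  proof -
    have "sqrt (tanhc \<xi>) / (c + 1) \<le> sqrt (tanhc \<xi>) / (c + sqrt (tanhc \<xi>))"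
      by (intro divide_left_mono mult_pos_pos) (use m[of \<xi>] c in linarith)+
    then have "sqrt (2 * pi) * (sqrt (tanhc \<xi>) / (c + 1)) \<le> sqrt (2 * pi) * (sqrt (tanhc \<xi>) / (c + sqrt (tanhc \<xi>)))"
      by (intro mult_left_mono) auto
    then show ?thesis unfolding regular_symbol_def using rem[of \<xi>] by linarith
  qed
  have "0 \<le> sqrt (2 * pi) * (sqrt (tanhc \<xi>) / (c + 1))" using m[of \<xi>] c by simp
  then show "0 \<le> regular_symbol c \<delta> \<xi>" using ge[of \<xi>] by linarith
  show "\<exists>C>0. \<forall>\<xi>. \<bar>\<xi>\<bar> \<ge> 1 \<longrightarrow> C * \<bar>\<xi>\<bar> powr (-1/2) \<le> regular_symbol c \<delta> \<xi>"
  proof (intro exI[of _ "sqrt (2 * pi) * (sqrt (tanh 1) / (c + 1))"] conjI allI impI)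
    show "0 < sqrt (2 * pi) * (sqrt (tanh 1) / (c + 1))" using c by simp
    fix \<xi> :: real assume \<xi>: "\<bar>\<xi>\<bar> \<ge> 1"
    then have "sqrt (tanh 1) * \<bar>\<xi>\<bar> powr (-1/2) \<le> sqrt (tanhc \<xi>)" by (intro sqrt_tanhc_bounds) auto
    then have "sqrt (2 * pi) * (sqrt (tanh 1) * \<bar>\<xi>\<bar> powr (-1/2) / (c + 1)) \<le> sqrt (2 * pi) * (sqrt (tanhc \<xi>) / (c + 1))"
      using c by (intro mult_left_mono divide_right_mono) auto
    with ge[of \<xi>] have "sqrt (2 * pi) * (sqrt (tanh 1) * \<bar>\<xi>\<bar> powr (-1/2) / (c + 1)) \<le> regular_symbol c \<delta> \<xi>" by linarith
    then show "sqrt (2 * pi) * (sqrt (tanh 1) / (c + 1)) * \<bar>\<xi>\<bar> powr (-1/2) \<le> regular_symbol c \<delta> \<xi>"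
      by (simp only: times_divide_eq_left times_divide_eq_right mult.assoc)
  qed
  have upper: "regular_symbol c \<delta> \<xi> \<le> (sqrt (2 * pi) / c + 2 * sqrt (2 * pi) / (c\<^sup>2 - 1)) * \<bar>\<xi>\<bar> powr (-1/2)" if "\<xi> \<noteq> 0" for \<xi>
  proof -
    define p where "p = \<bar>\<xi>\<bar> powr (-1/2)"
    have p: "sqrt (tanhc \<xi>) \<le> p" "0 \<le> p" unfolding p_def using sqrt_tanhc_bounds(1)[OF that] by auto
    have "sqrt (tanhc \<xi>) * sqrt (tanhc \<xi>) \<le> sqrt (tanhc \<xi>) * 1" using m[of \<xi>] by (intro mult_left_mono) auto
    then have tp: "tanhc \<xi> \<le> p" using p tanhc_pos[of \<xi>] by simp
    have 1: "sqrt (tanhc \<xi>) / (c + sqrt (tanhc \<xi>)) \<le> p / c"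
      by (intro frac_le) (use p m[of \<xi>] c in linarith)+
    have 2: "tanhc \<xi> / (c\<^sup>2 - tanhc \<xi>) \<le> p / (c\<^sup>2 - 1)"
      using p tp tanhc_le_1[of \<xi>] tanhc_pos[of \<xi>] c2 by (intro frac_le) auto
    have "0 \<le> residue_coeff \<delta> / (\<xi>\<^sup>2 + \<delta>\<^sup>2)" using residue_coeff_pos[OF \<delta>] by simp
    then have "tanhc \<xi> / (c\<^sup>2 - tanhc \<xi>) - residue_coeff \<delta> / (\<xi>\<^sup>2 + \<delta>\<^sup>2) \<le> p / (c\<^sup>2 - 1)" using 2 by linarith
    then have "regular_symbol c \<delta> \<xi> \<le> sqrt (2 * pi) * (p / c) + 2 * sqrt (2 * pi) * (p / (c\<^sup>2 - 1))"
      unfolding regular_symbol_def tan_div_eq using 1 by (intro add_mono mult_left_mono) auto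
    also have "\<dots> = (sqrt (2 * pi) / c + 2 * sqrt (2 * pi) / (c\<^sup>2 - 1)) * p" by (simp add: algebra_simps)
    finally show ?thesis unfolding p_def .
  qed
  then show "\<exists>C. \<forall>\<xi>. \<xi> \<noteq> 0 \<longrightarrow> regular_symbol c \<delta> \<xi> \<le> C * \<bar>\<xi>\<bar> powr (-1/2)" by blast
qed

section \<open>The profile v near the origin and at infinity\<close>

definition whitham_profile :: "real \<Rightarrow> real" where
  "whitham_profile x = exp (\<delta> * \<bar>x\<bar>) * regular_part c \<delta> x"

lemma whitham_kernel_eq_profile: "whitham_kernel x = exp (- \<delta> * \<bar>x\<bar>) * (whitham_profile x + polar_coeff)"
  by (simp add: whitham_kernel_def whitham_profile_def distrib_left mult.assoc[symmetric] flip: exp_add)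

lemma whitham_profile_even: "whitham_profile (- x) = whitham_profile x"
  by (simp add: whitham_profile_def exp_kernelD(2)[OF exp_kernel_regular])

text \<open>Where \<open>\<bar>x\<bar> < 1\<close> the weight lies between 1 and
  \<open>exp \<delta>\<close>, so both bounds on \<open>regular_part\<close> carry over. The origin
  is left out because \<open>0 powr (- 1 / 2)\<close> is 0.\<close>

lemma whitham_profile_simeq: "simeq_on {x. 0 < \<bar>x\<bar> \<and> \<bar>x\<bar> < 1} whitham_profile (\<lambda>x. \<bar>x\<bar> powr (- 1 / 2))"
proof -
  note k = exp_kernel_regular
  obtain C where C: "\<And>\<xi>. \<xi> \<noteq> 0 \<Longrightarrow> regular_symbol c \<delta> \<xi> \<le> C * \<bar>\<xi>\<bar> powr (-1/2)"
    using regular_symbol_upper by blast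
  obtain C' where C': "C' > 0" "\<And>\<xi>. \<bar>\<xi>\<bar> \<ge> 1 \<Longrightarrow> C' * \<bar>\<xi>\<bar> powr (-1/2) \<le> regular_symbol c \<delta> \<xi>"
    using regular_symbol_lower by blast
  obtain K where K: "K > 0" "\<And>x. x \<noteq> 0 \<Longrightarrow> regular_part c \<delta> x \<le> K * \<bar>x\<bar> powr (-1/2)"
    using exp_kernel_upper_bound[OF k _ C] by (metis pi_half_ge_zero)
  obtain k' where k': "k' > 0" "\<And>x. 0 < \<bar>x\<bar> \<and> \<bar>x\<bar> < 1 \<Longrightarrow> k' * \<bar>x\<bar> powr (-1/2) \<le> regular_part c \<delta> x"
    using exp_kernel_lower_bound[OF k _ K C'(2) regular_symbol_nonneg C'(1)] by (metis pi_half_ge_zero)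
  show ?thesis
    unfolding simeq_on_def
  proof (intro conjI)
    show "\<exists>C>0. \<forall>x\<in>{x. 0 < \<bar>x\<bar> \<and> \<bar>x\<bar> < 1}. whitham_profile x \<le> C * \<bar>x\<bar> powr (- 1 / 2)"
    proof (intro exI[of _ "exp \<delta> * K"] conjI ballI)
      fix x assume "x \<in> {x :: real. 0 < \<bar>x\<bar> \<and> \<bar>x\<bar> < 1}"
      then have x: "x \<noteq> 0" "\<bar>x\<bar> \<le> 1" by auto
      have "exp (\<delta> * \<bar>x\<bar>) \<le> exp (\<delta> * 1)" using x \<delta> by (simp add: mult_left_le)
      then have "whitham_profile x \<le> exp (\<delta> * 1) * (K * \<bar>x\<bar> powr (-1/2))"
        unfolding whitham_profile_def using K(2)[OF x(1)] exp_kernelD(3)[OF k] by (intro mult_mono) auto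
      then show "whitham_profile x \<le> exp \<delta> * K * \<bar>x\<bar> powr (- 1 / 2)" by simp
    qed (use K in simp)
    show "\<exists>C>0. \<forall>x\<in>{x. 0 < \<bar>x\<bar> \<and> \<bar>x\<bar> < 1}. \<bar>x\<bar> powr (- 1 / 2) \<le> C * whitham_profile x"
    proof (intro exI[of _ "1 / k'"] conjI ballI)
      fix x assume x: "x \<in> {x :: real. 0 < \<bar>x\<bar> \<and> \<bar>x\<bar> < 1}"
      have "1 * regular_part c \<delta> x \<le> whitham_profile x"
        unfolding whitham_profile_def using \<delta> exp_kernelD(3)[OF k, of x] by (intro mult_right_mono) auto
      then have "k' * \<bar>x\<bar> powr (-1/2) \<le> whitham_profile x" using k'(2)[of x] x by auto
      then show "\<bar>x\<bar> powr (- 1 / 2) \<le> 1 / k' * whitham_profile x" using k'(1) by (simp add: field_simps)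
    qed (use k' in simp)
  qed
qed

text \<open>The rate \<open>pi / 2\<close> of the regular part exceeds the growth
  \<open>\<delta>\<close> of the weight; the surplus \<open>e\<close> gives an exponential majorant
  off the unit interval, which settles all exponents at once.\<close>

lemma whitham_profile_Lp:
  assumes p: "1 \<le> p"
  shows "whitham_profile \<in> Lp p (lebesgue_on {x. \<bar>x\<bar> \<ge> 1})"
proof -
  note k = exp_kernel_regular
  define e where "e = pi / 2 - \<delta>"
  define C where "C = exp (pi / 2) * regular_part c \<delta> 1"
  have e: "e > 0" using \<delta> by (simp add: e_def)
  have C: "C \<ge> 0" unfolding C_def using exp_kernelD(3)[OF k, of 1] by simp
  have pn: "0 \<le> whitham_profile x" for x unfolding whitham_profile_def using exp_kernelD(3)[OF k, of x] by simp
  have bnd: "whitham_profile x \<le> C * exp (- e * \<bar>x\<bar>)" if "\<bar>x\<bar> \<ge> 1" for x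
  proof -
    have "regular_part c \<delta> x \<le> exp (- (pi / 2) * (\<bar>x\<bar> - \<bar>1\<bar>)) * regular_part c \<delta> 1"
      using that by (intro exp_kernel_antimono[OF k]) auto
    then have "whitham_profile x \<le> exp (\<delta> * \<bar>x\<bar>) * (exp (- (pi / 2) * (\<bar>x\<bar> - \<bar>1\<bar>)) * regular_part c \<delta> 1)"
      unfolding whitham_profile_def by (intro mult_left_mono) auto
    also have "\<dots> = exp (\<delta> * \<bar>x\<bar> + - (pi / 2) * (\<bar>x\<bar> - \<bar>1\<bar>)) * regular_part c \<delta> 1" by (simp only: exp_add mult.assoc)
    also have "\<delta> * \<bar>x\<bar> + - (pi / 2) * (\<bar>x\<bar> - \<bar>1\<bar>) = pi / 2 + - e * \<bar>x\<bar>" by (simp add: e_def field_simps)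
    also have "exp (pi / 2 + - e * \<bar>x\<bar>) * regular_part c \<delta> 1 = C * exp (- e * \<bar>x\<bar>)" by (simp only: C_def exp_add mult_ac)
    finally show ?thesis .
  qed
  have [measurable]: "regular_part c \<delta> \<in> borel_measurable borel" using exp_kernelD(1)[OF k] by auto
  have pm: "whitham_profile \<in> borel_measurable borel" unfolding whitham_profile_def[abs_def] by measurable
  then have "whitham_profile \<in> borel_measurable lebesgue" by (intro measurable_completion) simp
  then have m: "whitham_profile \<in> borel_measurable (lebesgue_on {x. \<bar>x\<bar> \<ge> 1})" by (rule measurable_restrict_space1)
  show ?thesis
  proof (cases "p = \<infinity>")
    case True
    have "esssup (lebesgue_on {x. \<bar>x\<bar> \<ge> 1}) (\<lambda>x. ereal \<bar>whitham_profile x\<bar>) \<le> ereal C"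
    proof (rule esssup_I)
      show "AE x in lebesgue_on {x. \<bar>x\<bar> \<ge> 1}. ereal \<bar>whitham_profile x\<bar> \<le> ereal C"
      proof (rule AE_I2)
        fix x :: real assume "x \<in> space (lebesgue_on {x. \<bar>x\<bar> \<ge> 1})"
        then have "whitham_profile x \<le> C * exp (- e * \<bar>x\<bar>)" using bnd by simp
        also have "\<dots> \<le> C * 1" using C e by (intro mult_left_mono) auto
        finally show "ereal \<bar>whitham_profile x\<bar> \<le> ereal C" using pn[of x] by simp
      qed
    qed (use m in measurable)
    then have "esssup (lebesgue_on {x. \<bar>x\<bar> \<ge> 1}) (\<lambda>x. ereal \<bar>whitham_profile x\<bar>) < \<infinity>"
      by (rule le_less_trans) simp
    then show ?thesis unfolding Lp_def using True m by simp
  next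
    case False
    define q where "q = enn2real p"
    have q: "q > 0" unfolding q_def using p False
      by (auto simp: enn2real_positive_iff top.not_eq_extremum intro: less_le_trans[of 0 1])
    have S: "{x :: real. \<bar>x\<bar> \<ge> 1} \<in> sets borel" by measurable
    have "(\<integral>\<^sup>+ x. ennreal (\<bar>whitham_profile x\<bar> powr q) \<partial>lebesgue_on {x. \<bar>x\<bar> \<ge> 1})
        = (\<integral>\<^sup>+ x. ennreal (\<bar>whitham_profile x\<bar> powr q) * indicator {x. \<bar>x\<bar> \<ge> 1} x \<partial>lebesgue)"
      using S by (subst nn_integral_restrict_space) (auto intro: sets_completionI_sets)
    also have "\<dots> \<le> (\<integral>\<^sup>+ x. ennreal (C powr q * exp (- (e * q) * \<bar>x\<bar>)) \<partial>lebesgue)"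
    proof (rule nn_integral_mono)
      fix x :: real
      show "ennreal (\<bar>whitham_profile x\<bar> powr q) * indicator {x. \<bar>x\<bar> \<ge> 1} x \<le> ennreal (C powr q * exp (- (e * q) * \<bar>x\<bar>))"
      proof (cases "\<bar>x\<bar> \<ge> 1")
        case True
        have "\<bar>whitham_profile x\<bar> powr q \<le> (C * exp (- e * \<bar>x\<bar>)) powr q"
          using bnd[OF True] pn[of x] q by (intro powr_mono2) auto
        also have "\<dots> = C powr q * exp (- (e * q) * \<bar>x\<bar>)"
          using C by (simp add: powr_mult powr_def[of "exp _"] mult_ac)
        finally show ?thesis using True by (simp add: ennreal_leI)
      qed simp
    qed
    also have "\<dots> = (\<integral>\<^sup>+ x. ennreal (C powr q * exp (- (e * q) * \<bar>x\<bar>)) \<partial>lborel)"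
      by (rule nn_integral_completion)
    also have "\<dots> = ennreal (\<integral>x. C powr q * exp (- (e * q) * \<bar>x\<bar>) \<partial>lborel)"
      using e q by (intro nn_integral_eq_integral integrable_mult_right integrable_exp_abs) auto
    also have "\<dots> < \<infinity>" by simp
    finally show ?thesis unfolding Lp_def using False m by (simp add: q_def)
  qed
qed

end

section \<open>From Lebesgue to Borel representatives\<close>

lemma AE_lebesgue_reflect:
  fixes P :: "real \<Rightarrow> bool"
  assumes "AE z in lebesgue. P z" shows "AE y in lebesgue. P (x - y)"
proof -
  have m: "(\<lambda>y. x + (-1) * y) \<in> lebesgue \<rightarrow>\<^sub>M lebesgue"
    using lebesgue_affine_measurable[where c = "\<lambda>_::real. -1" and t = x] by simp
  have "lebesgue = density (distr lebesgue lebesgue (\<lambda>y. x + (-1) * y)) (\<lambda>_. ennreal \<bar>-1\<bar>)"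
    by (rule lebesgue_real_affine) simp
  also have "\<dots> = distr lebesgue lebesgue (\<lambda>y. x + (-1) * y)"
    by (simp add: density_1)
  finally have "(AE z in lebesgue. P z) \<longleftrightarrow> (AE z in distr lebesgue lebesgue (\<lambda>y. x + (-1) * y). P z)"
    by (rule arg_cong)
  then have "AE z in distr lebesgue lebesgue (\<lambda>y. x + (-1) * y). P z" using assms by (rule iffD1)
  from AE_distrD[OF m this] show ?thesis by simp
qed

lemma tempered_fun_measurable:
  assumes "tempered_fun (\<lambda>x. complex_of_real (h x))"
  shows "h \<in> borel_measurable lebesgue"
proof -
  obtain N :: nat where N: "integrable lebesgue (\<lambda>x. complex_of_real (h x) / of_real ((1 + \<bar>x\<bar>) ^ N))"
    using assms unfolding tempered_fun_def by blast
  have [measurable]: "(\<lambda>x. \<bar>x :: real\<bar>) \<in> borel_measurable lebesgue"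
    by (intro measurable_completion) measurable
  have "(\<lambda>x. Re (complex_of_real (h x) / of_real ((1 + \<bar>x\<bar>) ^ N)) * (1 + \<bar>x\<bar>) ^ N) \<in> borel_measurable lebesgue"
    using borel_measurable_integrable[OF N] by measurable
  moreover have "Re (complex_of_real (h x) / of_real ((1 + \<bar>x\<bar>) ^ N)) * (1 + \<bar>x\<bar>) ^ N = h x" for x
  proof -
    have "(1 + \<bar>x\<bar>) ^ N \<noteq> 0" by simp
    then show ?thesis by (simp only: of_real_divide[symmetric] Re_complex_of_real) simp
  qed
  ultimately show ?thesis by simp
qed

lemma Lp_infinityD:
  assumes "u \<in> Lp \<infinity> M"
  shows "\<exists>B. AE x in M. \<bar>u x\<bar> \<le> B"
proof -
  have "esssup M (\<lambda>x. ereal \<bar>u x\<bar>) < \<infinity>" using assms by (simp add: Lp_def)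
  then obtain n :: nat where n: "esssup M (\<lambda>x. ereal \<bar>u x\<bar>) < ereal (real n)"
    using less_PInf_Ex_of_nat by auto
  have "AE x in M. ereal \<bar>u x\<bar> \<le> esssup M (\<lambda>x. ereal \<bar>u x\<bar>)" by (rule esssup_AE)
  then have "AE x in M. \<bar>u x\<bar> \<le> real n"
  proof eventually_elim
    case (elim x)
    then have "ereal \<bar>u x\<bar> \<le> ereal (real n)" using n by (rule order_trans[OF _ less_imp_le])
    then show ?case by simp
  qed
  then show ?thesis by blast
qed

text \<open>Reflection and translation preserve null sets, so for each fixed \<open>x\<close> both
  factors may be replaced by Borel representatives; the equality holds at every \<open>x\<close>,
  not only almost everywhere.\<close>

lemma fun_convolution_cong_AE:
  assumes "AE x in lebesgue. H x = H' x" and H: "H \<in> borel_measurable lebesgue" and H': "H' \<in> borel_measurable borel"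
    and g: "g \<in> borel_measurable lebesgue" and g': "g' \<in> borel_measurable borel" and gg': "AE x in lebesgue. g x = g' x"
  shows "fun_convolution H g x = (\<integral>y. H' (x - y) * g' y \<partial>lborel)"
proof -
  have [measurable]: "H' \<in> borel_measurable borel" "g' \<in> borel_measurable borel" "g \<in> borel_measurable lebesgue" by fact+
  have [measurable]: "(\<lambda>y. H (x - y)) \<in> borel_measurable lebesgue"
    using borel_measurable_affine[OF H, of "-1" x] by simp
  have m: "(\<lambda>y. H' (x - y) * g' y) \<in> borel_measurable lborel" by measurable
  have "fun_convolution H g x = (\<integral>y. H' (x - y) * g' y \<partial>lebesgue)"
    unfolding fun_convolution_def
  proof (rule integral_cong_AE)
    show "AE y in lebesgue. H (x - y) * g y = H' (x - y) * g' y"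
      using AE_lebesgue_reflect[OF assms(1), of x] gg' by eventually_elim simp
    show "(\<lambda>y. H' (x - y) * g' y) \<in> borel_measurable lebesgue" by (rule measurable_completion[OF m])
  qed measurable
  also have "\<dots> = (\<integral>y. H' (x - y) * g' y \<partial>lborel)" by (rule integral_completion[OF m])
  finally show ?thesis .
qed

text \<open>A function between two positive constants is essentially bounded, but its finite powers
  are bounded below on a space of infinite measure and have infinite integral.\<close>

lemma Lp_iff_infinity:
  fixes f :: "real \<Rightarrow> real"
  assumes f: "f \<in> borel_measurable lebesgue" and k: "k > 0" "AE x in lebesgue. k \<le> f x" and K: "AE x in lebesgue. f x \<le> K" 
    and p: "1 \<le> p"
  shows "f \<in> Lp p lebesgue \<longleftrightarrow> p = \<infinity>"
proof
  assume "p = \<infinity>"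
  have "esssup lebesgue (\<lambda>x. ereal \<bar>f x\<bar>) \<le> ereal K"
  proof (rule esssup_I)
    show "AE x in lebesgue. ereal \<bar>f x\<bar> \<le> ereal K" using k(2) K by eventually_elim (use k(1) in auto)
  qed (use f in measurable)
  then have "esssup lebesgue (\<lambda>x. ereal \<bar>f x\<bar>) < \<infinity>" by (rule le_less_trans) simp
  then show "f \<in> Lp p lebesgue" using f \<open>p = \<infinity>\<close> by (simp add: Lp_def)
next
  assume *: "f \<in> Lp p lebesgue"
  show "p = \<infinity>"
  proof (rule ccontr)
    assume "p \<noteq> \<infinity>"
    define q where "q = enn2real p"
    have fin: "(\<integral>\<^sup>+ x. ennreal (\<bar>f x\<bar> powr q) \<partial>lebesgue) < \<infinity>"
      using * \<open>p \<noteq> \<infinity>\<close> by (simp add: Lp_def q_def)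
    have q: "q \<ge> 0" by (simp add: q_def)
    have "(\<infinity> :: ennreal) = (\<integral>\<^sup>+ x. ennreal (k powr q) \<partial>(lebesgue :: real measure))"
      using k(1) by (simp add: nn_integral_completion ennreal_mult_top)
    also have "\<dots> \<le> (\<integral>\<^sup>+ x. ennreal (\<bar>f x\<bar> powr q) \<partial>lebesgue)"
    proof (rule nn_integral_mono_AE)
      show "AE x in lebesgue. ennreal (k powr q) \<le> ennreal (\<bar>f x\<bar> powr q)"
        using k(2) by eventually_elim (use k(1) q in \<open>auto intro!: ennreal_leI powr_mono2\<close>)
    qed
    finally show False using fin by simp
  qed
qed

text \<open>The transform fixes \<open>H\<close> only up to null sets, so the claims are made for
  every representative, and the existence clause keeps them from being vacuous. Positivity of the
  regular part and of the polar coefficient is what links the description of the kernel to the decay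
  of solutions.\<close>

theorem theorem6p2:
  fixes c \<delta> :: real
  assumes "c > 1"
    and "0 < \<delta>" and "\<delta> < pi / 2"
    and "sqrt (tan \<delta> / \<delta>) = c"
  shows "(\<exists>H. is_whitham_kernel c H) \<and>
    (\<forall>H. is_whitham_kernel c H \<longrightarrow>
      (\<exists>v :: real \<Rightarrow> real.
         (AE x in lebesgue. H x = exp (- \<delta> * \<bar>x\<bar>) *
            (v x + sqrt (2 * pi) *
               (2 * tan \<delta> * \<delta> / (\<delta> * (1 / cos \<delta>)\<^sup>2 - tan \<delta>)))) \<and>
         (\<forall>x. v (- x) = v x) \<and>
         (\<forall>p. 1 \<le> p \<longrightarrow> v \<in> Lp p (lebesgue_on {x. \<bar>x\<bar> \<ge> 1})) \<and>
         simeq_on {x. 0 < \<bar>x\<bar> \<and> \<bar>x\<bar> < 1} v (\<lambda>x. \<bar>x\<bar> powr (- 1 / 2))) \<and>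
      (\<forall>u :: real \<Rightarrow> real.
         u \<in> Lp \<infinity> lebesgue \<longrightarrow>
         (u \<longlongrightarrow> 0) at_infinity \<longrightarrow>
         \<not> (AE x in lebesgue. u x = 0) \<longrightarrow>
         (AE x in lebesgue. u x * (c - u x) = fun_convolution H (\<lambda>y. (u y)\<^sup>2) x) \<longrightarrow>
         (\<forall>p. 1 \<le> p \<longrightarrow>
            ((\<lambda>x. exp (\<delta> * \<bar>x\<bar>) * u x) \<in> Lp p lebesgue \<longleftrightarrow> p = \<infinity>))))"
proof (intro conjI allI impI)
  let ?K = "whitham_kernel c \<delta>"
  have K: "is_whitham_kernel c ?K" by (rule is_whitham_kernel_whitham_kernel[OF assms])
  then show "\<exists>H. is_whitham_kernel c H" by blast
  fix H assume H: "is_whitham_kernel c H"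
  have HK: "AE x in lebesgue. H x = ?K x"
    using tempered_inv_fourier_unique H K unfolding is_whitham_kernel_def by blast
  show "\<exists>v. (AE x in lebesgue. H x = exp (- \<delta> * \<bar>x\<bar>) *
            (v x + sqrt (2 * pi) * (2 * tan \<delta> * \<delta> / (\<delta> * (1 / cos \<delta>)\<^sup>2 - tan \<delta>)))) \<and>
         (\<forall>x. v (- x) = v x) \<and>
         (\<forall>p. 1 \<le> p \<longrightarrow> v \<in> Lp p (lebesgue_on {x. \<bar>x\<bar> \<ge> 1})) \<and>
         simeq_on {x. 0 < \<bar>x\<bar> \<and> \<bar>x\<bar> < 1} v (\<lambda>x. \<bar>x\<bar> powr (- 1 / 2))"
  proof (intro exI[of _ "whitham_profile c \<delta>"] conjI allI impI)
    show "AE x in lebesgue. H x = exp (- \<delta> * \<bar>x\<bar>) *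
        (whitham_profile c \<delta> x + sqrt (2 * pi) * (2 * tan \<delta> * \<delta> / (\<delta> * (1 / cos \<delta>)\<^sup>2 - tan \<delta>)))"
      using HK by eventually_elim (simp only: whitham_kernel_eq_profile[OF assms] polar_coeff_def[OF assms])
  qed (use whitham_profile_even[OF assms] whitham_profile_Lp[OF assms] whitham_profile_simeq[OF assms] in auto)
  fix u :: "real \<Rightarrow> real" and p :: ennreal
  assume u: "u \<in> Lp \<infinity> lebesgue" and lim: "(u \<longlongrightarrow> 0) at_infinity" and nz: "\<not> (AE x in lebesgue. u x = 0)"
    and eq: "AE x in lebesgue. u x * (c - u x) = fun_convolution H (\<lambda>y. (u y)\<^sup>2) x" and p: "1 \<le> p"
  \<comment> \<open>The decay estimates live over \<open>lborel\<close>, so \<open>u\<close> is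
    replaced by a Borel function \<open>g\<close>; boundedness, the limit, nontriviality and the
    equation are transferred to it one by one.\<close>
  have um: "u \<in> borel_measurable lebesgue" using u by (simp add: Lp_def)
  obtain g where g [measurable]: "g \<in> borel_measurable borel" and ug': "AE x in lborel. u x = g x"
    using completion_ex_borel_measurable_real[OF um] by auto
  have ug: "AE x in lebesgue. u x = g x" by (rule AE_completion[OF ug'])
  obtain B where "AE x in lebesgue. \<bar>u x\<bar> \<le> B" using Lp_infinityD[OF u] by blast
  then have "AE x in lborel. \<bar>u x\<bar> \<le> B" by (simp add: AE_completion_iff)
  with ug' have gB: "AE x in lborel. \<bar>g x\<bar> \<le> B" by eventually_elim simp
  have g_lim: "\<exists>R. AE x in lborel. R \<le> \<bar>x\<bar> \<longrightarrow> \<bar>g x\<bar> \<le> e" if "e > 0" for e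
  proof -
    have "\<forall>\<^sub>F x in at_infinity. dist (u x) 0 < e" using lim that by (rule tendstoD)
    then obtain R where R: "\<And>x. R \<le> norm x \<Longrightarrow> dist (u x) 0 < e" unfolding eventually_at_infinity by blast
    have "AE x in lborel. R \<le> \<bar>x\<bar> \<longrightarrow> \<bar>g x\<bar> \<le> e"
      using ug' by eventually_elim (use R in \<open>fastforce simp: dist_real_def\<close>)
    then show ?thesis by (rule exI)
  qed
  have g_nz: "\<not> (AE x in lborel. g x = 0)"
  proof
    assume "AE x in lborel. g x = 0"
    with ug' have "AE x in lborel. u x = 0" by eventually_elim simp
    then show False using nz AE_completion by blast
  qed
  have Hm: "H \<in> borel_measurable lebesgue"
    using H by (intro tempered_fun_measurable) (simp add: is_whitham_kernel_def is_tempered_inv_fourier_def)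
  have Km: "?K \<in> borel_measurable borel" using integrable_whitham_kernel[OF assms] by auto
  have um2: "(\<lambda>y. (u y)\<^sup>2) \<in> borel_measurable lebesgue" using um by measurable
  have gm2: "(\<lambda>y. (g y)\<^sup>2) \<in> borel_measurable borel" by measurable
  have ug2: "AE x in lebesgue. (u x)\<^sup>2 = (g x)\<^sup>2" using ug by eventually_elim simp
  have "AE x in lborel. u x * (c - u x) = fun_convolution H (\<lambda>y. (u y)\<^sup>2) x"
    using eq by (simp add: AE_completion_iff)
  with ug' have "AE x in lborel. g x * (c - g x) = (\<integral>y. ?K (x - y) * (g y)\<^sup>2 \<partial>lborel)"
    by eventually_elim (simp add: fun_convolution_cong_AE[OF HK Hm Km um2 gm2 ug2])
  then have g_eq: "AE x in lborel. g x * (c - g x) =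
      (\<integral>y. (regular_part c \<delta> (x - y) + polar_coeff \<delta> * exp (- \<delta> * \<bar>x - y\<bar>)) * (g y)\<^sup>2 \<partial>lborel)"
    by (simp only: whitham_kernel_def[OF assms])
  note decay = solution_decay[OF exp_kernel_regular[OF assms] assms(2,3) polar_coeff_pos[OF assms] _ g gB g_lim g_nz g_eq]
  obtain k where k: "k > 0" "AE x in lborel. k \<le> exp (\<delta> * \<bar>x\<bar>) * g x"
    using decay(1) assms(1) by auto
  obtain K where K: "AE x in lborel. exp (\<delta> * \<bar>x\<bar>) * g x \<le> K"
    using decay(2) assms(1) by auto
  have "AE x in lebesgue. k \<le> exp (\<delta> * \<bar>x\<bar>) * u x" "AE x in lebesgue. exp (\<delta> * \<bar>x\<bar>) * u x \<le> K"
    using AE_completion[OF k(2)] AE_completion[OF K] ug by (eventually_elim, simp)+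
  moreover have "(\<lambda>x. exp (\<delta> * \<bar>x\<bar>) * u x) \<in> borel_measurable lebesgue"
  proof -
    have [measurable]: "(\<lambda>x. exp (\<delta> * \<bar>x\<bar>)) \<in> borel_measurable lebesgue"
      by (intro measurable_completion) measurable
    show ?thesis using um by measurable
  qed
  ultimately show "(\<lambda>x. exp (\<delta> * \<bar>x\<bar>) * u x) \<in> Lp p lebesgue \<longleftrightarrow> p = \<infinity>"
    using Lp_iff_infinity k(1) p by blast
qed

end
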